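(* There is a holomorphic family $(M,J_a)_{a\in\Delta}$ of compact complex manifolds, where $\Delta=\{a\in\mathbb{C}\mid |a|<1\}$, such that $(M,J_a)$ has balanced metrics for each $a\in\Delta\setminus\{0\}$, but $(M,J_0)$ does not admit any strongly Gauduchon metric. In particular, the strongly Gauduchon property and the balanced property are not closed under holomorphic deformations.
   Context: A Hermitian metric with fundamental form $\Omega$ on a complex manifold of complex dimension $n$ is balanced if $d\Omega^{n-1}=0$, and strongly Gauduchon if $\partial\Omega^{n-1}$ is $\bar\partial$-exact. A compact complex manifold has the balanced (resp. strongly Gauduchon) property if it admits a balanced (resp. strongly Gauduchon) metric. A property $\mathcal{P}$ of compact complex manifolds is closed under holomorphic deformations if for every holomorphic family of compact complex manifolds $(M,J_a)_{a\in\Delta}$ over an open disc $\Delta\subset\mathbb{C}$ around the origin and every $a_0\in\Delta$: if $(M,J_a)$ has property $\mathcal{P}$ for all $a\in\Delta\setminus\{a_0\}$, then $(M,J_{a_0})$ has property $\mathcal{P}$. *)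

theory Defs
  imports "HOL-Analysis.Analysis" "HOL-Combinatorics.Permutations"
begin

section \<open>Smooth and holomorphic maps between open sets of coordinate spaces\<close>

text \<open>For open \<open>S\<close> and finite-dimensional \<open>'a\<close>, \<open>Ck_on k S f\<close> says that \<open>f\<close> is of class
  \<open>C\<^sup>k\<close> on \<open>S\<close>.\<close>

primrec Ck_on ::
  "nat \<Rightarrow> 'a::euclidean_space set \<Rightarrow> ('a \<Rightarrow> 'b::real_normed_vector) \<Rightarrow> bool" where
  "Ck_on 0 S f \<longleftrightarrow> continuous_on S f"
| "Ck_on (Suc k) S f \<longleftrightarrow>
     (\<forall>x\<in>S. f differentiable (at x)) \<and>
     (\<forall>v. Ck_on k S (\<lambda>x. frechet_derivative f (at x) v))"

definition smooth_on ::
  "'a::euclidean_space set \<Rightarrow> ('a \<Rightarrow> 'b::real_normed_vector) \<Rightarrow> bool" where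
  "smooth_on S f \<longleftrightarrow> (\<forall>k. Ck_on k S f)"

definition holomorphic_vec_on ::
  "(complex^'n) set \<Rightarrow> (complex^'n \<Rightarrow> complex^'k) \<Rightarrow> bool" where
  "holomorphic_vec_on S f \<longleftrightarrow>
     (\<forall>x\<in>S. f differentiable (at x) \<and>
        (\<forall>c v. frechet_derivative f (at x) (c *s v) = c *s frechet_derivative f (at x) v))"


section \<open>Complex manifolds\<close>

text \<open>A chart is a pair \<open>(U, \<phi>)\<close>; only the values of \<open>\<phi>\<close> on \<open>U\<close> matter. The topological
  space underlying a manifold is an abstract topology, so the type \<open>'m\<close> only provides names for
  the points and none of its own structure is used. Atlases need not be maximal. The complex
  dimension is \<open>CARD('n)\<close>.\<close>

type_synonym ('m, 'e) chart = "'m set \<times> ('m \<Rightarrow> 'e)"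
type_synonym ('m, 'n) atlas = "('m, complex^'n) chart set"

definition transition ::
  "('m, 'e) chart \<Rightarrow> ('m, 'f) chart \<Rightarrow> 'e \<Rightarrow> 'f" where
  "transition c c' = snd c' \<circ> inv_into (fst c) (snd c)"

definition is_chart ::
  "'m topology \<Rightarrow> ('m, 'e::topological_space) chart \<Rightarrow> bool" where
  "is_chart X c \<longleftrightarrow>
     openin X (fst c) \<and> open (snd c ` fst c) \<and>
     homeomorphic_map (subtopology X (fst c)) (top_of_set (snd c ` fst c)) (snd c)"

definition complex_manifold :: "'m topology \<Rightarrow> ('m, 'n::finite) atlas \<Rightarrow> bool" where
  "complex_manifold X A \<longleftrightarrow>
     Hausdorff_space X \<and> second_countable X \<and>
     (\<forall>c\<in>A. is_chart X c) \<and> (\<Union>c\<in>A. fst c) = topspace X \<and>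
     (\<forall>c\<in>A. \<forall>c'\<in>A. holomorphic_vec_on (snd c ` (fst c \<inter> fst c')) (transition c c'))"

definition compact_complex_manifold :: "'m topology \<Rightarrow> ('m, 'n::finite) atlas \<Rightarrow> bool" where
  "compact_complex_manifold X A \<longleftrightarrow> complex_manifold X A \<and> compact_space X"

text \<open>The expression of a map between manifolds in local coordinates, and its domain.\<close>

definition local_map ::
  "('m, 'e) chart \<Rightarrow> ('p, 'f) chart \<Rightarrow> ('m \<Rightarrow> 'p) \<Rightarrow> 'e \<Rightarrow> 'f" where
  "local_map c c' f = snd c' \<circ> f \<circ> inv_into (fst c) (snd c)"

definition local_dom ::
  "('m, 'e) chart \<Rightarrow> ('p, 'f) chart \<Rightarrow> ('m \<Rightarrow> 'p) \<Rightarrow> 'e set" where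
  "local_dom c c' f = snd c ` (fst c \<inter> f -` fst c')"

definition holomorphic_map ::
  "'m topology \<Rightarrow> ('m, 'n::finite) atlas \<Rightarrow> 'p topology \<Rightarrow> ('p, 'k::finite) atlas \<Rightarrow> ('m \<Rightarrow> 'p) \<Rightarrow> bool" where
  "holomorphic_map X A Y B f \<longleftrightarrow>
     continuous_map X Y f \<and>
     (\<forall>c\<in>A. \<forall>c'\<in>B. holomorphic_vec_on (local_dom c c' f) (local_map c c' f))"

definition holomorphic_submersion ::
  "'m topology \<Rightarrow> ('m, 'n::finite) atlas \<Rightarrow> 'p topology \<Rightarrow> ('p, 'k::finite) atlas \<Rightarrow> ('m \<Rightarrow> 'p) \<Rightarrow> bool" where
  "holomorphic_submersion X A Y B f \<longleftrightarrow>
     holomorphic_map X A Y B f \<and>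
     (\<forall>c\<in>A. \<forall>c'\<in>B. \<forall>x\<in>local_dom c c' f.
        surj (frechet_derivative (local_map c c' f) (at x)))"

definition smoothly_compatible ::
  "('m, 'e::euclidean_space) chart \<Rightarrow> ('m, 'f::euclidean_space) chart \<Rightarrow> bool" where
  "smoothly_compatible c c' \<longleftrightarrow>
     smooth_on (snd c ` (fst c \<inter> fst c')) (transition c c') \<and>
     smooth_on (snd c' ` (fst c \<inter> fst c')) (transition c' c)"


section \<open>Differential forms\<close>

text \<open>A complex-valued real \<open>k\<close>-covector takes a sequence of tangent vectors and uses only the
  entries with index \<open>< k\<close>.\<close>

type_synonym 'n covector = "(nat \<Rightarrow> complex^'n) \<Rightarrow> complex"

definition alternating_covector :: "nat \<Rightarrow> 'n::finite covector \<Rightarrow> bool" where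
  "alternating_covector k \<alpha> \<longleftrightarrow>
     (\<forall>v w. (\<forall>i<k. v i = w i) \<longrightarrow> \<alpha> v = \<alpha> w) \<and>
     (\<forall>v. \<forall>i<k. linear (\<lambda>u. \<alpha> (v(i := u)))) \<and>
     (\<forall>v. \<forall>i<k. \<forall>j<k. i \<noteq> j \<and> v i = v j \<longrightarrow> \<alpha> v = 0)"

definition wedge :: "nat \<Rightarrow> nat \<Rightarrow> 'n::finite covector \<Rightarrow> 'n covector \<Rightarrow> 'n covector" where
  "wedge p q \<alpha> \<beta> = (\<lambda>v. (1 / (fact p * fact q)) *
     (\<Sum>\<sigma> | \<sigma> permutes {..<p + q}.
        of_int (sign \<sigma>) * \<alpha> (\<lambda>i. v (\<sigma> i)) * \<beta> (\<lambda>i. v (\<sigma> (p + i)))))"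

text \<open>Exterior powers of a \<open>2\<close>-covector.\<close>

primrec wedge_power :: "nat \<Rightarrow> 'n::finite covector \<Rightarrow> 'n covector" where
  "wedge_power 0 \<alpha> = (\<lambda>v. 1)"
| "wedge_power (Suc m) \<alpha> = wedge 2 (2 * m) \<alpha> (wedge_power m \<alpha>)"

definition omit :: "nat \<Rightarrow> (nat \<Rightarrow> 'v) \<Rightarrow> nat \<Rightarrow> 'v" where
  "omit i v = (\<lambda>j. if j < i then v j else v (Suc j))"

text \<open>Complex-linear and conjugate-linear part of a real-linear functional.\<close>

definition part10 :: "(complex^'n \<Rightarrow> complex) \<Rightarrow> complex^'n \<Rightarrow> complex" where
  "part10 L u = (L u - \<i> * L (\<i> *s u)) / 2"

definition part01 :: "(complex^'n \<Rightarrow> complex) \<Rightarrow> complex^'n \<Rightarrow> complex" where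
  "part01 L u = (L u + \<i> * L (\<i> *s u)) / 2"

text \<open>The operators \<open>d\<close>, \<open>\<partial>\<close> and \<open>\<partial>\<close>-bar on \<open>k\<close>-forms on an open set of
  \<open>\<complex>\<^sup>n\<close>: if \<open>\<omega> = \<Sum> f\<^sub>I\<^sub>J dz\<^sub>I \<and> d(z\<^sub>J)\<^sup>*\<close>, they replace each coefficient \<open>f\<^sub>I\<^sub>J\<close> by
  its full differential, by the \<open>(1,0)\<close>-part \<open>\<Sum> (\<partial>f\<^sub>I\<^sub>J/\<partial>z\<^sub>m) dz\<^sub>m\<close> and by the
  \<open>(0,1)\<close>-part of that differential, respectively.\<close>

definition ext_d ::
  "nat \<Rightarrow> (complex^'n \<Rightarrow> 'n covector) \<Rightarrow> complex^'n \<Rightarrow> 'n covector" where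
  "ext_d k \<omega> x v =
     (\<Sum>i\<le>k. (-1)^i * frechet_derivative (\<lambda>y. \<omega> y (omit i v)) (at x) (v i))"

definition del ::
  "nat \<Rightarrow> (complex^'n \<Rightarrow> 'n covector) \<Rightarrow> complex^'n \<Rightarrow> 'n covector" where
  "del k \<omega> x v =
     (\<Sum>i\<le>k. (-1)^i * part10 (frechet_derivative (\<lambda>y. \<omega> y (omit i v)) (at x)) (v i))"

definition delbar ::
  "nat \<Rightarrow> (complex^'n \<Rightarrow> 'n covector) \<Rightarrow> complex^'n \<Rightarrow> 'n covector" where
  "delbar k \<omega> x v =
     (\<Sum>i\<le>k. (-1)^i * part01 (frechet_derivative (\<lambda>y. \<omega> y (omit i v)) (at x)) (v i))"

text \<open>A form on a manifold is the family of its expressions in the charts of the atlas, related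
  by pull-back along the coordinate changes. The expression in the chart \<open>(U, \<phi>)\<close> matters only
  on \<open>\<phi> ` U\<close>. The operators above act chart by chart.\<close>

type_synonym ('m, 'n) mform = "('m, complex^'n) chart \<Rightarrow> complex^'n \<Rightarrow> 'n covector"

definition smooth_form :: "('m, 'n::finite) atlas \<Rightarrow> nat \<Rightarrow> ('m, 'n::finite) mform \<Rightarrow> bool" where
  "smooth_form A k \<omega> \<longleftrightarrow>
     (\<forall>c\<in>A. (\<forall>x\<in>snd c ` fst c. alternating_covector k (\<omega> c x)) \<and>
            (\<forall>v. smooth_on (snd c ` fst c) (\<lambda>x. \<omega> c x v))) \<and>
     (\<forall>c\<in>A. \<forall>c'\<in>A. \<forall>x\<in>snd c ` (fst c \<inter> fst c'). \<forall>v.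
        \<omega> c x v =
        \<omega> c' (transition c c' x) (\<lambda>i. frechet_derivative (transition c c') (at x) (v i)))"

definition form_eq ::
  "('m, 'n::finite) atlas \<Rightarrow> ('m, 'n::finite) mform \<Rightarrow> ('m, 'n::finite) mform \<Rightarrow> bool" where
  "form_eq A \<omega> \<eta> \<longleftrightarrow> (\<forall>c\<in>A. \<forall>x\<in>snd c ` fst c. \<forall>v. \<omega> c x v = \<eta> c x v)"

definition delbar_exact :: "('m, 'n::finite) atlas \<Rightarrow> nat \<Rightarrow> ('m, 'n::finite) mform \<Rightarrow> bool" where
  "delbar_exact A k \<omega> \<longleftrightarrow>
     (\<exists>\<gamma> l. k = Suc l \<and> smooth_form A l \<gamma> \<and> form_eq A \<omega> (\<lambda>c. delbar l (\<gamma> c)))"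


section \<open>Hermitian metrics\<close>

text \<open>A Hermitian metric is given as a Riemannian metric \<open>g\<close> for which the complex structure
  \<open>J\<close> (multiplication by \<open>\<i>\<close> in holomorphic coordinates) is orthogonal. Its fundamental form is
  \<open>\<Omega>(u, w) = g(J u, w)\<close>.\<close>

type_synonym ('m, 'n) metric =
  "('m, complex^'n) chart \<Rightarrow> complex^'n \<Rightarrow> complex^'n \<Rightarrow> complex^'n \<Rightarrow> real"

definition hermitian_metric :: "('m, 'n::finite) atlas \<Rightarrow> ('m, 'n::finite) metric \<Rightarrow> bool" where
  "hermitian_metric A g \<longleftrightarrow>
     (\<forall>c\<in>A.
        (\<forall>x\<in>snd c ` fst c.
           (\<forall>u. linear (g c x u)) \<and>
           (\<forall>u w. g c x u w = g c x w u) \<and>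
           (\<forall>u. u \<noteq> 0 \<longrightarrow> g c x u u > 0) \<and>
           (\<forall>u w. g c x (\<i> *s u) (\<i> *s w) = g c x u w)) \<and>
        (\<forall>u w. smooth_on (snd c ` fst c) (\<lambda>x. g c x u w))) \<and>
     (\<forall>c\<in>A. \<forall>c'\<in>A. \<forall>x\<in>snd c ` (fst c \<inter> fst c'). \<forall>u w.
        g c x u w =
        g c' (transition c c' x) (frechet_derivative (transition c c') (at x) u)
                                 (frechet_derivative (transition c c') (at x) w))"

definition fundamental_form :: "('m, 'n::finite) metric \<Rightarrow> ('m, 'n::finite) mform" where
  "fundamental_form g c x v = complex_of_real (g c x (\<i> *s v 0) (v 1))"

text \<open>\<open>\<Omega>\<^bsup>n-1\<^esup>\<close>, a form of degree \<open>2 (n - 1)\<close>, where \<open>n = CARD('n) \<ge> 1\<close>.\<close>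

definition fundamental_power :: "('m, 'n::finite) metric \<Rightarrow> ('m, 'n::finite) mform" where
  "fundamental_power g c x = wedge_power (CARD('n) - 1) (fundamental_form g c x)"

definition balanced_metric :: "('m, 'n::finite) atlas \<Rightarrow> ('m, 'n::finite) metric \<Rightarrow> bool" where
  "balanced_metric A g \<longleftrightarrow> hermitian_metric A g \<and>
     form_eq A (\<lambda>c. ext_d (2 * (CARD('n) - 1)) (fundamental_power g c)) (\<lambda>c x v. 0)"

definition strongly_gauduchon_metric :: "('m, 'n::finite) atlas \<Rightarrow> ('m, 'n::finite) metric \<Rightarrow> bool" where
  "strongly_gauduchon_metric A g \<longleftrightarrow> hermitian_metric A g \<and>
     delbar_exact A (2 * (CARD('n) - 1) + 1)
       (\<lambda>c. del (2 * (CARD('n) - 1)) (fundamental_power g c))"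

definition balanced_property :: "'m topology \<Rightarrow> ('m, 'n::finite) atlas \<Rightarrow> bool" where
  "balanced_property X A \<longleftrightarrow> compact_complex_manifold X A \<and> (\<exists>g. balanced_metric A g)"

definition strongly_gauduchon_property :: "'m topology \<Rightarrow> ('m, 'n::finite) atlas \<Rightarrow> bool" where
  "strongly_gauduchon_property X A \<longleftrightarrow>
     compact_complex_manifold X A \<and> (\<exists>g. strongly_gauduchon_metric A g)"


section \<open>Holomorphic families\<close>

text \<open>The disc \<open>\<Delta>\<close> as a one-dimensional complex manifold: one chart, the identity.\<close>

definition disc_atlas :: "complex set \<Rightarrow> (complex, 1) atlas" where
  "disc_atlas \<Delta> = {(\<Delta>, vec)}"

text \<open>A holomorphic family \<open>(X, J a)\<close>, \<open>a \<in> \<Delta>\<close>, of compact complex manifolds on a fixed compact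
  space \<open>X\<close>: the product \<open>X \<times> \<Delta>\<close> carries a complex structure \<open>T\<close> of dimension \<open>n + 1\<close> for
  which the projection to \<open>\<Delta>\<close> is a holomorphic submersion (it is proper because \<open>X\<close> is compact)
  and whose fibre over \<open>a\<close> is \<open>(X, J a)\<close>. The last clause says that the smooth structure
  underlying \<open>T\<close> is the product of that of \<open>\<Delta>\<close> and of the smooth structure underlying
  \<open>J a\<close>. In particular the latter does not depend on \<open>a\<close>, and the inclusions of the fibres in
  the third clause are embeddings. By Ehresmann's theorem every proper holomorphic submersion
  onto a disc is of this form up to isomorphism.\<close>

definition holomorphic_family ::
  "complex set \<Rightarrow> 'm topology \<Rightarrow> (complex \<Rightarrow> ('m, 'n::finite) atlas) \<Rightarrow> bool" where
  "holomorphic_family \<Delta> X J \<longleftrightarrow>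
     (\<forall>a\<in>\<Delta>. compact_complex_manifold X (J a)) \<and>
     (\<exists>T :: ('m \<times> complex, 'n + 1) atlas.
        let XT = prod_topology X (top_of_set \<Delta>) in
        complex_manifold XT T \<and>
        holomorphic_submersion XT T (top_of_set \<Delta>) (disc_atlas \<Delta>) snd \<and>
        (\<forall>a\<in>\<Delta>. holomorphic_map X (J a) XT T (\<lambda>p. (p, a))) \<and>
        (\<forall>a\<in>\<Delta>. \<forall>c\<in>J a. \<forall>c'\<in>T.
           smoothly_compatible (fst c \<times> \<Delta>, \<lambda>(p, t). (snd c p, t)) c'))"

definition closed_under_holomorphic_deformations ::
  "('m topology \<Rightarrow> ('m, 'n::finite) atlas \<Rightarrow> bool) \<Rightarrow> bool" where
  "closed_under_holomorphic_deformations P \<longleftrightarrow>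
     (\<forall>r>0. \<forall>X. \<forall>J. holomorphic_family (ball 0 r) X J \<longrightarrow>
        (\<forall>a0\<in>ball 0 r. (\<forall>a\<in>ball 0 r - {a0}. P X (J a)) \<longrightarrow> P X (J a0)))"

end

(*
  Let M be the quotient of C^3, with coordinates (v, z, s), by the action of the Gaussian lattice
    (v, z, s) -> (v + l1, z + l2, s - (l1* + 2 l2* ) v - l2* z + l3),
  where * is complex conjugation. For |a| < 1 the functions
    v,  zeta = z + a z*,  w = s - a (z* )^2 / 2
  are coordinates in which the action is holomorphic, also in a; they define J_a. The form
  eps = dw + (v* + 2 z* ) dv + z* dzeta is invariant, of type (1,0), and - d eps is the pull-back of
    F = dv dv* + 2 dv dz* + dz dz*
  from the base torus. For a /= 0 there is a positive (1,1)-form eta on the base with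
  F wedge eta = 0, and the metric with fundamental form eta + i/2 eps eps* is balanced.
  For a = 0, F minus its conjugate is 2 (dv + dz)(dv* + dz* ), so that a nonzero semi-positive
  (1,1)-form is exact. Integrating del(Omega^2) wedge eps* over M gives zero if del(Omega^2) is
  delbar-exact, but by parts it gives the integral of Omega^2 against the conjugate of F, which
  does not vanish by positivity. A balanced metric is covered by the same argument, since
  then del(Omega^2) = - delbar(Omega^2). The integral is an iterated integral over a
  fundamental cube, and integration by parts is the statement that the derivatives of invariant
  functions along invariant vector fields have average zero.
*)

theory Submission
  imports Defs
begin


section \<open>Calculus of smooth functions\<close>

text \<open>What breaks down at a = 0: eps is \<open>del\<close>-closed there, so its conjugate is
  \<open>delbar\<close>-closed. Wedging with that conjugate makes a \<open>delbar\<close>-exact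
  5-form into a \<open>delbar\<close>-exact 6-form, of integral zero, whereas \<open>del\<close>
  (Omega^2) leaves a curvature term. For a /= 0 eps has a nonzero (2,0)-derivative and this
  obstruction disappears. The coefficients h of eta obey one linear equation. With D = 1 - |a|^2 the
  (1,1)-part of F has coefficients 1, 2/D, 0, 1/D, and the equation reads h22 + h11/D = 2 h21/D. The
  solution h11 = h12 = h21 = D, h22 = 1 has determinant D (1 - D), which is positive exactly for 0 <
  |a| < 1. Stokes' theorem becomes a computation on the covering C^3. \<open>del\<close> and
  \<open>delbar\<close> differentiate with constant arguments, while invariant functions, the only
  ones that can be averaged, arise by inserting an invariant frame that moves with the point. The
  difference consists of brackets of frame fields. They point in the fibre direction, and they are
  all that survives averaging.\<close>

lemma frechet_derivative_cong_open:
  assumes "open S" "x \<in> S" "\<And>y. y \<in> S \<Longrightarrow> f y = g y"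
  shows "frechet_derivative f (at x) = frechet_derivative g (at x)"
proof -
  have "(f has_derivative D) (at x) \<longleftrightarrow> (g has_derivative D) (at x)" for D
    using assms has_derivative_transform_within_open[of f D x UNIV S g]
      has_derivative_transform_within_open[of g D x UNIV S f] by auto
  then show ?thesis
    by (simp add: frechet_derivative_def)
qed

lemma Ck_on_cong:
  assumes "open S" "\<And>x. x \<in> S \<Longrightarrow> f x = g x" "Ck_on k S f"
  shows "Ck_on k S g"
  using assms(2,3)
proof (induction k arbitrary: f g)
  case 0
  then show ?case by (simp cong: continuous_on_cong)
next
  case (Suc k)
  have "g differentiable (at x)" if "x \<in> S" for x
    using Suc.prems that has_derivative_transform_within_open[OF _ assms(1) that, of f _ UNIV g]
    by (auto simp: differentiable_def) blast
  moreover have "Ck_on k S (\<lambda>x. frechet_derivative g (at x) v)" for v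
  proof (rule Suc.IH)
    show "frechet_derivative f (at x) v = frechet_derivative g (at x) v" if "x \<in> S" for x
      using frechet_derivative_cong_open[OF assms(1) that Suc.prems(1)] by simp
    show "Ck_on k S (\<lambda>x. frechet_derivative f (at x) v)"
      using Suc.prems(2) by simp
  qed
  ultimately show ?case by simp
qed

text \<open>Differentiation rules produce some derivative \<open>f'\<close>, while
  \<open>Ck_on\<close> speaks of \<open>frechet_derivative\<close>; both agree on the open set, so
  smoothness may be checked on \<open>f'\<close>.\<close>

lemma Ck_on_SucI:
  assumes "open S" "\<And>x. x \<in> S \<Longrightarrow> (f has_derivative f' x) (at x)"
    and "\<And>v. Ck_on k S (\<lambda>x. f' x v)"
  shows "Ck_on (Suc k) S f"
proof -
  have "Ck_on k S (\<lambda>x. frechet_derivative f (at x) v)" for v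
  proof (rule Ck_on_cong[OF assms(1) _ assms(3)[of v]])
    show "f' x v = frechet_derivative f (at x) v" if "x \<in> S" for x
      using frechet_derivative_at[OF assms(2)[OF that]] by simp
  qed
  with assms(2) show ?thesis
    by (auto simp: differentiable_def)
qed

lemma Ck_on_subset: "Ck_on k S f \<Longrightarrow> T \<subseteq> S \<Longrightarrow> Ck_on k T f"
  by (induction k arbitrary: f) (auto intro: continuous_on_subset)

lemma Ck_on_local:
  assumes "\<And>x. x \<in> S \<Longrightarrow> \<exists>N. open N \<and> x \<in> N \<and> Ck_on k N f"
  shows "Ck_on k S f"
  using assms
proof (induction k arbitrary: f)
  case 0
  then show ?case
    by (metis Ck_on.simps(1) continuous_at_imp_continuous_on continuous_on_eq_continuous_at)
next
  case (Suc k)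
  show ?case
    unfolding Ck_on.simps
  proof (intro conjI ballI allI)
    fix x assume "x \<in> S"
    then show "f differentiable at x"
      using Suc.prems by (metis Ck_on.simps(2))
  next
    fix v
    show "Ck_on k S (\<lambda>x. frechet_derivative f (at x) v)"
      using Suc.prems by (intro Suc.IH) (metis Ck_on.simps(2))
  qed
qed

lemma Ck_on_SucD: "Ck_on (Suc k) S f \<Longrightarrow> Ck_on k S f"
proof (induction k arbitrary: f)
  case 0
  then show ?case
    by (simp add: continuous_at_imp_continuous_on differentiable_imp_continuous_within)
qed auto

lemma Ck_on_const: "Ck_on k S (\<lambda>x. c)"
proof (induction k arbitrary: c)
  case (Suc k)
  have "frechet_derivative (\<lambda>x::'a. c) (at x) = (\<lambda>v. 0)" for x
    by (rule frechet_derivative_at[symmetric]) (rule has_derivative_const)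
  with Suc show ?case by simp
qed simp

lemma Ck_on_bounded_linear:
  assumes "open S" "bounded_linear L" "Ck_on k S f"
  shows "Ck_on k S (\<lambda>x. L (f x))"
  using assms(3)
proof (induction k arbitrary: f)
  case 0
  then show ?case
    by (simp add: bounded_linear.continuous_on[OF assms(2)])
next
  case (Suc k)
  have D: "((\<lambda>x. L (f x)) has_derivative (\<lambda>v. L (frechet_derivative f (at x) v))) (at x)"
    if "x \<in> S" for x
    using Suc.prems that
    by (simp add: bounded_linear.has_derivative[OF assms(2)] frechet_derivative_works[symmetric])
  have "Ck_on k S (\<lambda>x. L (frechet_derivative f (at x) v))" for v
    using Suc by simp
  from Ck_on_SucI[OF assms(1) D this] show ?case .
qed

lemma Ck_on_id: "open S \<Longrightarrow> Ck_on k S (\<lambda>x. x)"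
proof (cases k)
  case (Suc m)
  have "frechet_derivative (\<lambda>x::'a. x) (at x) = (\<lambda>v. v)" for x
    by (rule frechet_derivative_at[symmetric]) (rule has_derivative_ident)
  with Suc show ?thesis by (simp add: Ck_on_const)
qed simp

lemma Ck_on_add:
  assumes "open S" "Ck_on k S f" "Ck_on k S g"
  shows "Ck_on k S (\<lambda>x. f x + g x)"
  using assms(2,3)
proof (induction k arbitrary: f g)
  case 0
  then show ?case by (simp add: continuous_on_add)
next
  case (Suc k)
  have D: "((\<lambda>x. f x + g x) has_derivative
      (\<lambda>v. frechet_derivative f (at x) v + frechet_derivative g (at x) v)) (at x)"
    if "x \<in> S" for x
    using Suc.prems that by (intro has_derivative_add) (auto simp: frechet_derivative_works[symmetric])
  have "Ck_on k S (\<lambda>x. frechet_derivative f (at x) v + frechet_derivative g (at x) v)" for v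
    using Suc by simp
  from Ck_on_SucI[OF assms(1) D this] show ?case .
qed

lemma Ck_on_bounded_bilinear:
  assumes "open S" "bounded_bilinear pr" "Ck_on k S f" "Ck_on k S g"
  shows "Ck_on k S (\<lambda>x. pr (f x) (g x))"
  using assms(3,4)
proof (induction k arbitrary: f g)
  case 0
  then show ?case by (simp add: bounded_bilinear.continuous_on[OF assms(2)])
next
  case (Suc k)
  have D: "((\<lambda>x. pr (f x) (g x)) has_derivative
      (\<lambda>v. pr (f x) (frechet_derivative g (at x) v) + pr (frechet_derivative f (at x) v) (g x))) (at x)"
    if "x \<in> S" for x
    using Suc.prems that
    by (intro bounded_bilinear.FDERIV[OF assms(2)]) (auto simp: frechet_derivative_works[symmetric])
  \<comment> \<open>The product rule mixes orders: \<open>f\<close> and \<open>g\<close> occur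
    undifferentiated beside their derivatives.\<close>
  have "Ck_on k S f" "Ck_on k S g"
    using Suc.prems by (auto intro: Ck_on_SucD)
  then have "Ck_on k S (\<lambda>x. pr (f x) (frechet_derivative g (at x) v) +
      pr (frechet_derivative f (at x) v) (g x))" for v
    using Suc by (intro Ck_on_add[OF assms(1)] Suc.IH) auto
  from Ck_on_SucI[OF assms(1) D this] show ?case .
qed

lemma Ck_on_inverse:
  fixes f :: "'a::euclidean_space \<Rightarrow> 'b::real_normed_field"
  assumes "open S" "Ck_on k S f" "\<And>x. x \<in> S \<Longrightarrow> f x \<noteq> 0"
  shows "Ck_on k S (\<lambda>x. inverse (f x))"
  using assms(2)
proof (induction k)
  case 0
  then show ?case by (simp add: continuous_on_inverse assms(3))
next
  case (Suc k)
  have D: "((\<lambda>x. inverse (f x)) has_derivative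
      (\<lambda>v. - (inverse (f x) * frechet_derivative f (at x) v * inverse (f x)))) (at x)"
    if "x \<in> S" for x
    using Suc.prems that assms(3) by (intro Deriv.has_derivative_inverse) (auto simp: frechet_derivative_works[symmetric])
  have inv: "Ck_on k S (\<lambda>x. inverse (f x))"
    using Suc Ck_on_SucD by blast
  have "Ck_on k S (\<lambda>x. - (inverse (f x) * frechet_derivative f (at x) v * inverse (f x)))" for v
    using Suc.prems
    by (intro Ck_on_bounded_linear[OF assms(1) bounded_linear_minus[OF bounded_linear_ident]]
        Ck_on_bounded_bilinear[OF assms(1) bounded_bilinear_mult] inv) auto
  from Ck_on_SucI[OF assms(1) D this] show ?case .
qed

lemma smooth_on_const: "smooth_on S (\<lambda>x. c)"
  by (simp add: smooth_on_def Ck_on_const)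

lemma smooth_on_id: "open S \<Longrightarrow> smooth_on S (\<lambda>x. x)"
  by (simp add: smooth_on_def Ck_on_id)

lemma smooth_on_add:
  "open S \<Longrightarrow> smooth_on S f \<Longrightarrow> smooth_on S g \<Longrightarrow> smooth_on S (\<lambda>x. f x + g x)"
  by (simp add: smooth_on_def Ck_on_add)

lemma smooth_on_bounded_linear:
  "bounded_linear L \<Longrightarrow> open S \<Longrightarrow> smooth_on S f \<Longrightarrow> smooth_on S (\<lambda>x. L (f x))"
  by (simp add: smooth_on_def Ck_on_bounded_linear)

lemmas smooth_on_minus = smooth_on_bounded_linear[OF bounded_linear_minus[OF bounded_linear_ident]]
lemmas smooth_on_cnj = smooth_on_bounded_linear[OF bounded_linear_cnj]
lemmas smooth_on_Re = smooth_on_bounded_linear[OF bounded_linear_Re]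
lemmas smooth_on_nth = smooth_on_bounded_linear[OF bounded_linear_vec_nth]
lemmas smooth_on_fst = smooth_on_bounded_linear[OF bounded_linear_fst]
lemmas smooth_on_snd = smooth_on_bounded_linear[OF bounded_linear_snd]

lemma smooth_on_diff:
  "open S \<Longrightarrow> smooth_on S f \<Longrightarrow> smooth_on S g \<Longrightarrow> smooth_on S (\<lambda>x. f x - g x)"
  using smooth_on_add[of S f "\<lambda>x. - g x"] by (simp add: smooth_on_minus)

lemma smooth_on_mult:
  fixes f g :: "'a::euclidean_space \<Rightarrow> 'b::real_normed_algebra"
  shows "open S \<Longrightarrow> smooth_on S f \<Longrightarrow> smooth_on S g \<Longrightarrow> smooth_on S (\<lambda>x. f x * g x)"
  by (simp add: smooth_on_def Ck_on_bounded_bilinear bounded_bilinear_mult)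

lemma smooth_on_power:
  fixes f :: "'a::euclidean_space \<Rightarrow> 'b::{real_normed_algebra_1}"
  shows "open S \<Longrightarrow> smooth_on S f \<Longrightarrow> smooth_on S (\<lambda>x. f x ^ n)"
  by (induction n) (simp_all add: smooth_on_const smooth_on_mult)

lemma smooth_on_divide:
  fixes f g :: "'a::euclidean_space \<Rightarrow> 'b::real_normed_field"
  shows "open S \<Longrightarrow> smooth_on S f \<Longrightarrow> smooth_on S g \<Longrightarrow> (\<And>x. x \<in> S \<Longrightarrow> g x \<noteq> 0) \<Longrightarrow>
    smooth_on S (\<lambda>x. f x / g x)"
  by (simp add: divide_inverse smooth_on_mult) (simp add: smooth_on_def Ck_on_inverse
      Ck_on_bounded_bilinear[OF _ bounded_bilinear_mult])

lemma smooth_on_sum: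
  assumes "open S" "\<And>i. i \<in> I \<Longrightarrow> smooth_on S (f i)"
  shows "smooth_on S (\<lambda>x. \<Sum>i\<in>I. f i x)"
  using assms(2)
  by (induction I rule: infinite_finite_induct)
    (simp_all add: smooth_on_const smooth_on_add[OF assms(1)])

lemma smooth_on_vec_lambda:
  fixes f :: "'n::finite \<Rightarrow> 'a::euclidean_space \<Rightarrow> 'b::euclidean_space"
  assumes "open S" "\<And>i. smooth_on S (f i)"
  shows "smooth_on S (\<lambda>x. \<chi> i. f i x)"
proof -
  have L: "bounded_linear (axis i :: 'b \<Rightarrow> 'b ^ 'n)" for i
    by (auto simp: linear_conv_bounded_linear[symmetric] linear_iff axis_def vec_eq_iff)
  have "smooth_on S (\<lambda>x. \<Sum>i\<in>UNIV. axis i (f i x))"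
    by (intro smooth_on_sum smooth_on_bounded_linear[OF L] assms)
  moreover have "(\<Sum>i\<in>UNIV. axis i (f i x)) = (\<chi> i. f i x)" for x
    by (simp add: vec_eq_iff axis_def if_distrib cong: if_cong)
  ultimately show ?thesis by simp
qed

lemma smooth_on_Pair:
  assumes "open S" "smooth_on S f" "smooth_on S g"
  shows "smooth_on S (\<lambda>x. (f x, g x))"
proof -
  have "smooth_on S (\<lambda>x. (f x, 0) + (0, g x))"
    by (intro smooth_on_add assms(1)
        smooth_on_bounded_linear[OF bounded_linear_Pair[OF bounded_linear_ident bounded_linear_zero]]
        smooth_on_bounded_linear[OF bounded_linear_Pair[OF bounded_linear_zero bounded_linear_ident]]
        assms(2,3))
  then show ?thesis by simp
qed

text \<open>Coordinate changes of a quotient have an explicit formula only near each point, with a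
  lattice element that may vary.\<close>

lemma smooth_on_local:
  assumes "\<And>x. x \<in> S \<Longrightarrow> \<exists>N g. open N \<and> x \<in> N \<and> smooth_on N g \<and> (\<forall>y\<in>N. f y = g y)"
  shows "smooth_on S f"
  unfolding smooth_on_def
proof (intro allI Ck_on_local)
  fix k x assume "x \<in> S"
  then obtain N g where "open N" "x \<in> N" "smooth_on N g" "\<forall>y\<in>N. f y = g y"
    using assms by blast
  then have "Ck_on k N f"
    by (intro Ck_on_cong[of N g f]) (auto simp: smooth_on_def)
  with \<open>open N\<close> \<open>x \<in> N\<close> show "\<exists>N. open N \<and> x \<in> N \<and> Ck_on k N f"
    by blast
qed

lemmas smooth_on_intros = smooth_on_const smooth_on_id smooth_on_add smooth_on_minus smooth_on_diff
  smooth_on_mult smooth_on_power smooth_on_divide smooth_on_cnj smooth_on_Re smooth_on_nth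
  smooth_on_fst smooth_on_snd smooth_on_vec_lambda smooth_on_Pair


definition vec3 :: "complex \<Rightarrow> complex \<Rightarrow> complex \<Rightarrow> complex^3" where
  "vec3 a b c = (\<chi> i. if i = 1 then a else if i = 2 then b else c)"

lemma vec3_nth [simp]: "vec3 a b c $ 1 = a" "vec3 a b c $ 2 = b" "vec3 a b c $ 3 = c"
  by (simp_all add: vec3_def)

lemma vec3_collapse [simp]: "vec3 (x $ 1) (x $ 2) (x $ 3) = x"
  by (simp add: vec_eq_iff forall_3)

lemma vec3_eqI: "x $ 1 = y $ 1 \<Longrightarrow> x $ 2 = y $ 2 \<Longrightarrow> x $ 3 = y $ 3 \<Longrightarrow> x = (y :: complex^3)"
  by (simp add: vec_eq_iff forall_3)

lemma continuous_on_vec3 [continuous_intros]: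
  assumes "continuous_on S f" "continuous_on S g" "continuous_on S h"
  shows "continuous_on S (\<lambda>x. vec3 (f x) (g x) (h x))"
  unfolding vec3_def
proof (rule continuous_on_vec_lambda)
  show "continuous_on S (\<lambda>x. if i = 1 then f x else if i = 2 then g x else h x)" for i :: 3
    using assms by (cases "i = 1"; cases "i = 2") simp_all
qed

lemma has_derivative_vec3 [derivative_intros]:
  assumes "(f has_derivative f') F" "(g has_derivative g') F" "(h has_derivative h') F"
  shows "((\<lambda>x. vec3 (f x) (g x) (h x)) has_derivative (\<lambda>v. vec3 (f' v) (g' v) (h' v))) F"
proof -
  have L: "bounded_linear (axis i :: complex \<Rightarrow> complex ^ 3)" for i
    by (auto simp: linear_conv_bounded_linear[symmetric] linear_iff axis_def vec_eq_iff)
  have eq: "vec3 a b c = axis 1 a + axis 2 b + axis 3 c" for a b c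
    by (rule vec3_eqI) (simp_all add: axis_def)
  show ?thesis
    unfolding eq by (intro has_derivative_add bounded_linear.has_derivative[OF L] assms)
qed

lemma smooth_on_vec3:
  assumes "open S" "smooth_on S f" "smooth_on S g" "smooth_on S h"
  shows "smooth_on S (\<lambda>x. vec3 (f x) (g x) (h x))"
  unfolding vec3_def
proof (rule smooth_on_vec_lambda[OF assms(1)])
  show "smooth_on S (\<lambda>x. if i = 1 then f x else if i = 2 then g x else h x)" for i :: 3
    using assms by (cases "i = 1"; cases "i = 2") simp_all
qed


section \<open>The lattice action\<close>

definition gauss_ints :: "complex set" where
  "gauss_ints = {z. Re z \<in> \<int> \<and> Im z \<in> \<int>}"

definition lat :: "(complex^3) set" where
  "lat = {l. \<forall>i. l $ i \<in> gauss_ints}"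

text \<open>As a binary operation this is the multiplication of a nilpotent group on C^3, and the
  lattice acts by left translations. It is affine and holomorphic in \<open>x\<close>, but its
  coefficients contain conjugates of \<open>l\<close>.\<close>

definition act :: "complex^3 \<Rightarrow> complex^3 \<Rightarrow> complex^3" where
  "act l x = vec3 (x$1 + l$1) (x$2 + l$2)
     (x$3 - (cnj (l$1) + 2 * cnj (l$2)) * x$1 - cnj (l$2) * x$2 + l$3)"

text \<open>The element of the group that takes \<open>x\<close> to \<open>y\<close>.\<close>

definition displacement :: "complex^3 \<Rightarrow> complex^3 \<Rightarrow> complex^3" where
  "displacement x y = vec3 (y$1 - x$1) (y$2 - x$2)
     (y$3 - x$3 + (cnj (y$1 - x$1) + 2 * cnj (y$2 - x$2)) * x$1 + cnj (y$2 - x$2) * x$2)"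

text \<open>The quotient needs points of an existing type, so an orbit is represented by one of its
  elements. The choice depends only on the orbit as a predicate; hence equivalent points get the
  same representative.\<close>

definition proj :: "complex^3 \<Rightarrow> complex^3" where
  "proj x = (SOME y. \<exists>l\<in>lat. y = act l x)"

definition nil_top :: "(complex^3) topology" where
  "nil_top = topology (\<lambda>U. U \<subseteq> range proj \<and> open (proj -` U))"

lemma gauss_ints_closed [intro]:
  "0 \<in> gauss_ints" "a \<in> gauss_ints \<Longrightarrow> b \<in> gauss_ints \<Longrightarrow> a + b \<in> gauss_ints"
  "a \<in> gauss_ints \<Longrightarrow> b \<in> gauss_ints \<Longrightarrow> a - b \<in> gauss_ints"
  "a \<in> gauss_ints \<Longrightarrow> b \<in> gauss_ints \<Longrightarrow> a * b \<in> gauss_ints"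
  "a \<in> gauss_ints \<Longrightarrow> cnj a \<in> gauss_ints" "a \<in> gauss_ints \<Longrightarrow> - a \<in> gauss_ints"
  "numeral n \<in> gauss_ints"
  by (auto simp: gauss_ints_def)

lemma lat_iff: "l \<in> lat \<longleftrightarrow> l$1 \<in> gauss_ints \<and> l$2 \<in> gauss_ints \<and> l$3 \<in> gauss_ints"
  by (simp add: lat_def forall_3)

lemma act_0 [simp]: "act 0 x = x"
  by (rule vec3_eqI) (simp_all add: act_def)

lemma act_displacement [simp]: "act (displacement x y) x = y"
  by (rule vec3_eqI) (simp_all add: act_def displacement_def algebra_simps)

lemma displacement_act [simp]: "displacement x (act l x) = l"
  by (rule vec3_eqI) (simp_all add: act_def displacement_def algebra_simps)

lemma act_act:
  assumes "k \<in> lat" "l \<in> lat"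
  shows "\<exists>m\<in>lat. \<forall>x. act l (act k x) = act m x"
proof
  \<comment> \<open>The product \<open>act l k\<close>. It stays in \<open>lat\<close> because the
    Gaussian integers form a ring closed under conjugation.\<close>
  let ?m = "vec3 (k$1 + l$1) (k$2 + l$2)
    (k$3 + l$3 - (cnj (l$1) + 2 * cnj (l$2)) * k$1 - cnj (l$2) * k$2)"
  show "?m \<in> lat"
    using assms by (auto simp: lat_iff intro!: gauss_ints_closed)
  show "\<forall>x. act l (act k x) = act ?m x"
    by (auto intro!: vec3_eqI simp: act_def algebra_simps)
qed

lemma act_inverse:
  assumes "k \<in> lat"
  shows "\<exists>m\<in>lat. \<forall>x. act m (act k x) = x"
proof
  \<comment> \<open>The solution of \<open>act m k = 0\<close>.\<close>
  let ?m = "vec3 (- k$1) (- k$2)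
    (- k$3 - (cnj (k$1) + 2 * cnj (k$2)) * k$1 - cnj (k$2) * k$2)"
  show "?m \<in> lat"
    using assms by (auto simp: lat_iff intro!: gauss_ints_closed)
  show "\<forall>x. act ?m (act k x) = x"
    by (auto intro!: vec3_eqI simp: act_def algebra_simps)
qed

lemma proj_eq_iff: "proj x = proj y \<longleftrightarrow> (\<exists>l\<in>lat. y = act l x)"
proof
  assume eq: "proj x = proj y"
  have "0 \<in> lat" by (simp add: lat_def gauss_ints_closed)
  then have ex: "\<exists>l\<in>lat. proj w = act l w" for w
    unfolding proj_def by (intro someI_ex[of "\<lambda>y. \<exists>l\<in>lat. y = act l w"]) blast
  obtain k l where kl: "k \<in> lat" "l \<in> lat" "act k x = act l y"
    using ex[of x] ex[of y] eq by metis
  obtain m where m: "m \<in> lat" "y = act m (act k x)"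
    using act_inverse[OF kl(2)] kl(3) by metis
  then show "\<exists>l\<in>lat. y = act l x"
    using act_act[OF kl(1) m(1)] by metis
next
  assume "\<exists>l\<in>lat. y = act l x"
  then obtain l where l: "l \<in> lat" "y = act l x" by blast
  have "(\<exists>k\<in>lat. w = act k x) \<longleftrightarrow> (\<exists>k\<in>lat. w = act k y)" for w
  proof
    assume "\<exists>k\<in>lat. w = act k x"
    then obtain k where k: "k \<in> lat" "w = act k x" by blast
    obtain m where m: "m \<in> lat" "x = act m y"
      using act_inverse[OF l(1)] l(2) by metis
    show "\<exists>k\<in>lat. w = act k y"
      using act_act[OF m(1) k(1)] m(2) k(2) by metis
  next
    assume "\<exists>k\<in>lat. w = act k y"
    then show "\<exists>k\<in>lat. w = act k x"
      using act_act[OF l(1)] l(2) by metis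
  qed
  then show "proj x = proj y"
    by (simp add: proj_def)
qed

text \<open>Equivalence of two points becomes a condition on one continuous function. Closedness of
  \<open>lat\<close> then gives the Hausdorff property, and discreteness the local injectivity of
  \<open>proj\<close>.\<close>

lemma proj_eq_iff_displacement: "proj x = proj y \<longleftrightarrow> displacement x y \<in> lat"
  unfolding proj_eq_iff by (metis act_displacement displacement_act)

lemma proj_act [simp]: "l \<in> lat \<Longrightarrow> proj (act l x) = proj x"
  using proj_eq_iff by metis

lemma continuous_on_displacement: "continuous_on UNIV (\<lambda>p. displacement (fst p) (snd p))"
  unfolding displacement_def by (intro continuous_intros)

lemma continuous_on_act: "continuous_on S (act l)"
  unfolding act_def by (intro continuous_intros)

lemma closed_gauss_ints: "closed gauss_ints"
proof -
  have eq: "gauss_ints = Re -` \<int> \<inter> Im -` \<int>"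
    by (auto simp: gauss_ints_def)
  show ?thesis
    unfolding eq by (intro closed_Int continuous_closed_vimage closed_Ints) (auto intro: continuous_intros)
qed

lemma closed_lat: "closed lat"
proof -
  have eq: "lat = (\<Inter>i. (\<lambda>l. l $ i) -` gauss_ints)"
    by (auto simp: lat_def)
  show ?thesis
    unfolding eq
    by (intro closed_INT ballI continuous_closed_vimage closed_gauss_ints) (auto intro: continuous_intros)
qed

lemma gauss_ints_small: "z \<in> gauss_ints \<Longrightarrow> norm z < 1 \<Longrightarrow> z = 0"
proof -
  assume z: "z \<in> gauss_ints" "norm z < 1"
  have "\<bar>Re z\<bar> < 1" "\<bar>Im z\<bar> < 1"
    using z(2) abs_Re_le_cmod[of z] abs_Im_le_cmod[of z] by linarith+
  then have "Re z = 0" "Im z = 0"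
    using z(1) Ints_nonzero_abs_less1 by (auto simp: gauss_ints_def)
  then show ?thesis by (simp add: complex_eq_iff)
qed


section \<open>The quotient space\<close>

lemma openin_nil_top: "openin nil_top U \<longleftrightarrow> U \<subseteq> range proj \<and> open (proj -` U)"
proof -
  have "istopology (\<lambda>U. U \<subseteq> range proj \<and> open (proj -` U))"
    unfolding istopology_def by (auto simp: vimage_Int vimage_Union)
  then show ?thesis
    by (simp add: nil_top_def topology_inverse')
qed

lemma topspace_nil_top [simp]: "topspace nil_top = range proj"
proof (rule subset_antisym)
  show "topspace nil_top \<subseteq> range proj"
    using openin_topspace[of nil_top] by (simp only: openin_nil_top)
  have "proj -` range proj = UNIV" by blast
  then have "openin nil_top (range proj)"
    by (simp only: openin_nil_top) simp
  then show "range proj \<subseteq> topspace nil_top"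
    by (rule openin_subset)
qed

lemma continuous_map_proj: "continuous_map euclidean nil_top proj"
  unfolding continuous_map by (auto simp: openin_nil_top vimage_def)

lemma proj_vimage_image:
  "proj -` (proj ` U) = (\<Union>l\<in>lat. act l -` U)"
proof (intro set_eqI iffI)
  fix x assume "x \<in> proj -` (proj ` U)"
  then obtain u where "u \<in> U" "proj x = proj u" by auto
  then show "x \<in> (\<Union>l\<in>lat. act l -` U)"
    unfolding proj_eq_iff by auto
next
  fix x assume "x \<in> (\<Union>l\<in>lat. act l -` U)"
  then obtain l where "l \<in> lat" "act l x \<in> U" by auto
  then show "x \<in> proj -` (proj ` U)"
    by (metis imageI proj_act vimageI2)
qed

lemma open_map_proj: "open_map euclidean nil_top proj"
proof -
  have "open (act l -` U)" if "open U" for l U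
    using that continuous_on_act by (auto intro: open_vimage)
  then have "open (proj -` (proj ` U))" if "open U" for U
    using that unfolding proj_vimage_image by blast
  then show ?thesis
    by (auto simp: open_map_def openin_nil_top)
qed

lemma Hausdorff_nil_top: "Hausdorff_space nil_top"
  unfolding Hausdorff_space_def
proof (intro allI impI)
  fix p q assume "p \<in> topspace nil_top \<and> q \<in> topspace nil_top \<and> p \<noteq> q"
  then obtain x y where xy: "p = proj x" "q = proj y" "proj x \<noteq> proj y"
    by auto
  let ?R = "(\<lambda>p. displacement (fst p) (snd p)) -` (- lat)"
  have "open ?R"
    using closed_lat continuous_on_displacement by (intro open_vimage) auto
  moreover have "(x, y) \<in> ?R"
    using xy by (simp add: proj_eq_iff_displacement)
  ultimately obtain A B where AB: "open A" "open B" "(x, y) \<in> A \<times> B" "A \<times> B \<subseteq> ?R"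
    by (rule open_prod_elim)
  have "proj a \<noteq> proj b" if "a \<in> A" "b \<in> B" for a b
    using AB(4) that unfolding proj_eq_iff_displacement by auto
  then have "disjnt (proj ` A) (proj ` B)"
    by (auto simp: disjnt_iff)
  moreover have "openin nil_top (proj ` A)" "openin nil_top (proj ` B)"
    using AB open_map_proj by (auto simp: open_map_def)
  ultimately show "\<exists>U V. openin nil_top U \<and> openin nil_top V \<and> p \<in> U \<and> q \<in> V \<and> disjnt U V"
    using AB xy by blast
qed

lemma second_countable_euclidean: "second_countable (euclidean :: 'a::second_countable_topology topology)"
proof -
  obtain B :: "'a set set" where B: "countable B" "topological_basis B"
    using ex_countable_basis by blast
  have "\<forall>U x. openin euclidean U \<and> x \<in> U \<longrightarrow> (\<exists>V\<in>B. x \<in> V \<and> V \<subseteq> U)"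
    using topological_basisE[OF B(2)] by (metis open_openin)
  moreover have "\<forall>V\<in>B. openin euclidean V"
    using topological_basis_open[OF B(2)] by simp
  ultimately show ?thesis
    unfolding second_countable_def using B(1) by (intro exI[of _ B] conjI)
qed

lemma second_countable_nil_top: "second_countable nil_top"
  using second_countable_open_map_image[OF continuous_map_proj open_map_proj _ second_countable_euclidean]
  by simp

lemma compact_space_nil_top: "compact_space nil_top"
proof -
  define Q where "Q = cbox 0 (Complex 1 1)"
  define K where "K = (\<lambda>(a, b, c). vec3 a b c) ` (Q \<times> Q \<times> Q)"
  define fl where "fl z = Complex (of_int \<lfloor>Re z\<rfloor>) (of_int \<lfloor>Im z\<rfloor>)" for z
  have fl: "fl z \<in> gauss_ints" "z - fl z \<in> Q" for z
  proof -
    show "fl z \<in> gauss_ints" by (simp add: fl_def gauss_ints_def)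
    have "\<lfloor>Re z\<rfloor> \<le> Re z" "Re z - \<lfloor>Re z\<rfloor> \<le> 1" "\<lfloor>Im z\<rfloor> \<le> Im z" "Im z - \<lfloor>Im z\<rfloor> \<le> 1"
      by linarith+
    then show "z - fl z \<in> Q"
      by (simp add: fl_def Q_def in_cbox_complex_iff)
  qed
  have "compact K"
    unfolding K_def case_prod_unfold
    by (intro compact_continuous_image compact_Times continuous_intros) (simp_all add: Q_def)
  moreover have "proj ` K = range proj"
  proof (intro equalityI subsetI)
    fix p assume "p \<in> range proj"
    then obtain x where p: "p = proj x" by auto
    \<comment> \<open>Two successive reductions: moving the first two coordinates by
      \<open>l\<close> also shears the third, which \<open>k\<close> then corrects by a pure
      translation.\<close>
    define l where "l = vec3 (- fl (x$1)) (- fl (x$2)) 0"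
    define k where "k = vec3 0 0 (- fl (act l x $ 3))"
    have lat: "l \<in> lat" "k \<in> lat"
      by (auto simp: lat_iff l_def k_def gauss_ints_closed fl)
    have "act k (act l x) = vec3 (x$1 - fl (x$1)) (x$2 - fl (x$2)) (act l x $ 3 - fl (act l x $ 3))"
      by (rule vec3_eqI) (simp_all add: act_def k_def l_def)
    then have "act k (act l x) \<in> K"
      using fl(2) by (auto simp: K_def intro!: image_eqI[of _ _ "(a, b, c)" for a b c])
    moreover have "p = proj (act k (act l x))"
      using lat p by simp
    ultimately show "p \<in> proj ` K" by blast
  qed auto
  ultimately show ?thesis
    using image_compactin[OF _ continuous_map_proj] by (metis compact_space_def compactin_euclidean_iff topspace_nil_top)
qed


section \<open>Charts from sheets of a covering\<close>

text \<open>All charts below arise from a covering \<open>p\<close>, a set \<open>W\<close> on which \<open>p\<close> is injective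
  and global coordinates \<open>\<kappa>\<close> on the covering space. Coordinate changes can then be computed on
  the covering space, where they are given by lifts.\<close>

definition is_sheet :: "('m, 'e) chart \<Rightarrow> ('a \<Rightarrow> 'm) \<Rightarrow> ('a \<Rightarrow> 'e) \<Rightarrow> 'a set \<Rightarrow> bool" where
  "is_sheet c p \<kappa> W \<longleftrightarrow> fst c = p ` W \<and> (\<forall>w\<in>W. snd c (p w) = \<kappa> w)"

definition sheet_chart :: "('a \<Rightarrow> 'm) \<Rightarrow> ('a \<Rightarrow> 'e) \<Rightarrow> 'a set \<Rightarrow> ('m, 'e) chart" where
  "sheet_chart p \<kappa> W = (p ` W, \<kappa> \<circ> inv_into W p)"

lemma is_sheet_sheet_chart: "inj_on p W \<Longrightarrow> is_sheet (sheet_chart p \<kappa> W) p \<kappa> W"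
  by (simp add: is_sheet_def sheet_chart_def)

lemma is_sheet_image: "is_sheet c p \<kappa> W \<Longrightarrow> snd c ` fst c = \<kappa> ` W"
  by (force simp: is_sheet_def)

lemma is_sheet_inv_into:
  assumes "is_sheet c p \<kappa> W" "inj_on \<kappa> W" "w \<in> W"
  shows "inv_into (fst c) (snd c) (\<kappa> w) = p w"
  using assms unfolding is_sheet_def by (intro inv_into_f_eq inj_onI) (auto dest: inj_onD)

lemma local_map_sheet:
  assumes "is_sheet c p \<kappa> W" "is_sheet c' p' \<kappa>' W'" "inj_on \<kappa> W"
    and "w \<in> W" "w' \<in> W'" "f (p w) = p' w'"
  shows "local_map c c' f (\<kappa> w) = \<kappa>' w'"
  using is_sheet_inv_into[OF assms(1,3,4)] assms(2,5,6) by (simp add: local_map_def is_sheet_def)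

lemma local_dom_sheet:
  assumes "is_sheet c p \<kappa> W" "is_sheet c' p' \<kappa>' W'"
  shows "local_dom c c' f = \<kappa> ` {w \<in> W. \<exists>w'\<in>W'. f (p w) = p' w'}"
proof -
  have "fst c \<inter> f -` fst c' = p ` {w \<in> W. \<exists>w'\<in>W'. f (p w) = p' w'}"
    using assms unfolding is_sheet_def by (auto simp: image_iff)
  moreover have "snd c ` p ` V = \<kappa> ` V" if "V \<subseteq> W" for V
    unfolding image_image using assms(1) that by (intro image_cong) (auto simp: is_sheet_def)
  ultimately show ?thesis
    by (simp add: local_dom_def)
qed

lemma transition_eq_local_map: "transition c c' = local_map c c' id"
  by (simp add: transition_def local_map_def)

lemma image_Int_eq_local_dom: "snd c ` (fst c \<inter> fst c') = local_dom c c' id"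
  by (simp add: local_dom_def)

text \<open>The lift reaches \<open>W'\<close> only on part of \<open>W\<close>, so the formula
  \<open>G\<close> is claimed just near \<open>\<kappa> w\<close>; the homeomorphism makes the image
  of that part open.\<close>

lemma local_map_lift:
  fixes \<kappa> :: "'a::topological_space \<Rightarrow> 'e::topological_space" and lift :: "'a \<Rightarrow> 'b::topological_space"
  assumes c: "is_sheet c p \<kappa> W" and c': "is_sheet c' p' \<kappa>' W'"
    and hom: "homeomorphism E D \<kappa> \<kappa>i" and op: "open E" "open D" "open W" "W \<subseteq> E" "open W'"
    and lift: "continuous_on W lift" "\<And>w. w \<in> W \<Longrightarrow> f (p w) = p' (lift w)"
      "\<And>w. w \<in> W \<Longrightarrow> \<kappa>' (lift w) = G (\<kappa> w)"
    and w: "w \<in> W" "lift w \<in> W'"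
  shows "\<exists>N. open N \<and> \<kappa> w \<in> N \<and> N \<subseteq> \<kappa> ` W \<and> (\<forall>y\<in>N. local_map c c' f y = G y)"
proof -
  define V where "V = W \<inter> lift -` W'"
  have "open V"
    unfolding V_def using lift(1) op by (simp add: continuous_open_preimage)
  have inj: "inj_on \<kappa> W"
    using hom op(4) by (metis homeomorphism_apply1 inj_on_inverseI subsetD)
  have "openin (top_of_set D) (\<kappa> ` V)"
    using homeomorphism_imp_open_map[OF hom] \<open>open V\<close> op(4)
    by (metis V_def inf.coboundedI1 open_subset)
  then have "open (\<kappa> ` V)"
    using op(2) by (meson openin_open_eq)
  moreover have "local_map c c' f (\<kappa> v) = G (\<kappa> v)" if "v \<in> V" for v
    using local_map_sheet[OF c c' inj, of v "lift v" f] that lift(2,3) by (simp add: V_def)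
  ultimately show ?thesis
    using w by (intro exI[of _ "\<kappa> ` V"]) (auto simp: V_def)
qed

text \<open>The inverse of the chart is \<open>p \<circ> \<kappa>i\<close>; continuity of the chart
  itself comes from \<open>p\<close> being open and injective on \<open>W\<close>.\<close>

lemma is_chart_sheet:
  fixes \<kappa> :: "'a::topological_space \<Rightarrow> 'e::topological_space"
  assumes c: "is_sheet c p \<kappa> W" and inj: "inj_on p W"
    and hom: "homeomorphism E D \<kappa> \<kappa>i" and op: "open E" "open D" "open W" "W \<subseteq> E"
    and p: "continuous_map (top_of_set E) X p" "open_map (top_of_set E) X p"
  shows "is_chart X c"
  unfolding is_chart_def
proof (intro conjI)
  have img: "openin X (p ` V)" if "openin (top_of_set W) V" for V
  proof -
    have "open V" "V \<subseteq> W"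
      using that op(3) by (auto simp: openin_open_eq)
    then have "openin (top_of_set E) V"
      using op(1,4) by (auto simp: openin_open_eq)
    then show ?thesis
      using p(2) by (simp add: open_map_def)
  qed
  show "openin X (fst c)"
    using img[of W] c by (simp add: is_sheet_def)
  have \<kappa>W: "openin (top_of_set D) (\<kappa> ` W)"
    using homeomorphism_imp_open_map[OF hom] op by (metis open_subset)
  then show "open (snd c ` fst c)"
    using op(2) is_sheet_image[OF c] by (metis openin_open_eq)
  have "continuous_map (subtopology X (p ` W)) (top_of_set W) (inv_into W p)"
    unfolding continuous_map
  proof (intro conjI allI impI)
    show "inv_into W p ` topspace (subtopology X (p ` W)) \<subseteq> topspace (top_of_set W)"
      by (auto simp: inv_into_into)
    fix U assume U: "openin (top_of_set W) U"
    then have "U \<subseteq> W" using openin_imp_subset by blast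
    have "p ` W \<subseteq> topspace X"
      using p(1) op(4) by (auto simp: continuous_map_def)
    then have "{x \<in> topspace (subtopology X (p ` W)). inv_into W p x \<in> U} = p ` U"
      using \<open>U \<subseteq> W\<close> inj by (auto simp: inv_into_f_f)
    then show "openin (subtopology X (p ` W)) {x \<in> topspace (subtopology X (p ` W)). inv_into W p x \<in> U}"
      using img[OF U] \<open>U \<subseteq> W\<close> unfolding openin_subtopology by (intro exI[of _ "p ` U"]) auto
  qed
  moreover have "continuous_map (top_of_set W) (top_of_set (\<kappa> ` W)) \<kappa>"
    using hom op(4) by (auto simp: homeomorphism_def intro: continuous_on_subset)
  ultimately have "continuous_map (subtopology X (p ` W)) (top_of_set (\<kappa> ` W)) (\<kappa> \<circ> inv_into W p)"
    by (rule continuous_map_compose)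
  then have f: "continuous_map (subtopology X (fst c)) (top_of_set (snd c ` fst c)) (snd c)"
    unfolding is_sheet_image[OF c] using c inj
    by (simp add: is_sheet_def) (erule continuous_map_eq, auto simp: inv_into_f_f)
  have \<kappa>i: "\<kappa>i (\<kappa> w) = w" if "w \<in> W" for w
    using hom op(4) that by (metis homeomorphism_apply1 subsetD)
  have "continuous_map (top_of_set (\<kappa> ` W)) (top_of_set E) \<kappa>i"
    using hom op(4) \<kappa>i by (auto simp: homeomorphism_def intro: continuous_on_subset)
  then have "continuous_map (top_of_set (\<kappa> ` W)) X (p \<circ> \<kappa>i)"
    using p(1) by (rule continuous_map_compose)
  then have g: "continuous_map (top_of_set (snd c ` fst c)) (subtopology X (fst c)) (p \<circ> \<kappa>i)"
    unfolding continuous_map_in_subtopology is_sheet_image[OF c]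
    using c \<kappa>i by (auto simp: is_sheet_def)
  have "homeomorphic_maps (subtopology X (fst c)) (top_of_set (snd c ` fst c)) (snd c) (p \<circ> \<kappa>i)"
    unfolding homeomorphic_maps_def using f g c \<kappa>i is_sheet_image[OF c]
    by (auto simp: is_sheet_def)
  then show "homeomorphic_map (subtopology X (fst c)) (top_of_set (snd c ` fst c)) (snd c)"
    using homeomorphic_maps_map by blast
qed

lemma holomorphic_vec_onI:
  assumes "\<And>x. x \<in> S \<Longrightarrow> \<exists>N G G'. open N \<and> x \<in> N \<and> (\<forall>y\<in>N. f y = G y) \<and>
    (G has_derivative G') (at x) \<and> (\<forall>c v. G' (c *s v) = c *s G' v)"
  shows "holomorphic_vec_on S f"
  unfolding holomorphic_vec_on_def
proof (intro ballI)
  fix x assume "x \<in> S"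
  from assms[OF this] obtain N G G' where N: "open N" "x \<in> N" "\<forall>y\<in>N. f y = G y"
    "(G has_derivative G') (at x)" "\<forall>c v. G' (c *s v) = c *s G' v"
    by (elim exE conjE)
  then have "(f has_derivative G') (at x)"
    using has_derivative_transform_within_open[of G G' x UNIV N f] by auto
  then have "frechet_derivative f (at x) = G'" "f differentiable (at x)"
    using frechet_derivative_at[of f G' x] by (auto intro: differentiableI)
  then show "f differentiable (at x) \<and> (\<forall>c v. frechet_derivative f (at x) (c *s v) =
      c *s frechet_derivative f (at x) v)"
    using N(5) by simp
qed

text \<open>\<open>displacement\<close> vanishes on the diagonal and is small near it, while 0 is
  the only lattice element of norm less than 1.\<close>

lemma proj_locally_injective: "\<exists>W. open W \<and> x \<in> W \<and> inj_on proj W"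
proof -
  let ?R = "(\<lambda>p. displacement (fst p) (snd p)) -` ball 0 1"
  have "open ?R"
    using continuous_on_displacement by (intro open_vimage) auto
  moreover have "(x, x) \<in> ?R"
  proof -
    have "displacement x x = 0"
      by (rule vec3_eqI) (simp_all add: displacement_def)
    then show ?thesis by simp
  qed
  ultimately obtain A B where AB: "open A" "open B" "(x, x) \<in> A \<times> B" "A \<times> B \<subseteq> ?R"
    by (rule open_prod_elim)
  have "y = y'" if "y \<in> A \<inter> B" "y' \<in> A \<inter> B" "proj y = proj y'" for y y'
  proof -
    let ?d = "displacement y y'"
    have "norm ?d < 1" "?d \<in> lat"
      using AB(4) that proj_eq_iff_displacement by (auto simp: subset_iff)
    then have "?d $ i = 0" for i
      by (intro gauss_ints_small) (auto simp: lat_def intro: order_le_less_trans[OF Finite_Cartesian_Product.norm_nth_le])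
    then have "?d = 0"
      by (simp add: vec_eq_iff)
    then show ?thesis
      using act_displacement[of y y'] by simp
  qed
  then show ?thesis
    using AB by (intro exI[of _ "A \<inter> B"]) (auto simp: inj_on_def)
qed


section \<open>Holomorphic coordinates\<close>

abbreviation "unit_disc \<equiv> {a::complex. norm a < 1}"

definition Phi :: "complex \<Rightarrow> complex^3 \<Rightarrow> complex^3" where
  "Phi a x = vec3 (x$1) (x$2 + a * cnj (x$2)) (x$3 - a * (cnj (x$2))\<^sup>2 / 2)"

text \<open>The inverse of \<open>z \<mapsto> z + a * cnj z\<close>.\<close>

definition zcoord :: "complex \<Rightarrow> complex \<Rightarrow> complex" where
  "zcoord a y = (y - a * cnj y) / (1 - a * cnj a)"

definition Phi_inv :: "complex \<Rightarrow> complex^3 \<Rightarrow> complex^3" where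
  "Phi_inv a y = vec3 (y$1) (zcoord a (y$2)) (y$3 + a * (cnj (zcoord a (y$2)))\<^sup>2 / 2)"

text \<open>The action of the lattice in the holomorphic coordinates \<open>Phi a\<close>; it is holomorphic, also
  in \<open>a\<close>.\<close>

definition hol_act :: "complex^3 \<Rightarrow> complex \<Rightarrow> complex^3 \<Rightarrow> complex^3" where
  "hol_act l a y = vec3 (y$1 + l$1) (y$2 + l$2 + a * cnj (l$2))
     (y$3 - (cnj (l$1) + 2 * cnj (l$2)) * y$1 - cnj (l$2) * y$2 - a * (cnj (l$2))\<^sup>2 / 2 + l$3)"

text \<open>\<open>hol_act l a\<close> is affine and \<open>a\<close> enters only its constant term,
  so this one linear map is the derivative at every point of every fibre.\<close>

definition hol_act_deriv :: "complex^3 \<Rightarrow> complex^3 \<Rightarrow> complex^3" where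
  "hol_act_deriv l v = vec3 (v$1) (v$2)
     (v$3 - (cnj (l$1) + 2 * cnj (l$2)) * v$1 - cnj (l$2) * v$2)"

definition join :: "complex^3 \<Rightarrow> complex \<Rightarrow> complex^(3 + 1)" where
  "join x t = (\<chi> i. case i of Inl j \<Rightarrow> x $ j | Inr _ \<Rightarrow> t)"

definition fibre_coords :: "complex^(3 + 1) \<Rightarrow> complex^3" where
  "fibre_coords y = (\<chi> j. y $ Inl j)"

definition base_coord :: "complex^(3 + 1) \<Rightarrow> complex" where
  "base_coord y = y $ Inr 1"

definition fam :: "(complex^3) \<times> complex \<Rightarrow> complex^(3 + 1)" where
  "fam = (\<lambda>(x, t). join (Phi t x) t)"

definition nil_atlas :: "complex \<Rightarrow> (complex^3, 3) atlas" where
  "nil_atlas a = {sheet_chart proj (Phi a) W |W. open W \<and> inj_on proj W}"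

text \<open>A sheet is multiplied by the whole disc: the lattice does not move the parameter, so
  injectivity of \<open>proj\<close> on \<open>W\<close> is enough.\<close>

definition total_atlas :: "((complex^3) \<times> complex, 3 + 1) atlas" where
  "total_atlas = {sheet_chart (map_prod proj id) fam (W \<times> unit_disc) |W. open W \<and> inj_on proj W}"

lemma disc_denom: "a \<in> unit_disc \<Longrightarrow> 1 - a * cnj a \<noteq> 0"
proof -
  assume "a \<in> unit_disc"
  then have "(norm a)\<^sup>2 < 1"
    by (simp add: power_less_one_iff)
  moreover have "1 - a * cnj a = of_real (1 - (norm a)\<^sup>2)"
    by (simp only: of_real_diff of_real_1 complex_norm_square)
  ultimately show ?thesis
    by (metis less_irrefl of_real_eq_0_iff right_minus_eq)
qed

lemma zcoord_left: "a \<in> unit_disc \<Longrightarrow> zcoord a (z + a * cnj z) = z"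
  using disc_denom[of a] by (simp add: zcoord_def divide_simps) (simp add: algebra_simps)

lemma zcoord_right: "a \<in> unit_disc \<Longrightarrow> zcoord a y + a * cnj (zcoord a y) = y"
proof -
  assume "a \<in> unit_disc"
  then have d: "1 - a * cnj a \<noteq> 0" by (rule disc_denom)
  have "cnj (zcoord a y) = (cnj y - cnj a * y) / (1 - a * cnj a)"
    by (simp add: zcoord_def mult.commute)
  then have "zcoord a y + a * cnj (zcoord a y) = ((y - a * cnj y) + a * (cnj y - cnj a * y)) / (1 - a * cnj a)"
    by (simp add: zcoord_def add_divide_distrib)
  also have "(y - a * cnj y) + a * (cnj y - cnj a * y) = y * (1 - a * cnj a)"
    by (simp add: algebra_simps)
  finally show ?thesis using d by simp
qed

lemma Phi_inv_left: "a \<in> unit_disc \<Longrightarrow> Phi_inv a (Phi a x) = x"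
  using zcoord_left[of a "x$2"] by (intro vec3_eqI) (simp_all add: Phi_def Phi_inv_def)

lemma Phi_inv_right: "a \<in> unit_disc \<Longrightarrow> Phi a (Phi_inv a y) = y"
  using zcoord_right[of a "y$2"] by (intro vec3_eqI) (simp_all add: Phi_def Phi_inv_def)

text \<open>This explains the quadratic term in \<open>Phi\<close>. Under z -> z + l2 it contributes
  a cnj(l2) cnj(z), which joins the summand cnj(l2) z of \<open>act\<close> to give cnj(l2) (z + a
  cnj(z)), an expression holomorphic in the new coordinates.\<close>

lemma Phi_act: "Phi a (act l x) = hol_act l a (Phi a x)"
  by (rule vec3_eqI) (simp_all add: Phi_def act_def hol_act_def power2_eq_square field_simps)

lemma homeomorphism_Phi:
  assumes "a \<in> unit_disc"
  shows "homeomorphism UNIV UNIV (Phi a) (Phi_inv a)"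
proof (rule homeomorphismI)
  show "continuous_on UNIV (Phi a)"
    unfolding Phi_def by (intro continuous_intros) auto
  show "continuous_on UNIV (Phi_inv a)"
    unfolding Phi_inv_def zcoord_def using disc_denom[OF assms] by (intro continuous_intros) auto
qed (use Phi_inv_left[OF assms] Phi_inv_right[OF assms] in auto)

lemma fibre_coords_join [simp]: "fibre_coords (join x t) = x"
  by (simp add: fibre_coords_def join_def)

lemma base_coord_join [simp]: "base_coord (join x t) = t"
  by (simp add: base_coord_def join_def)

lemma join_collapse [simp]: "join (fibre_coords y) (base_coord y) = y"
  by (auto simp: join_def fibre_coords_def base_coord_def vec_eq_iff split: sum.split)

lemma bounded_linear_fibre_coords: "bounded_linear fibre_coords"
  by (auto simp: fibre_coords_def linear_conv_bounded_linear[symmetric] linear_iff vec_eq_iff)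

lemma bounded_linear_base_coord: "bounded_linear base_coord"
  by (auto simp: base_coord_def linear_conv_bounded_linear[symmetric] linear_iff)

lemma bounded_linear_join: "bounded_linear (\<lambda>p. join (fst p) (snd p))"
  by (auto simp: join_def linear_conv_bounded_linear[symmetric] linear_iff vec_eq_iff split: sum.split)

lemma has_derivative_join [derivative_intros]:
  assumes "(f has_derivative f') (at x within S)" "(g has_derivative g') (at x within S)"
  shows "((\<lambda>x. join (f x) (g x)) has_derivative (\<lambda>v. join (f' v) (g' v))) (at x within S)"
  using bounded_linear.has_derivative[OF bounded_linear_join has_derivative_Pair[OF assms]] by simp

lemma smooth_on_join:
  assumes "open S" "smooth_on S f" "smooth_on S g"
  shows "smooth_on S (\<lambda>x. join (f x) (g x))"
  using smooth_on_bounded_linear[OF bounded_linear_join assms(1) smooth_on_Pair[OF assms]] by simp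

lemmas continuous_on_fibre_coords [continuous_intros] =
  bounded_linear.continuous_on[OF bounded_linear_fibre_coords]
lemmas continuous_on_base_coord [continuous_intros] =
  bounded_linear.continuous_on[OF bounded_linear_base_coord]
lemmas smooth_on_fibre_coords = smooth_on_bounded_linear[OF bounded_linear_fibre_coords]
lemmas smooth_on_base_coord = smooth_on_bounded_linear[OF bounded_linear_base_coord]

lemma continuous_on_join [continuous_intros]:
  assumes "continuous_on S f" "continuous_on S g"
  shows "continuous_on S (\<lambda>x. join (f x) (g x))"
  using bounded_linear.continuous_on[OF bounded_linear_join continuous_on_Pair[OF assms]] by simp

lemma open_unit_disc: "open unit_disc"
  by (intro open_Collect_less continuous_intros)

lemma homeomorphism_fam:
  "homeomorphism (UNIV \<times> unit_disc) {y. norm (base_coord y) < 1} fam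
     (\<lambda>y. (Phi_inv (base_coord y) (fibre_coords y), base_coord y))"
proof (rule homeomorphismI)
  show "continuous_on (UNIV \<times> unit_disc) fam"
    unfolding fam_def case_prod_unfold Phi_def by (intro continuous_intros) auto
  have d: "1 - base_coord y * cnj (base_coord y) \<noteq> 0" if "norm (base_coord y) < 1" for y
    using disc_denom[of "base_coord y"] that by simp
  show "continuous_on {y. norm (base_coord y) < 1}
      (\<lambda>y. (Phi_inv (base_coord y) (fibre_coords y), base_coord y))"
    unfolding Phi_inv_def zcoord_def using d by (intro continuous_intros) auto
qed (auto simp: fam_def Phi_inv_left Phi_inv_right)

lemma open_total_coords: "open {y. norm (base_coord y) < 1}"
  by (intro open_Collect_less continuous_intros)

lemma has_derivative_hol_act: "((hol_act l a) has_derivative hol_act_deriv l) (at y)"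
proof -
  have eq: "hol_act l a = (\<lambda>y. hol_act_deriv l y + hol_act l a 0)"
    by (auto simp: fun_eq_iff hol_act_def hol_act_deriv_def algebra_simps intro!: vec3_eqI)
  have "linear (hol_act_deriv l)"
    by (auto simp: linear_iff hol_act_deriv_def algebra_simps scaleR_conv_of_real[where 'a = complex] intro!: vec3_eqI)
  then show ?thesis
    by (subst eq) (intro has_derivative_add_const linear_imp_has_derivative)
qed

lemma hol_act_deriv_smult: "hol_act_deriv l (c *s v) = c *s hol_act_deriv l v"
  by (rule vec3_eqI) (simp_all add: hol_act_deriv_def algebra_simps)

lemma is_sheet_nil_atlas:
  assumes "c \<in> nil_atlas a"
  obtains W where "open W" "inj_on proj W" "is_sheet c proj (Phi a) W"
  using assms is_sheet_sheet_chart unfolding nil_atlas_def by blast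

lemma is_sheet_total_atlas:
  assumes "c \<in> total_atlas"
  obtains W where "open W" "inj_on proj W" "is_sheet c (map_prod proj id) fam (W \<times> unit_disc)"
proof -
  obtain W where W: "open W" "inj_on proj W"
    "c = sheet_chart (map_prod proj id) fam (W \<times> unit_disc)"
    using assms unfolding total_atlas_def by blast
  then have "inj_on (map_prod proj id) (W \<times> unit_disc)"
    by (auto simp: inj_on_def)
  then show ?thesis
    using that[OF W(1,2)] is_sheet_sheet_chart unfolding W(3) by blast
qed


definition total_act :: "complex^3 \<Rightarrow> complex^(3 + 1) \<Rightarrow> complex^(3 + 1)" where
  "total_act l y = join (hol_act l (base_coord y) (fibre_coords y)) (base_coord y)"

text \<open>The vector multiplied by \<open>base_coord v\<close> is the derivative of
  \<open>hol_act l a y\<close> in \<open>a\<close>. It depends on \<open>l\<close> alone, so the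
  action on the total space is affine as well.\<close>

definition total_act_deriv :: "complex^3 \<Rightarrow> complex^(3 + 1) \<Rightarrow> complex^(3 + 1)" where
  "total_act_deriv l v = join (hol_act_deriv l (fibre_coords v) +
     base_coord v *s vec3 0 (cnj (l$2)) (- (cnj (l$2))\<^sup>2 / 2)) (base_coord v)"

lemma join_arith:
  "join x s + join y t = join (x + y) (s + t)" "c *s join x s = join (c *s x) (c * s)"
  "r *\<^sub>R join x s = join (r *\<^sub>R x) (r *\<^sub>R s)"
  by (auto simp: join_def vec_eq_iff split: sum.split)

lemma coords_arith:
  "fibre_coords (v + w) = fibre_coords v + fibre_coords w" "base_coord (v + w) = base_coord v + base_coord w"
  "fibre_coords (c *s v) = c *s fibre_coords v" "base_coord (c *s v) = c * base_coord v"
  "fibre_coords (r *\<^sub>R v) = r *\<^sub>R fibre_coords v" "base_coord (r *\<^sub>R v) = r *\<^sub>R base_coord v"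
  "fibre_coords 0 = 0" "base_coord 0 = 0"
  by (auto simp: fibre_coords_def base_coord_def vec_eq_iff)

lemma total_act_deriv_smult: "total_act_deriv l (c *s v) = c *s total_act_deriv l v"
  by (simp add: total_act_deriv_def join_arith coords_arith hol_act_deriv_smult
      vector_smult_assoc vector_add_ldistrib)

lemma has_derivative_total_act: "(total_act l has_derivative total_act_deriv l) (at y)"
proof -
  have eq: "total_act l = (\<lambda>y. total_act_deriv l y + total_act l 0)"
    unfolding total_act_def total_act_deriv_def join_arith coords_arith
    by (auto simp: fun_eq_iff hol_act_def hol_act_deriv_def algebra_simps
        intro!: vec3_eqI arg_cong2[of _ _ _ _ join])
  have "linear (total_act_deriv l)"
    unfolding total_act_deriv_def linear_iff join_arith coords_arith
    by (auto simp: hol_act_deriv_def algebra_simps scaleR_conv_of_real[where 'a = complex]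
        intro!: vec3_eqI arg_cong2[of _ _ _ _ join])
  then show ?thesis
    by (subst eq) (intro has_derivative_add_const linear_imp_has_derivative)
qed

text \<open>One sheet may meet several translates of the other, so the lattice element depends on
  the point.\<close>

lemma nil_transition:
  assumes a: "a \<in> unit_disc" and c: "c \<in> nil_atlas a" "c' \<in> nil_atlas a"
    and x: "x \<in> snd c ` (fst c \<inter> fst c')"
  obtains l N where "l \<in> lat" "open N" "x \<in> N" "N \<subseteq> snd c ` fst c"
    "\<And>y. y \<in> N \<Longrightarrow> transition c c' y = hol_act l a y"
proof -
  obtain W where W: "open W" "inj_on proj W" "is_sheet c proj (Phi a) W"
    using is_sheet_nil_atlas[OF c(1)] by blast
  obtain W' where W': "open W'" "inj_on proj W'" "is_sheet c' proj (Phi a) W'"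
    using is_sheet_nil_atlas[OF c(2)] by blast
  obtain w w' where w: "w \<in> W" "w' \<in> W'" "x = Phi a w" "proj w = proj w'"
    using x unfolding image_Int_eq_local_dom local_dom_sheet[OF W(3) W'(3)] by auto
  then obtain l where l: "l \<in> lat" "w' = act l w"
    using proj_eq_iff by blast
  have "\<exists>N. open N \<and> Phi a w \<in> N \<and> N \<subseteq> Phi a ` W \<and> (\<forall>y\<in>N. local_map c c' id y = hol_act l a y)"
    by (rule local_map_lift[OF W(3) W'(3) homeomorphism_Phi[OF a], of "act l"])
      (use W W' w l continuous_on_act Phi_act in auto)
  then show ?thesis
    using that[OF l(1)] w(3) is_sheet_image[OF W(3)] by (metis transition_eq_local_map)
qed

lemma nil_transition_deriv:
  assumes "a \<in> unit_disc" and "c \<in> nil_atlas a" "c' \<in> nil_atlas a"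
    and "x \<in> snd c ` (fst c \<inter> fst c')"
  obtains l where "l \<in> lat" "transition c c' x = hol_act l a x"
    "frechet_derivative (transition c c') (at x) = hol_act_deriv l"
proof -
  obtain l N where l: "l \<in> lat" "open N" "x \<in> N"
    "\<And>y. y \<in> N \<Longrightarrow> transition c c' y = hol_act l a y"
    using nil_transition[OF assms] by metis
  have "frechet_derivative (transition c c') (at x) = frechet_derivative (hol_act l a) (at x)"
    by (rule frechet_derivative_cong_open[OF l(2,3,4)])
  also have "\<dots> = hol_act_deriv l"
    using frechet_derivative_at[OF has_derivative_hol_act] by simp
  finally show ?thesis
    using that l by blast
qed

lemma nil_atlas_covers: "(\<Union>c\<in>nil_atlas a. fst c) = range proj"
proof
  show "(\<Union>c\<in>nil_atlas a. fst c) \<subseteq> range proj"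
    by (auto simp: nil_atlas_def sheet_chart_def)
  show "range proj \<subseteq> (\<Union>c\<in>nil_atlas a. fst c)"
  proof clarify
    fix x
    obtain W where "open W" "x \<in> W" "inj_on proj W"
      using proj_locally_injective by blast
    then show "proj x \<in> (\<Union>c\<in>nil_atlas a. fst c)"
      unfolding nil_atlas_def
      by (intro UN_I[of "sheet_chart proj (Phi a) W"]) (auto simp: sheet_chart_def)
  qed
qed

lemma compact_complex_manifold_nil:
  assumes a: "a \<in> unit_disc"
  shows "compact_complex_manifold nil_top (nil_atlas a)"
  unfolding compact_complex_manifold_def complex_manifold_def
proof (intro conjI ballI)
  show "Hausdorff_space nil_top" "second_countable nil_top" "compact_space nil_top"
    by (fact Hausdorff_nil_top second_countable_nil_top compact_space_nil_top)+
  show "(\<Union>c\<in>nil_atlas a. fst c) = topspace nil_top"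
    by (simp add: nil_atlas_covers)
next
  fix c assume "c \<in> nil_atlas a"
  then obtain W where W: "open W" "inj_on proj W" "is_sheet c proj (Phi a) W"
    using is_sheet_nil_atlas by blast
  show "is_chart nil_top c"
    by (rule is_chart_sheet[OF W(3,2) homeomorphism_Phi[OF a]])
      (use W continuous_map_proj open_map_proj in auto)
next
  fix c c' assume c: "c \<in> nil_atlas a" "c' \<in> nil_atlas a"
  show "holomorphic_vec_on (snd c ` (fst c \<inter> fst c')) (transition c c')"
  proof (rule holomorphic_vec_onI)
    fix x assume "x \<in> snd c ` (fst c \<inter> fst c')"
    then obtain l N where "open N" "x \<in> N" "\<And>y. y \<in> N \<Longrightarrow> transition c c' y = hol_act l a y"
      using nil_transition[OF a c] by metis
    then show "\<exists>N G G'. open N \<and> x \<in> N \<and> (\<forall>y\<in>N. transition c c' y = G y) \<and>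
        (G has_derivative G') (at x) \<and> (\<forall>c v. G' (c *s v) = c *s G' v)"
      by (intro exI[of _ N] exI[of _ "hol_act l a"] exI[of _ "hol_act_deriv l"])
        (simp add: has_derivative_hol_act hol_act_deriv_smult)
  qed
qed


section \<open>The family over the disc\<close>

abbreviation "total_top \<equiv> prod_topology nil_top (top_of_set unit_disc)"

lemma continuous_map_total_proj:
  "continuous_map (top_of_set (UNIV \<times> unit_disc)) total_top (map_prod proj id)"
proof -
  have "continuous_map (prod_topology euclidean (top_of_set unit_disc)) total_top (\<lambda>(x, t). (proj x, id t))"
    unfolding continuous_map_prod_top by (simp add: continuous_map_proj)
  then show ?thesis
    unfolding map_prod_def using prod_topology_subtopology_eu[of "UNIV :: (complex^3) set" unit_disc]
    by simp
qed

lemma open_map_total_proj: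
  "open_map (top_of_set (UNIV \<times> unit_disc)) total_top (map_prod proj id)"
  unfolding open_map_def
proof (intro allI impI)
  fix U assume "openin (top_of_set (UNIV \<times> unit_disc)) (U :: ((complex^3) \<times> complex) set)"
  then have U: "openin (prod_topology euclidean (top_of_set unit_disc)) U"
    using prod_topology_subtopology_eu[of "UNIV :: (complex^3) set" unit_disc] by simp
  show "openin total_top (map_prod proj id ` U)"
    unfolding openin_prod_topology_alt
  proof (intro allI impI)
    fix p t assume "(p, t) \<in> map_prod proj id ` U"
    then obtain x where x: "(x, t) \<in> U" "p = proj x" by auto
    then obtain A B where AB: "open A" "openin (top_of_set unit_disc) B" "x \<in> A" "t \<in> B" "A \<times> B \<subseteq> U"
      using U unfolding openin_prod_topology_alt by (metis open_openin)
    moreover have "openin nil_top (proj ` A)"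
      using open_map_proj AB(1) by (simp add: open_map_def)
    moreover have "proj ` A \<times> B \<subseteq> map_prod proj id ` U"
      using AB(5) by (force simp: map_prod_def)
    ultimately show "\<exists>A B. openin nil_top A \<and> openin (top_of_set unit_disc) B \<and> p \<in> A \<and> t \<in> B \<and>
        A \<times> B \<subseteq> map_prod proj id ` U"
      using x(2) by blast
  qed
qed

text \<open>The two coordinate systems are kept independent, because the lemma serves both for
  changes within \<open>total_atlas\<close> and, in either direction, for comparison with product
  charts.\<close>

lemma total_lift:
  assumes c: "is_sheet c (map_prod proj id) \<kappa> (W \<times> unit_disc)" "open W"
    and \<kappa>: "homeomorphism (UNIV \<times> unit_disc) D \<kappa> \<kappa>i" "open D"
    and c': "is_sheet c' (map_prod proj id) \<kappa>' (W' \<times> unit_disc)" "open W'"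
    and G: "\<And>l w. l \<in> lat \<Longrightarrow> w \<in> UNIV \<times> unit_disc \<Longrightarrow> \<kappa>' (map_prod (act l) id w) = G l (\<kappa> w)"
    and x: "x \<in> snd c ` (fst c \<inter> fst c')"
  obtains l N where "l \<in> lat" "open N" "x \<in> N" "N \<subseteq> \<kappa> ` (W \<times> unit_disc)"
    "\<And>y. y \<in> N \<Longrightarrow> transition c c' y = G l y"
proof -
  obtain w w' where w: "w \<in> W \<times> unit_disc" "w' \<in> W' \<times> unit_disc" "x = \<kappa> w"
    "map_prod proj id w = map_prod proj id w'"
    using x unfolding image_Int_eq_local_dom local_dom_sheet[OF c(1) c'(1)] by auto
  then have "proj (fst w) = proj (fst w')" "snd w = snd w'"
    by (auto simp: map_prod_def split_beta)
  then obtain l where l: "l \<in> lat" "w' = map_prod (act l) id w"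
    using proj_eq_iff by (metis eq_id_iff fst_map_prod prod.expand snd_map_prod)
  have "continuous_on (W \<times> unit_disc) (map_prod (act l) id)"
    unfolding map_prod_def case_prod_unfold id_def act_def by (intro continuous_intros)
  then have "\<exists>N. open N \<and> \<kappa> w \<in> N \<and> N \<subseteq> \<kappa> ` (W \<times> unit_disc) \<and> (\<forall>y\<in>N. local_map c c' id y = G l y)"
    by (intro local_map_lift[OF c(1) c'(1) \<kappa>(1), of "map_prod (act l) id"])
      (use c c' \<kappa> w l G in \<open>auto intro!: open_Times open_unit_disc\<close>)
  then show ?thesis
    using that[OF l(1)] w(3) by (metis transition_eq_local_map)
qed

lemma fam_act:
  "w \<in> UNIV \<times> unit_disc \<Longrightarrow> fam (map_prod (act l) id w) = total_act l (fam w)"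
  by (auto simp: fam_def total_act_def Phi_act)

lemma total_transition:
  assumes c: "c \<in> total_atlas" "c' \<in> total_atlas"
    and x: "x \<in> snd c ` (fst c \<inter> fst c')"
  obtains l N where "l \<in> lat" "open N" "x \<in> N"
    "\<And>y. y \<in> N \<Longrightarrow> transition c c' y = total_act l y"
proof -
  obtain W where W: "open W" "is_sheet c (map_prod proj id) fam (W \<times> unit_disc)"
    using is_sheet_total_atlas[OF c(1)] by blast
  obtain W' where W': "open W'" "is_sheet c' (map_prod proj id) fam (W' \<times> unit_disc)"
    using is_sheet_total_atlas[OF c(2)] by blast
  show ?thesis
    by (rule total_lift[OF W(2,1) homeomorphism_fam open_total_coords W'(2,1) fam_act x]) (auto intro: that)
qed

lemma total_atlas_covers: "(\<Union>c\<in>total_atlas. fst c) = range proj \<times> unit_disc"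
proof
  show "(\<Union>c\<in>total_atlas. fst c) \<subseteq> range proj \<times> unit_disc"
    by (auto simp: total_atlas_def sheet_chart_def)
  show "range proj \<times> unit_disc \<subseteq> (\<Union>c\<in>total_atlas. fst c)"
  proof clarify
    fix x and t :: complex assume t: "norm t < 1"
    obtain W where "open W" "x \<in> W" "inj_on proj W"
      using proj_locally_injective by blast
    then show "(proj x, t) \<in> (\<Union>c\<in>total_atlas. fst c)"
      unfolding total_atlas_def using t
      by (intro UN_I[of "sheet_chart (map_prod proj id) fam (W \<times> unit_disc)"])
        (auto simp: sheet_chart_def intro!: image_eqI[of _ _ "(x, t)"])
  qed
qed

lemma complex_manifold_total: "complex_manifold total_top total_atlas"
  unfolding complex_manifold_def
proof (intro conjI ballI)
  show "Hausdorff_space total_top"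
    by (auto simp: Hausdorff_space_prod_topology Hausdorff_nil_top intro: Hausdorff_space_subtopology)
  have "map_prod proj id ` (UNIV \<times> unit_disc) = topspace total_top"
    by (auto simp: map_prod_def)
  then show "second_countable total_top"
    using second_countable_open_map_image[OF continuous_map_total_proj open_map_total_proj]
      second_countable_subtopology[OF second_countable_euclidean, of "UNIV \<times> unit_disc"] by simp
  show "(\<Union>c\<in>total_atlas. fst c) = topspace total_top"
    by (simp add: total_atlas_covers)
next
  fix c assume "c \<in> total_atlas"
  then obtain W where W: "open W" "inj_on proj W" "is_sheet c (map_prod proj id) fam (W \<times> unit_disc)"
    using is_sheet_total_atlas by blast
  have "inj_on (map_prod proj id) (W \<times> unit_disc)"
    using W(2) by (auto simp: inj_on_def)
  then show "is_chart total_top c"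
    by (rule is_chart_sheet[OF W(3) _ homeomorphism_fam])
      (use W open_total_coords continuous_map_total_proj open_map_total_proj open_unit_disc
        in \<open>auto intro!: open_Times\<close>)
next
  fix c c' assume c: "c \<in> total_atlas" "c' \<in> total_atlas"
  show "holomorphic_vec_on (snd c ` (fst c \<inter> fst c')) (transition c c')"
  proof (rule holomorphic_vec_onI)
    fix x assume "x \<in> snd c ` (fst c \<inter> fst c')"
    then obtain l N where "open N" "x \<in> N" "\<And>y. y \<in> N \<Longrightarrow> transition c c' y = total_act l y"
      using total_transition[OF c] by metis
    then show "\<exists>N G G'. open N \<and> x \<in> N \<and> (\<forall>y\<in>N. transition c c' y = G y) \<and>
        (G has_derivative G') (at x) \<and> (\<forall>c v. G' (c *s v) = c *s G' v)"
      by (intro exI[of _ N] exI[of _ "total_act l"] exI[of _ "total_act_deriv l"])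
        (simp add: has_derivative_total_act total_act_deriv_smult)
  qed
qed


lemma holomorphic_submersion_total:
  "holomorphic_submersion total_top total_atlas (top_of_set unit_disc) (disc_atlas unit_disc) snd"
proof -
  let ?D = "(unit_disc, vec) :: (complex, complex^1) chart"
  let ?G = "\<lambda>y. vec (base_coord y) :: complex^1"
  have disc: "is_sheet ?D id vec unit_disc"
    by (simp add: is_sheet_def)
  have loc: "\<exists>N. open N \<and> x \<in> N \<and> (\<forall>y\<in>N. local_map c ?D snd y = ?G y)"
    if c: "c \<in> total_atlas" and x: "x \<in> local_dom c ?D snd" for c x
  proof -
    obtain W where W: "open W" "is_sheet c (map_prod proj id) fam (W \<times> unit_disc)"
      using is_sheet_total_atlas[OF c] by blast
    obtain w where w: "w \<in> W \<times> unit_disc" "x = fam w"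
      using x unfolding local_dom_sheet[OF W(2) disc] by auto
    have "\<exists>N. open N \<and> fam w \<in> N \<and> N \<subseteq> fam ` (W \<times> unit_disc) \<and>
        (\<forall>y\<in>N. local_map c ?D snd y = ?G y)"
      by (rule local_map_lift[OF W(2) disc homeomorphism_fam, of snd])
        (use W w open_total_coords open_unit_disc in
          \<open>auto simp: fam_def intro!: open_Times continuous_intros\<close>)
    then show ?thesis
      using w(2) by blast
  qed
  have "bounded_linear ?G"
    using bounded_linear_compose[OF _ bounded_linear_base_coord, of vec]
    by (simp add: linear_conv_bounded_linear[symmetric] linear_iff vec_eq_iff)
  then have G: "(?G has_derivative ?G) (at x)" for x
    by (rule bounded_linear_imp_has_derivative)
  have Gs: "?G (c *s v) = c *s ?G v" for c v
    by (simp add: coords_arith vec_eq_iff)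
  show ?thesis
    unfolding holomorphic_submersion_def holomorphic_map_def disc_atlas_def
  proof (intro conjI ballI)
    show "continuous_map total_top (top_of_set unit_disc) snd"
      by (rule continuous_map_snd)
  next
    fix c c' assume c: "c \<in> total_atlas" and c': "c' \<in> {(unit_disc, vec :: complex \<Rightarrow> complex^1)}"
    show "holomorphic_vec_on (local_dom c c' snd) (local_map c c' snd)"
    proof (rule holomorphic_vec_onI)
      fix x assume "x \<in> local_dom c c' snd"
      then obtain N where "open N" "x \<in> N" "\<forall>y\<in>N. local_map c c' snd y = ?G y"
        using loc[OF c, of x] c' by auto
      then show "\<exists>N G G'. open N \<and> x \<in> N \<and> (\<forall>y\<in>N. local_map c c' snd y = G y) \<and>
          (G has_derivative G') (at x) \<and> (\<forall>c v. G' (c *s v) = c *s G' v)"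
        using G[of x] Gs by (intro exI[of _ N] exI[of _ ?G] conjI allI) auto
    qed
  next
    fix c c' x assume "c \<in> total_atlas" "c' \<in> {(unit_disc, vec :: complex \<Rightarrow> complex^1)}"
      "x \<in> local_dom c c' snd"
    then obtain N where "open N" "x \<in> N" "\<And>y. y \<in> N \<Longrightarrow> local_map c c' snd y = ?G y"
      using loc[of c x] by auto
    then have "frechet_derivative (local_map c c' snd) (at x) = frechet_derivative ?G (at x)"
      by (rule frechet_derivative_cong_open)
    also have "\<dots> = ?G"
      using frechet_derivative_at[OF G] by simp
    finally have "frechet_derivative (local_map c c' snd) (at x) = ?G" .
    moreover have "surj ?G"
    proof (rule surjI)
      show "?G (join 0 (u $ 1)) = u" for u
        by (simp add: vec_eq_iff)
    qed
    ultimately show "surj (frechet_derivative (local_map c c' snd) (at x))"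
      by simp
  qed
qed

lemma holomorphic_map_fibre:
  assumes a: "a \<in> unit_disc"
  shows "holomorphic_map nil_top (nil_atlas a) total_top total_atlas (\<lambda>p. (p, a))"
  unfolding holomorphic_map_def
proof (intro conjI ballI)
  show "continuous_map nil_top total_top (\<lambda>p. (p, a))"
    using a by (intro continuous_map_pairedI) auto
next
  fix c c' assume c: "c \<in> nil_atlas a" "c' \<in> total_atlas"
  obtain W where W: "open W" "is_sheet c proj (Phi a) W"
    using is_sheet_nil_atlas[OF c(1)] by blast
  obtain W' where W': "open W'" "is_sheet c' (map_prod proj id) fam (W' \<times> unit_disc)"
    using is_sheet_total_atlas[OF c(2)] by blast
  show "holomorphic_vec_on (local_dom c c' (\<lambda>p. (p, a))) (local_map c c' (\<lambda>p. (p, a)))"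
  proof (rule holomorphic_vec_onI)
    fix x assume "x \<in> local_dom c c' (\<lambda>p. (p, a))"
    then obtain w w' where w: "w \<in> W" "w' \<in> W'" "x = Phi a w" "proj w = proj w'"
      unfolding local_dom_sheet[OF W(2) W'(2)] by auto
    then obtain l where l: "l \<in> lat" "w' = act l w"
      using proj_eq_iff by blast
    let ?G = "\<lambda>y. join (hol_act l a y) a"
    have "\<exists>N. open N \<and> Phi a w \<in> N \<and> N \<subseteq> Phi a ` W \<and> (\<forall>y\<in>N. local_map c c' (\<lambda>p. (p, a)) y = ?G y)"
      (is "\<exists>N. ?P N")
      by (rule local_map_lift[OF W(2) W'(2) homeomorphism_Phi[OF a], of "\<lambda>w. (act l w, a)"])
        (use W W' w l a open_unit_disc in \<open>auto simp: fam_def Phi_act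
          intro!: open_Times continuous_intros continuous_on_act\<close>)
    then obtain N where "?P N" ..
    moreover have "(?G has_derivative (\<lambda>v. join (hol_act_deriv l v) 0)) (at x)"
      by (intro has_derivative_join has_derivative_hol_act has_derivative_const)
    ultimately show "\<exists>N G G'. open N \<and> x \<in> N \<and> (\<forall>y\<in>N. local_map c c' (\<lambda>p. (p, a)) y = G y) \<and>
        (G has_derivative G') (at x) \<and> (\<forall>c v. G' (c *s v) = c *s G' v)"
      using w(3) by (intro exI[of _ N] exI[of _ ?G] exI[of _ "\<lambda>v. join (hol_act_deriv l v) 0"] conjI)
        (auto simp: join_arith hol_act_deriv_smult)
  qed
qed

lemma smoothly_compatible_total:
  assumes a: "a \<in> unit_disc" and c: "c \<in> nil_atlas a" "c' \<in> total_atlas"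
  shows "smoothly_compatible (fst c \<times> unit_disc, \<lambda>(p, t). (snd c p, t)) c'"
proof -
  let ?c = "(fst c \<times> unit_disc, \<lambda>(p, t). (snd c p, t)) :: ((complex^3) \<times> complex, (complex^3) \<times> complex) chart"
  let ?\<kappa> = "map_prod (Phi a) (id :: complex \<Rightarrow> complex)"
  obtain W where W: "open W" "is_sheet c proj (Phi a) W"
    using is_sheet_nil_atlas[OF c(1)] by blast
  obtain W' where W': "open W'" "is_sheet c' (map_prod proj id) fam (W' \<times> unit_disc)"
    using is_sheet_total_atlas[OF c(2)] by blast
  have sheet: "is_sheet ?c (map_prod proj id) ?\<kappa> (W \<times> unit_disc)"
    using W(2) by (auto simp: is_sheet_def map_prod_def)
  have hom: "homeomorphism (UNIV \<times> unit_disc) (UNIV \<times> unit_disc) ?\<kappa> (map_prod (Phi_inv a) id)"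
  proof (rule homeomorphismI)
    show "continuous_on (UNIV \<times> unit_disc) ?\<kappa>"
      unfolding map_prod_def case_prod_unfold id_def Phi_def by (intro continuous_intros) auto
    show "continuous_on (UNIV \<times> unit_disc) (map_prod (Phi_inv a) id)"
      unfolding map_prod_def case_prod_unfold id_def Phi_inv_def zcoord_def
      using disc_denom[OF a] by (intro continuous_intros) auto
  qed (use Phi_inv_left[OF a] Phi_inv_right[OF a] in auto)
  have op: "open (UNIV \<times> unit_disc :: ((complex^3) \<times> complex) set)"
    by (intro open_Times open_unit_disc open_UNIV)
  \<comment> \<open>One side uses the coordinates of the fixed fibre \<open>a\<close>, the other
    those of the moving fibre. The passage goes through the covering by \<open>Phi_inv\<close>, so
    conjugates occur and it is only smooth in general.\<close>
  let ?G = "\<lambda>l y. join (Phi (snd y) (act l (Phi_inv a (fst y)))) (snd y)"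
  let ?H = "\<lambda>l y. (Phi a (act l (Phi_inv (base_coord y) (fibre_coords y))), base_coord y)"
  note smooths = smooth_on_intros smooth_on_vec3 smooth_on_join smooth_on_fibre_coords smooth_on_base_coord
  show ?thesis
    unfolding smoothly_compatible_def
  proof (intro conjI smooth_on_local)
    fix x assume x: "x \<in> snd ?c ` (fst ?c \<inter> fst c')"
    have "fam (map_prod (act l) id w) = ?G l (?\<kappa> w)" if "w \<in> UNIV \<times> unit_disc" for l w
      using Phi_inv_left[OF a] by (simp add: fam_def map_prod_def split_beta)
    from total_lift[where G = ?G, OF sheet W(1) hom op W'(2,1) this x] obtain l N where N: "open N" "x \<in> N"
        "\<And>y. y \<in> N \<Longrightarrow> transition ?c c' y = ?G l y"
      by metis
    have "smooth_on N (?G l)"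
      unfolding Phi_def act_def Phi_inv_def zcoord_def vec3_nth using disc_denom[OF a] N(1)
      by (intro smooths) auto
    then show "\<exists>N g. open N \<and> x \<in> N \<and> smooth_on N g \<and> (\<forall>y\<in>N. transition ?c c' y = g y)"
      using N by blast
  next
    fix x assume "x \<in> snd c' ` (fst ?c \<inter> fst c')"
    then have x: "x \<in> snd c' ` (fst c' \<inter> fst ?c)"
      by (simp add: Int_commute)
    have "?\<kappa> (map_prod (act l) id w) = ?H l (fam w)" if "w \<in> UNIV \<times> unit_disc" for l w
      using that by (auto simp: fam_def Phi_inv_left)
    from total_lift[where G = ?H, OF W'(2,1) homeomorphism_fam open_total_coords sheet W(1) this x]
    obtain l N where N: "open N" "x \<in> N" "N \<subseteq> fam ` (W' \<times> unit_disc)"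
        "\<And>y. y \<in> N \<Longrightarrow> transition c' ?c y = ?H l y"
      by metis
    \<comment> \<open>\<open>N\<close> lies in the image of the chart, where the parameter has norm
      less than 1; thus the denominator of \<open>zcoord\<close> does not vanish.\<close>
    have "1 - base_coord y * cnj (base_coord y) \<noteq> 0" if "y \<in> N" for y
      using N(3) that disc_denom by (force simp: fam_def)
    then have "smooth_on N (?H l)"
      unfolding Phi_def act_def Phi_inv_def zcoord_def vec3_nth using N(1)
      by (intro smooths) auto
    then show "\<exists>N g. open N \<and> x \<in> N \<and> smooth_on N g \<and> (\<forall>y\<in>N. transition c' ?c y = g y)"
      using N by blast
  qed
qed

lemma holomorphic_family_nil: "holomorphic_family unit_disc nil_top nil_atlas"
  unfolding holomorphic_family_def Let_def
  using compact_complex_manifold_nil complex_manifold_total holomorphic_submersion_total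
    holomorphic_map_fibre smoothly_compatible_total
  by (intro conjI exI[of _ total_atlas] ballI)


section \<open>Exterior squares of two-forms\<close>

lemma sum_permutes_2:
  "(\<Sum>\<sigma> | \<sigma> permutes {..<2::nat}. f \<sigma>) = f id + f (Transposition.transpose 0 1)"
proof -
  have eq: "{..<2::nat} = insert 0 {1}" by auto
  show ?thesis
    unfolding eq by (subst sum_over_permutations_insert) (auto simp: permutes_sing)
qed

lemma sum_permutes_4:
  "(\<Sum>\<sigma> | \<sigma> permutes {..<4::nat}. f \<sigma>) =
   (\<Sum>a\<in>{0,1,2,3}. \<Sum>b\<in>{1,2,3}. \<Sum>c\<in>{2,3}. f (Transposition.transpose 0 a \<circ> (Transposition.transpose 1 b \<circ> Transposition.transpose 2 c)))"
proof -
  have eq: "{..<4::nat} = insert 0 (insert 1 (insert 2 {3}))" by auto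
  show ?thesis
    unfolding eq by (subst sum_over_permutations_insert | simp only: permutes_sing | force)+
qed

text \<open>The 24 permutations fall into three classes of eight, one for each way of pairing the
  four arguments, and 8 / (2! 2!) is the factor 2.\<close>

lemma wedge_power_2:
  fixes A :: "complex^'n \<Rightarrow> complex^'n \<Rightarrow> complex"
  assumes A: "\<And>u w. A w u = - A u w"
  shows "wedge_power 2 (\<lambda>v. A (v 0) (v 1)) v =
    2 * (A (v 0) (v 1) * A (v 2) (v 3) - A (v 0) (v 2) * A (v 1) (v 3) + A (v 0) (v 3) * A (v 1) (v 2))"
proof -
  have 1: "wedge_power (Suc 0) (\<lambda>v. A (v 0) (v 1)) = (\<lambda>v. A (v 0) (v 1))"
    by (rule ext) (simp add: wedge_def sum_permutes_2 sign_swap_id A[of "_ (Suc 0)" "_ 0"] Transposition.transpose_def)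
  have 2: "wedge_power 2 (\<lambda>v. A (v 0) (v 1)) = wedge 2 2 (\<lambda>v. A (v 0) (v 1)) (\<lambda>v. A (v 0) (v 1))"
    using wedge_power.simps(2)[of "Suc 0" "\<lambda>v. A (v 0) (v 1)"] unfolding 1
    by (simp only: Suc_1 mult_2 add_Suc_right add_0_right One_nat_def[symmetric] mult_1_right)
  have "A (v 1) (v 0) = - A (v 0) (v 1)" "A (v 2) (v 0) = - A (v 0) (v 2)" "A (v 3) (v 0) = - A (v 0) (v 3)"
    "A (v 2) (v 1) = - A (v 1) (v 2)" "A (v 3) (v 1) = - A (v 1) (v 3)" "A (v 3) (v 2) = - A (v 2) (v 3)"
    by (rule A)+
  note anti = this this[unfolded One_nat_def]
  have sum: "wedge_power 2 (\<lambda>v. A (v 0) (v 1)) v = 1 / 4 *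
     (\<Sum>\<sigma> | \<sigma> permutes {..<4}. of_int (sign \<sigma>) * A (v (\<sigma> 0)) (v (\<sigma> 1)) * A (v (\<sigma> 2)) (v (\<sigma> 3)))"
    unfolding 2 wedge_def by (simp add: fact_numeral)
  show ?thesis
    unfolding sum sum_permutes_4
    by (simp add: sign_compose sign_swap_id permutation_swap_id permutation_compose
        Transposition.transpose_def anti) 
qed


text \<open>The exterior square of the two-form \<open>A\<close>: twice the Pfaffian of the matrix with entries
  \<open>A (v i) (v j)\<close>.\<close>

definition pf :: "(complex^'n \<Rightarrow> complex^'n \<Rightarrow> complex) \<Rightarrow> (nat \<Rightarrow> complex^'n) \<Rightarrow> complex" where
  "pf A v = 2 * (A (v 0) (v 1) * A (v 2) (v 3) - A (v 0) (v 2) * A (v 1) (v 3) + A (v 0) (v 3) * A (v 1) (v 2))"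

lemma has_derivative_pf:
  assumes "\<And>u w. ((\<lambda>x. A x u w) has_derivative A' u w) (at x)"
  shows "((\<lambda>x. pf (A x) v) has_derivative (\<lambda>y. 2 *
    ((A' (v 0) (v 1) y * A x (v 2) (v 3) + A x (v 0) (v 1) * A' (v 2) (v 3) y)
    - (A' (v 0) (v 2) y * A x (v 1) (v 3) + A x (v 0) (v 2) * A' (v 1) (v 3) y)
    + (A' (v 0) (v 3) y * A x (v 1) (v 2) + A x (v 0) (v 3) * A' (v 1) (v 2) y)))) (at x)"
  unfolding pf_def by (auto intro!: derivative_eq_intros assms simp: algebra_simps)

text \<open>The Leibniz rule d(Omega^2 / 2) = d Omega wedge Omega. \<open>Q\<close> is the
  derivative of the Pfaffian, \<open>d\<close> the exterior derivative of the two-form, and the ten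
  terms on the right are the shuffles of three and two indices.\<close>

lemma alternating_sum_square:
  fixes P :: "nat \<Rightarrow> nat \<Rightarrow> nat \<Rightarrow> complex" and O' :: "nat \<Rightarrow> nat \<Rightarrow> complex"
  defines "d \<equiv> \<lambda>i j k. P i j k - P j i k + P k i j"
    and "Q \<equiv> \<lambda>i a b c e. P i a b * O' c e + O' a b * P i c e - (P i a c * O' b e + O' a c * P i b e)
      + (P i a e * O' b c + O' a e * P i b c)"
  shows "Q 0 1 2 3 4 - Q 1 0 2 3 4 + Q 2 0 1 3 4 - Q 3 0 1 2 4 + Q 4 0 1 2 3 =
    d 0 1 2 * O' 3 4 - d 0 1 3 * O' 2 4 + d 0 1 4 * O' 2 3 + d 0 2 3 * O' 1 4 - d 0 2 4 * O' 1 3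
    + d 0 3 4 * O' 1 2 - d 1 2 3 * O' 0 4 + d 1 2 4 * O' 0 3 - d 1 3 4 * O' 0 2 + d 2 3 4 * O' 0 1"
  unfolding d_def Q_def by (simp add: algebra_simps)

lemma part10_pf:
  "part10 (\<lambda>y. 2 * ((X1 y * b1 + a1 * Y1 y) - (X2 y * b2 + a2 * Y2 y) + (X3 y * b3 + a3 * Y3 y))) u =
    2 * ((part10 X1 u * b1 + a1 * part10 Y1 u) - (part10 X2 u * b2 + a2 * part10 Y2 u)
      + (part10 X3 u * b3 + a3 * part10 Y3 u))"
  by (simp add: part10_def field_simps)

lemma del_pf:
  fixes v :: "nat \<Rightarrow> complex^'n::finite"
  assumes A: "\<And>u w. ((\<lambda>x. A x u w) has_derivative A' u w) (at x)"
  defines "P \<equiv> \<lambda>i j k. part10 (A' (v j) (v k)) (v i)" and "O' \<equiv> \<lambda>j k. A x (v j) (v k)"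
  defines "d \<equiv> \<lambda>i j k. P i j k - P j i k + P k i j"
  shows "del 4 (\<lambda>y. pf (A y)) x v = 2 *
    (d 0 1 2 * O' 3 4 - d 0 1 3 * O' 2 4 + d 0 1 4 * O' 2 3 + d 0 2 3 * O' 1 4 - d 0 2 4 * O' 1 3
    + d 0 3 4 * O' 1 2 - d 1 2 3 * O' 0 4 + d 1 2 4 * O' 0 3 - d 1 3 4 * O' 0 2 + d 2 3 4 * O' 0 1)"
proof -
  define Q where "Q = (\<lambda>i a b c e. P i a b * O' c e + O' a b * P i c e - (P i a c * O' b e + O' a c * P i b e)
      + (P i a e * O' b c + O' a e * P i b c))"
  have D: "frechet_derivative (\<lambda>x. pf (A x) w) (at x) = (\<lambda>y. 2 *
    ((A' (w 0) (w 1) y * A x (w 2) (w 3) + A x (w 0) (w 1) * A' (w 2) (w 3) y)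
    - (A' (w 0) (w 2) y * A x (w 1) (w 3) + A x (w 0) (w 2) * A' (w 1) (w 3) y)
    + (A' (w 0) (w 3) y * A x (w 1) (w 2) + A x (w 0) (w 3) * A' (w 1) (w 2) y)))" for w
    by (rule frechet_derivative_at[symmetric], rule has_derivative_pf[OF A])
  have 4: "{..4::nat} = {0,1,2,3,4}" by auto
  have "del 4 (\<lambda>y. pf (A y)) x v =
    2 * (Q 0 1 2 3 4 - Q 1 0 2 3 4 + Q 2 0 1 3 4 - Q 3 0 1 2 4 + Q 4 0 1 2 3)"
    unfolding del_def D 4 part10_pf by (simp add: omit_def Q_def P_def O'_def algebra_simps numeral_2_eq_2[symmetric])
  also have "Q 0 1 2 3 4 - Q 1 0 2 3 4 + Q 2 0 1 3 4 - Q 3 0 1 2 4 + Q 4 0 1 2 3 =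
    d 0 1 2 * O' 3 4 - d 0 1 3 * O' 2 4 + d 0 1 4 * O' 2 3 + d 0 2 3 * O' 1 4 - d 0 2 4 * O' 1 3
    + d 0 3 4 * O' 1 2 - d 1 2 3 * O' 0 4 + d 1 2 4 * O' 0 3 - d 1 3 4 * O' 0 2 + d 2 3 4 * O' 0 1"
    unfolding Q_def d_def by (rule alternating_sum_square)
  finally show ?thesis .
qed

definition wedge22 :: "(nat \<Rightarrow> nat \<Rightarrow> complex) \<Rightarrow> (nat \<Rightarrow> nat \<Rightarrow> complex) \<Rightarrow> nat \<Rightarrow> nat \<Rightarrow> nat \<Rightarrow> nat \<Rightarrow> complex" where
  "wedge22 T N i j k l = T i j * N k l - T i k * N j l + T i l * N j k + T j k * N i l - T j l * N i k + T k l * N i j"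

text \<open>With \<open>\<Omega> = N + e \<and> e'\<close> and \<open>d = T \<and> e' - e \<and> S\<close> the product \<open>d \<and> \<Omega>\<close> contains
  \<open>N\<close> only through \<open>T \<and> N\<close> and \<open>S \<and> N\<close>, since \<open>e \<and> e = e' \<and> e' = 0\<close>.\<close>

lemma wedge32_zero:
  fixes e e' :: "nat \<Rightarrow> complex" and T S N :: "nat \<Rightarrow> nat \<Rightarrow> complex"
  defines "O' \<equiv> \<lambda>j k. N j k + e j * e' k - e k * e' j"
    and "d \<equiv> \<lambda>i j k. T i j * e' k - T i k * e' j + T j k * e' i - e k * S i j + e j * S i k - e i * S j k"
  assumes T: "\<And>i j k l. wedge22 T N i j k l = 0" and S: "\<And>i j k l. wedge22 S N i j k l = 0"
  shows "d 0 1 2 * O' 3 4 - d 0 1 3 * O' 2 4 + d 0 1 4 * O' 2 3 + d 0 2 3 * O' 1 4 - d 0 2 4 * O' 1 3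
    + d 0 3 4 * O' 1 2 - d 1 2 3 * O' 0 4 + d 1 2 4 * O' 0 3 - d 1 3 4 * O' 0 2 + d 2 3 4 * O' 0 1 = 0"
    (is "?L = 0")
proof -
  have "?L = e' 4 * wedge22 T N 0 1 2 3 - e' 3 * wedge22 T N 0 1 2 4 + e' 2 * wedge22 T N 0 1 3 4
      - e' 1 * wedge22 T N 0 2 3 4 + e' 0 * wedge22 T N 1 2 3 4
      - (e 4 * wedge22 S N 0 1 2 3 - e 3 * wedge22 S N 0 1 2 4 + e 2 * wedge22 S N 0 1 3 4
      - e 1 * wedge22 S N 0 2 3 4 + e 0 * wedge22 S N 1 2 3 4)"
    unfolding d_def O'_def wedge22_def by (simp add: algebra_simps)
  then show ?thesis
    by (simp add: T S)
qed

text \<open>With two base coordinates a (2,0)-form times a (1,1)-form has type (3,1) and must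
  vanish; \<open>p\<close>, \<open>q\<close> stand for the (1,0)-forms and \<open>p'\<close>,
  \<open>q'\<close> for their conjugates.\<close>

lemma wedge22_20_11:
  fixes p q p' q' :: "nat \<Rightarrow> complex"
  shows "wedge22 (\<lambda>i j. t * (q i * p j - q j * p i))
    (\<lambda>j k. (D * ((p j + q j) * (p' k + q' k)) + B * (q j * q' k)) -
      (D * ((p k + q k) * (p' j + q' j)) + B * (q k * q' j))) i j k l = 0"
  unfolding wedge22_def by (simp add: algebra_simps)

text \<open>If f and h are the coefficient matrices of the two (1,1)-forms, the product is a
  multiple of f11 h22 + f22 h11 - f12 h21 - f21 h12, here D (D + B) + D - 2 D.\<close>

lemma wedge22_11_11:
  fixes p q p' q' :: "nat \<Rightarrow> complex"
  assumes D: "D + B = 1"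
  shows "wedge22 (\<lambda>i j. (D * p i * p' j + 2 * q i * p' j + q i * q' j) -
       (D * p j * p' i + 2 * q j * p' i + q j * q' i))
    (\<lambda>j k. (D * ((p j + q j) * (p' k + q' k)) + B * (q j * q' k)) -
      (D * ((p k + q k) * (p' j + q' j)) + B * (q k * q' j))) i j k l = 0"
proof -
  have B: "B = 1 - D" using D by (simp add: algebra_simps)
  show ?thesis
    unfolding wedge22_def B by (simp add: algebra_simps)
qed


section \<open>Fundamental forms of Hermitian metrics and the operators on real forms\<close>

lemma hermitian_metric_anti:
  assumes "hermitian_metric A g" "c \<in> A" "x \<in> snd c ` fst c"
  shows "g c x (\<i> *s w) u = - g c x (\<i> *s u) w"
proof -
  have lin: "linear (g c x u)" and sym: "g c x u w = g c x w u"
    and J: "g c x (\<i> *s u) (\<i> *s w) = g c x u w" for u w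
    using assms unfolding hermitian_metric_def by blast+
  have "g c x (\<i> *s w) u = g c x (\<i> *s (\<i> *s w)) (\<i> *s u)"
    by (rule J[symmetric])
  also have "\<i> *s (\<i> *s w) = - w"
    by (simp add: vec_eq_iff vector_smult_assoc)
  also have "g c x (- w) (\<i> *s u) = - g c x (\<i> *s u) w"
    using linear_neg[OF lin] sym by metis
  finally show ?thesis .
qed

lemma fundamental_power_pf:
  fixes g :: "('m, 3) metric"
  assumes "\<And>u w. g c x (\<i> *s w) u = - g c x (\<i> *s u) w"
  shows "fundamental_power g c x = pf (\<lambda>u w. of_real (g c x (\<i> *s u) w))"
proof -
  define A where "A u w = complex_of_real (g c x (\<i> *s u) w)" for u w
  have "A w u = - A u w" for u w
    unfolding A_def by (subst assms) simp
  then have "wedge_power 2 (\<lambda>v. A (v 0) (v 1)) v = pf A v" for v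
    unfolding pf_def by (rule wedge_power_2)
  moreover have "fundamental_power g c x = wedge_power 2 (\<lambda>v. A (v 0) (v 1))"
    by (simp add: fundamental_power_def fundamental_form_def[abs_def] A_def)
  ultimately have "fundamental_power g c x = pf A"
    by (simp add: fun_eq_iff)
  then show ?thesis
    by (simp add: A_def[abs_def])
qed

lemma ext_d_eq: "ext_d k \<omega> x v = del k \<omega> x v + delbar k \<omega> x v"
  unfolding ext_d_def del_def delbar_def sum.distrib[symmetric]
  by (intro sum.cong refl) (simp add: part10_def part01_def field_simps)

text \<open>For a real-valued functional, \<open>part01\<close> is the conjugate of
  \<open>part10\<close>. Hence a real form annihilated by \<open>del\<close> is closed.\<close>

lemma delbar_real:
  assumes "\<And>w. (\<lambda>y. \<omega> y w) differentiable (at x)" "\<And>y w. cnj (\<omega> y w) = \<omega> y w"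
  shows "delbar k \<omega> x v = cnj (del k \<omega> x v)"
proof -
  have "cnj (frechet_derivative (\<lambda>y. \<omega> y w) (at x) u) = frechet_derivative (\<lambda>y. \<omega> y w) (at x) u" for w u
  proof -
    have "((\<lambda>y. \<omega> y w) has_derivative frechet_derivative (\<lambda>y. \<omega> y w) (at x)) (at x)"
      using assms(1) frechet_derivative_works by blast
    from has_derivative_cnj[OF this]
    have "((\<lambda>y. \<omega> y w) has_derivative (\<lambda>u. cnj (frechet_derivative (\<lambda>y. \<omega> y w) (at x) u))) (at x)"
      by (simp add: assms(2))
    from frechet_derivative_at[OF this] show ?thesis
      by metis
  qed
  then show ?thesis
    by (simp add: delbar_def del_def part01_def part10_def)
qed


section \<open>The balanced metrics\<close>

text \<open>The invariant \<open>(1,0)\<close>-form that restricts to the differential of the fibre coordinate, and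
  its derivative with respect to the base point.\<close>

definition eps :: "complex \<Rightarrow> complex^3 \<Rightarrow> complex^3 \<Rightarrow> complex" where
  "eps a x u = u$3 + (cnj (x$1) + 2 * cnj (zcoord a (x$2))) * u$1 + cnj (zcoord a (x$2)) * u$2"

definition deps :: "complex \<Rightarrow> complex^3 \<Rightarrow> complex^3 \<Rightarrow> complex" where
  "deps a u y = (cnj (y$1) + 2 * cnj (zcoord a (y$2))) * u$1 + cnj (zcoord a (y$2)) * u$2"

text \<open>On the base the coefficients are chosen such that the \<open>(1,1)\<close>-part of the differential of
  \<open>eps\<close> is trace-free; the form is positive definite because \<open>a \<noteq> 0\<close>.\<close>

definition herm :: "complex \<Rightarrow> complex^3 \<Rightarrow> complex^3 \<Rightarrow> complex^3 \<Rightarrow> complex" where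
  "herm a x u w = (1 - a * cnj a) * ((u$1 + u$2) * cnj (w$1 + w$2)) + a * cnj a * (u$2 * cnj (w$2))
     + eps a x u * cnj (eps a x w)"

definition nil_metric :: "complex \<Rightarrow> (complex^3, 3) metric" where
  "nil_metric a = (\<lambda>c x u w. Re (herm a x u w))"

text \<open>The fundamental form Re (herm (\<i> u, w)) of \<open>nil_metric\<close>, with the real
  part written out so that only complex polynomials have to be differentiated.\<close>

definition Om :: "complex \<Rightarrow> complex^3 \<Rightarrow> complex^3 \<Rightarrow> complex^3 \<Rightarrow> complex" where
  "Om a x u w = \<i> / 2 * (herm a x u w - herm a x w u)"

lemma eps_arith:
  "eps a x (u + w) = eps a x u + eps a x w" "eps a x (r *\<^sub>R u) = of_real r * eps a x u"
  "eps a x (c *s u) = c * eps a x u"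
  by (simp_all add: eps_def algebra_simps scaleR_conv_of_real[where 'a = complex])

lemma cnj_herm: "cnj (herm a x u w) = herm a x w u"
  by (simp add: herm_def algebra_simps)

lemma herm_smult: "herm a x (c *s u) w = c * herm a x u w" "herm a x u (c *s w) = cnj c * herm a x u w"
  by (simp_all add: herm_def eps_arith algebra_simps)

lemma Om_eq: "of_real (nil_metric a c x (\<i> *s u) w) = Om a x u w"
proof -
  have "of_real (nil_metric a c x (\<i> *s u) w) = (\<i> * herm a x u w + cnj (\<i> * herm a x u w)) / 2"
    unfolding nil_metric_def herm_smult complex_add_cnj by simp
  then show ?thesis
    by (simp add: Om_def cnj_herm algebra_simps)
qed

text \<open>Moving the base point adds conjugated entries of \<open>l\<close> to the coefficients of
  \<open>eps\<close>, and these cancel the shear in the third component of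
  \<open>hol_act_deriv l\<close>.\<close>

lemma eps_hol_act:
  assumes "a \<in> unit_disc"
  shows "eps a (hol_act l a x) (hol_act_deriv l u) = eps a x u"
proof -
  have "zcoord a (x$2 + l$2 + a * cnj (l$2)) = zcoord a (x$2) + zcoord a (l$2 + a * cnj (l$2))"
    by (simp add: zcoord_def add_divide_distrib[symmetric] algebra_simps)
  then have "zcoord a (x$2 + l$2 + a * cnj (l$2)) = zcoord a (x$2) + l$2"
    using zcoord_left[OF assms] by simp
  then show ?thesis
    by (simp add: eps_def hol_act_def hol_act_deriv_def algebra_simps)
qed

lemma herm_hol_act:
  assumes "a \<in> unit_disc"
  shows "herm a (hol_act l a x) (hol_act_deriv l u) (hol_act_deriv l w) = herm a x u w"
  unfolding herm_def eps_hol_act[OF assms] by (simp add: hol_act_deriv_def)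

lemma herm_positive:
  assumes "a \<in> unit_disc" "a \<noteq> 0" "u \<noteq> 0"
  shows "Re (herm a x u u) > 0"
proof -
  have sq: "z * cnj z = of_real ((norm z)\<^sup>2)" for z
    by (simp only: complex_norm_square)
  have h: "herm a x u u = of_real ((1 - (norm a)\<^sup>2) * (norm (u$1 + u$2))\<^sup>2 + (norm a)\<^sup>2 * (norm (u$2))\<^sup>2
      + (norm (eps a x u))\<^sup>2)"
    unfolding herm_def sq by simp
  \<comment> \<open>Here \<open>a \<noteq> 0\<close> enters: without the second weight the base part
    would vanish on vectors with \<open>u$1 + u$2 = 0\<close>.\<close>
  have a: "(norm a)\<^sup>2 < 1" "(norm a)\<^sup>2 > 0"
    using assms by (auto simp: power_less_one_iff)
  have pos: "0 \<le> (1 - (norm a)\<^sup>2) * (norm (u$1 + u$2))\<^sup>2" "0 \<le> (norm a)\<^sup>2 * (norm (u$2))\<^sup>2"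
    using a by simp_all
  show ?thesis
  proof (rule ccontr)
    assume "\<not> ?thesis"
    then have "(1 - (norm a)\<^sup>2) * (norm (u$1 + u$2))\<^sup>2 + (norm a)\<^sup>2 * (norm (u$2))\<^sup>2
        + (norm (eps a x u))\<^sup>2 \<le> 0"
      unfolding h by simp
    then have "(1 - (norm a)\<^sup>2) * (norm (u$1 + u$2))\<^sup>2 = 0 \<and> (norm a)\<^sup>2 * (norm (u$2))\<^sup>2 = 0
      \<and> (norm (eps a x u))\<^sup>2 = 0"
      using pos zero_le_power2[of "norm (eps a x u)"] by linarith
    then have "u$2 = 0" "u$1 = 0" "u$3 = 0"
      using a by (auto simp: eps_def)
    then show False
      using assms(3) by (metis vec3_eqI zero_index)
  qed
qed

lemma smooth_on_herm:
  assumes "a \<in> unit_disc" "open S"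
  shows "smooth_on S (\<lambda>x. Re (herm a x u w))"
  unfolding herm_def eps_def zcoord_def using assms disc_denom[OF assms(1)]
  by (intro smooth_on_intros) auto

lemma hermitian_nil_metric:
  assumes a: "a \<in> unit_disc" "a \<noteq> 0"
  shows "hermitian_metric (nil_atlas a) (nil_metric a)"
  unfolding hermitian_metric_def nil_metric_def
proof (intro conjI ballI allI impI)
  fix x u w
  show "linear (\<lambda>w. Re (herm a x u w))"
    by (simp add: linear_iff herm_def eps_arith algebra_simps scaleR_conv_of_real[where 'a = complex])
  show "Re (herm a x u w) = Re (herm a x w u)"
    using cnj_herm[of a x u w] by (metis cnj.simps(1))
  show "Re (herm a x u u) > 0" if "u \<noteq> 0"
    using herm_positive[OF a that] .
  show "Re (herm a x (\<i> *s u) (\<i> *s w)) = Re (herm a x u w)"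
    by (simp add: herm_smult)
next
  fix c u w assume "c \<in> nil_atlas a"
  then have "is_chart nil_top c"
    using compact_complex_manifold_nil[OF a(1)]
    unfolding compact_complex_manifold_def complex_manifold_def by blast
  then show "smooth_on (snd c ` fst c) (\<lambda>x. Re (herm a x u w))"
    by (intro smooth_on_herm a) (simp add: is_chart_def)
next
  fix c c' x u w assume "c \<in> nil_atlas a" "c' \<in> nil_atlas a" "x \<in> snd c ` (fst c \<inter> fst c')"
  then obtain l where "transition c c' x = hol_act l a x"
    "frechet_derivative (transition c c') (at x) = hol_act_deriv l"
    using nil_transition_deriv[OF a(1)] by metis
  then show "Re (herm a x u w) = Re (herm a (transition c c' x) (frechet_derivative (transition c c') (at x) u)
      (frechet_derivative (transition c c') (at x) w))"
    using herm_hol_act[OF a(1)] by simp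
qed

lemma has_derivative_eps: "((\<lambda>x. eps a x u) has_derivative deps a u) (at x)"
proof -
  have "bounded_linear (zcoord a)"
    by (simp add: zcoord_def linear_conv_bounded_linear[symmetric] linear_iff
        scaleR_conv_of_real add_divide_distrib[symmetric]) (simp add: algebra_simps)
  then have "bounded_linear (\<lambda>x :: complex^3. zcoord a (x $ 2))"
    using bounded_linear_compose[OF _ bounded_linear_vec_nth] by blast
  then have "((\<lambda>x. zcoord a (x $ 2)) has_derivative (\<lambda>y. zcoord a (y $ 2))) (at x)"
    by (rule bounded_linear_imp_has_derivative)
  note [derivative_intros] = this bounded_linear_imp_has_derivative[OF bounded_linear_vec_nth]
  show ?thesis
    unfolding eps_def deps_def
    by (auto intro!: derivative_eq_intros simp: algebra_simps)
qed

lemma has_derivative_Om: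
  "((\<lambda>x. Om a x u w) has_derivative (\<lambda>y. \<i> / 2 *
     ((deps a u y * cnj (eps a x w) + eps a x u * cnj (deps a w y)) -
      (deps a w y * cnj (eps a x u) + eps a x w * cnj (deps a u y))))) (at x)"
  unfolding Om_def herm_def
  by (auto intro!: derivative_eq_intros has_derivative_eps simp: fun_eq_iff field_simps)

lemma wedge22_scale: "wedge22 (\<lambda>i j. c * X i j) N i j k l = c * wedge22 X N i j k l"
  by (simp add: wedge22_def algebra_simps)

lemma alternating_scale:
  fixes c :: complex
  shows "c * x1 * (c * y1) - c * x2 * (c * y2) + c * x3 * (c * y3) + c * x4 * (c * y4)
    - c * x5 * (c * y5) + c * x6 * (c * y6) - c * x7 * (c * y7) + c * x8 * (c * y8)
    - c * x9 * (c * y9) + c * x10 * (c * y10) =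
    c\<^sup>2 * (x1 * y1 - x2 * y2 + x3 * y3 + x4 * y4 - x5 * y5 + x6 * y6 - x7 * y7 + x8 * y8
      - x9 * y9 + x10 * y10)"
  by (simp add: algebra_simps power2_eq_square)

lemma del_Om_square:
  assumes a: "a \<in> unit_disc"
  shows "del 4 (\<lambda>y. pf (Om a y)) x v = 0"
proof -
  define D where "D = 1 - a * cnj a"
  have D: "D \<noteq> 0" "cnj D = D"
    using disc_denom[OF a] by (simp_all add: D_def mult.commute)
  define p q e where "p i = v i $ 1" and "q i = v i $ 2" and "e i = eps a x (v i)" for i
  \<comment> \<open>\<open>T\<close> is \<open>del\<close> of eps, of type (2,0); \<open>S\<close>
    is \<open>del\<close> of its conjugate, of type (1,1); \<open>N\<close> is the base part of the
    fundamental form without the factor \<i>/2.\<close>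
  define T where "T i j = - 2 * cnj a / D * (q i * p j - q j * p i)" for i j
  define S where "S i j = 1 / D * ((D * p i * cnj (p j) + 2 * q i * cnj (p j) + q i * cnj (q j)) -
       (D * p j * cnj (p i) + 2 * q j * cnj (p i) + q j * cnj (q i)))" for i j
  define N where "N j k = (D * ((p j + q j) * (cnj (p k) + cnj (q k))) + a * cnj a * (q j * cnj (q k))) -
      (D * ((p k + q k) * (cnj (p j) + cnj (q j))) + a * cnj a * (q k * cnj (q j)))" for j k
  define A' where "A' = (\<lambda>u w y. \<i> / 2 *
     ((deps a u y * cnj (eps a x w) + eps a x u * cnj (deps a w y)) -
      (deps a w y * cnj (eps a x u) + eps a x w * cnj (deps a u y))))"
  have HA: "((\<lambda>x. Om a x u w) has_derivative A' u w) (at x)" for u w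
    unfolding A'_def by (rule has_derivative_Om)
  define P where "P i j k = part10 (A' (v j) (v k)) (v i)" for i j k
  define t where "t i j = part10 (deps a (v j)) (v i)" for i j
  define s where "s i j = part10 (\<lambda>y. cnj (deps a (v j) y)) (v i)" for i j
  have P: "P i j k = \<i> / 2 * (t i j * cnj (e k) + e j * s i k - t i k * cnj (e j) - e k * s i j)" for i j k
    by (simp add: P_def A'_def t_def s_def e_def part10_def field_simps)
  have t: "t i j = - (cnj a / D) * q i * (2 * p j + q j)" for i j
    using D by (simp add: t_def part10_def deps_def zcoord_def p_def q_def D_def[symmetric] field_simps)
  have s: "s i j = (p i + 2 * q i / D) * cnj (p j) + q i / D * cnj (q j)" for i j
    using D by (simp add: s_def part10_def deps_def zcoord_def p_def q_def D_def[symmetric] field_simps)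
  have T: "t i j - t j i = T i j" for i j
    using D by (simp add: T_def t field_simps)
  have S: "s i j - s j i = S i j" for i j
    using D by (simp add: S_def s field_simps)
  have d: "P i j k - P j i k + P k i j = \<i> / 2 *
     (T i j * cnj (e k) - T i k * cnj (e j) + T j k * cnj (e i) - e k * S i j + e j * S i k - e i * S j k)"
    for i j k
    unfolding P T[symmetric] S[symmetric] by (simp add: algebra_simps)
  have Om: "Om a x (v j) (v k) = \<i> / 2 * (N j k + e j * cnj (e k) - e k * cnj (e j))" for j k
    by (simp add: Om_def herm_def N_def p_def q_def e_def D_def)
  have TN: "wedge22 T N i j k l = 0" for i j k l
    unfolding T_def N_def wedge22_20_11 by simp
  have SN: "wedge22 S N i j k l = 0" for i j k l
    unfolding S_def N_def wedge22_scale
    using wedge22_11_11[of D "a * cnj a" p "\<lambda>i. cnj (p i)" q "\<lambda>i. cnj (q i)"] by (simp add: D_def)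
  show ?thesis
    unfolding del_pf[OF HA] P_def[symmetric] d Om alternating_scale
    using wedge32_zero[where e = e and e' = "\<lambda>i. cnj (e i)", OF TN SN] by simp
qed

lemma fundamental_power_nil_metric: "fundamental_power (nil_metric a) c x = pf (Om a x)"
proof -
  have "nil_metric a c x (\<i> *s w) u = - nil_metric a c x (\<i> *s u) w" for u w
  proof -
    have "complex_of_real (nil_metric a c x (\<i> *s w) u) = of_real (- nil_metric a c x (\<i> *s u) w)"
      unfolding of_real_minus Om_eq by (simp add: Om_def algebra_simps)
    then show ?thesis
      by (simp only: of_real_eq_iff)
  qed
  from fundamental_power_pf[of "nil_metric a", OF this] show ?thesis
    by (simp add: Om_eq)
qed

lemma cnj_Om: "cnj (Om a x u w) = Om a x u w"
  by (simp add: Om_def cnj_herm algebra_simps)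

lemma balanced_nil_metric:
  assumes a: "a \<in> unit_disc" "a \<noteq> 0"
  shows "balanced_metric (nil_atlas a) (nil_metric a)"
proof -
  have "delbar 4 (\<lambda>y. pf (Om a y)) x v = cnj (del 4 (\<lambda>y. pf (Om a y)) x v)" for x v
  proof (rule delbar_real)
    show "(\<lambda>y. pf (Om a y) w) differentiable (at x)" for w
      using has_derivative_pf[OF has_derivative_Om] by (rule differentiableI)
    show "cnj (pf (Om a y) w) = pf (Om a y) w" for y w
      by (simp add: pf_def cnj_Om)
  qed
  then have "ext_d 4 (\<lambda>y. pf (Om a y)) x v = 0" for x v
    by (simp add: ext_d_eq del_Om_square[OF a(1)])
  then show ?thesis
    using hermitian_nil_metric[OF a]
    by (simp add: balanced_metric_def form_eq_def fundamental_power_nil_metric[abs_def])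
qed

lemma smooth_form_0: "smooth_form A k (\<lambda>c x v. 0)"
  by (simp add: smooth_form_def alternating_covector_def smooth_on_const linear_iff)

text \<open>The zero form is a primitive, since \<open>del\<close> of the squared fundamental form
  vanishes. The failure of closedness for the strongly Gauduchon property needs this metric on the
  fibres with \<open>a \<noteq> 0\<close>.\<close>

lemma strongly_gauduchon_nil_metric:
  assumes a: "a \<in> unit_disc" "a \<noteq> 0"
  shows "strongly_gauduchon_metric (nil_atlas a) (nil_metric a)"
proof -
  let ?\<gamma> = "\<lambda>c x v. 0 :: complex"
  have "smooth_form (nil_atlas a) 4 ?\<gamma>"
    by (rule smooth_form_0)
  moreover have "delbar 4 (\<lambda>x v. 0) x v = 0" for x and v :: "nat \<Rightarrow> complex^3"
    by (simp add: delbar_def part01_def)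
  ultimately have "delbar_exact (nil_atlas a) 5 (\<lambda>c. del 4 (\<lambda>y. pf (Om a y)))"
    unfolding delbar_exact_def form_eq_def
    by (intro exI[of _ ?\<gamma>] exI[of _ 4]) (simp add: del_Om_square[OF a(1)])
  then show ?thesis
    using hermitian_nil_metric[OF a]
    by (simp add: strongly_gauduchon_metric_def fundamental_power_nil_metric[abs_def])
qed


section \<open>Averages over the quotient\<close>

text \<open>The shifted cube is cut along the face x . b = 1, and the protruding slab is moved back
  by the period \<open>b\<close>.\<close>

lemma integral_shift_periodic_unit:
  fixes F :: "'a::euclidean_space \<Rightarrow> 'b::banach"
  assumes F: "continuous_on UNIV F" and per: "\<And>x. F (x + b) = F x"
    and b: "b \<in> Basis" and t: "0 \<le> t" "t \<le> 1"
  shows "integral (cbox 0 One) (\<lambda>x. F (x + t *\<^sub>R b)) = integral (cbox 0 One) F"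
proof -
  have int: "F integrable_on cbox u v" for u v
    using F by (intro integrable_continuous) (auto intro: continuous_on_subset)
  have bb: "b \<bullet> i = (if i = b then 1 else 0)" if "i \<in> Basis" for i
    using b that by (auto simp: inner_Basis)
  have box: "cbox (t *\<^sub>R b) (One + t *\<^sub>R b) \<inter> {x. x \<bullet> b \<le> 1} = cbox (t *\<^sub>R b) One"
      "cbox (t *\<^sub>R b) (One + t *\<^sub>R b) \<inter> {x. x \<bullet> b \<ge> 1} = cbox b (One + t *\<^sub>R b)"
      "cbox 0 One \<inter> {x. x \<bullet> b \<le> t} = cbox (b - b) (One + t *\<^sub>R b - b)"
      "cbox 0 One \<inter> {x. x \<bullet> b \<ge> t} = cbox (t *\<^sub>R b) One"
    using b t by (auto simp: mem_box inner_add_left inner_diff_left bb split: if_splits)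
      (smt (verit) b bb)+
  have "integral (cbox 0 One) (\<lambda>x. F (x + t *\<^sub>R b)) = integral (cbox (t *\<^sub>R b) (One + t *\<^sub>R b)) F"
    using integral_shift_cbox[of "t *\<^sub>R b" "t *\<^sub>R b" "One + t *\<^sub>R b" F] by simp
  also have "\<dots> = integral (cbox (t *\<^sub>R b) One) F + integral (cbox b (One + t *\<^sub>R b)) F"
    using integral_split[OF int b, of "t *\<^sub>R b" "One + t *\<^sub>R b" 1] unfolding box by simp
  also have "integral (cbox b (One + t *\<^sub>R b)) F = integral (cbox (b - b) (One + t *\<^sub>R b - b)) F"
    using integral_shift_cbox[of b b "One + t *\<^sub>R b" F] by (simp add: per)
  also have "integral (cbox (t *\<^sub>R b) One) F + \<dots> = integral (cbox 0 One) F"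
    using integral_split[OF int b, of 0 One t] unfolding box by simp
  finally show ?thesis .
qed

lemma integral_shift_periodic:
  fixes F :: "'a::euclidean_space \<Rightarrow> 'b::banach"
  assumes F: "continuous_on UNIV F" and per: "\<And>x. F (x + b) = F x" and b: "b \<in> Basis"
  shows "integral (cbox 0 One) (\<lambda>x. F (x + t *\<^sub>R b)) = integral (cbox 0 One) F"
proof -
  have nat: "F (x + real n *\<^sub>R b) = F x" for x n
  proof (induction n)
    case (Suc n)
    have "F (x + real (Suc n) *\<^sub>R b) = F ((x + real n *\<^sub>R b) + b)"
      by (simp add: algebra_simps)
    then show ?case using per Suc by metis
  qed simp
  have int: "F (x + of_int n *\<^sub>R b) = F x" for x n
  proof (cases n)
    case (neg m)
    then show ?thesis
      using nat[of "x + of_int n *\<^sub>R b" "Suc m"] by (simp add: scaleR_add_left[symmetric] add.assoc)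
  qed (simp add: nat)
  have "F (x + t *\<^sub>R b) = F (x + frac t *\<^sub>R b)" for x
    using int[of "x + frac t *\<^sub>R b" "\<lfloor>t\<rfloor>"] by (simp add: frac_def algebra_simps)
  then show ?thesis
    using integral_shift_periodic_unit[OF F per b, of "frac t"] frac_lt_1[of t] by simp
qed

text \<open>The integral of a translate does not depend on the amount of translation;
  differentiating it under the integral sign gives the claim.\<close>

lemma integral_derivative_periodic:
  fixes F :: "'a::euclidean_space \<Rightarrow> 'b::banach"
  assumes F: "continuous_on UNIV F" and per: "\<And>x. F (x + b) = F x" and b: "b \<in> Basis"
    and G: "continuous_on UNIV G"
    and deriv: "\<And>x t. ((\<lambda>s. F (x + s *\<^sub>R b)) has_vector_derivative G (x + t *\<^sub>R b)) (at t)"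
  shows "integral (cbox 0 One) G = 0"
proof -
  have 1: "((\<lambda>t. integral (cbox 0 One) (\<lambda>x. F (x + t *\<^sub>R b))) has_vector_derivative
      integral (cbox 0 One) (\<lambda>x. G (x + 0 *\<^sub>R b))) (at 0 within cbox 0 1)"
  proof (rule leibniz_rule_vector_derivative)
    show "((\<lambda>t. F (x + t *\<^sub>R b)) has_vector_derivative G (x + t *\<^sub>R b)) (at t within cbox 0 1)" for x t
      using deriv by (rule has_vector_derivative_at_within)
    show "(\<lambda>x. F (x + t *\<^sub>R b)) integrable_on cbox 0 One" for t
      by (intro integrable_continuous continuous_on_compose2[OF F] continuous_intros) auto
    show "continuous_on (cbox 0 1 \<times> cbox 0 One) (\<lambda>(t, x). G (x + t *\<^sub>R b))"
      unfolding case_prod_unfold by (intro continuous_on_compose2[OF G] continuous_intros) auto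
  qed auto
  have 2: "((\<lambda>t. integral (cbox 0 One) (\<lambda>x. F (x + t *\<^sub>R b))) has_vector_derivative 0) (at 0 within cbox 0 (1::real))"
    unfolding integral_shift_periodic[OF F per b] by (rule has_vector_derivative_const)
  show ?thesis
    using vector_derivative_unique_within_closed_interval[OF _ _ 1 2] by simp
qed

lemma integral_cube_pos:
  fixes g :: "'a::euclidean_space \<Rightarrow> real"
  assumes g: "continuous_on UNIV g" and pos: "\<And>x. g x > 0"
  shows "integral (cbox 0 One) g > 0"
proof -
  have g': "continuous_on (cbox 0 One) g"
    using g by (rule continuous_on_subset) simp
  have "cbox (0::'a) One \<noteq> {}"
    by (auto simp: box_ne_empty)
  then obtain x where x: "\<forall>y\<in>cbox 0 One. g x \<le> g y"
    using continuous_attains_inf[OF compact_cbox _ g'] by blast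
  have "integral (cbox 0 One) (\<lambda>y::'a. g x) \<le> integral (cbox 0 One) g"
    using x by (intro integral_le integrable_continuous g') auto
  then show ?thesis
    using pos[of x] by simp
qed

text \<open>The integral over the quotient, as an iterated integral: first over the fibre, on which
  the lattice acts by translations, and then over the base torus.\<close>

definition average :: "(complex^3 \<Rightarrow> complex) \<Rightarrow> complex" where
  "average f = integral (cbox 0 One) (\<lambda>p. integral (cbox 0 One) (\<lambda>s. f (vec3 (fst p) (snd p) s)))"

definition invariant :: "(complex^3 \<Rightarrow> complex) \<Rightarrow> bool" where
  "invariant f \<longleftrightarrow> (\<forall>l\<in>lat. \<forall>x. f (act l x) = f x)"

lemma continuous_on_slice:
  assumes "continuous_on UNIV f"
  shows "continuous_on UNIV (\<lambda>s. f (vec3 v z s))"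
  by (intro continuous_on_compose2[OF assms] continuous_intros) auto

lemma continuous_on_fibre_integral:
  fixes f :: "complex^3 \<Rightarrow> complex"
  assumes "continuous_on UNIV f"
  shows "continuous_on UNIV (\<lambda>p. integral (cbox 0 One) (\<lambda>s. f (vec3 (fst p) (snd p) s)))"
  unfolding case_prod_unfold
  by (rule integral_continuous_on_param)
    (auto simp: case_prod_unfold intro!: continuous_on_compose2[OF assms] continuous_intros)

lemma slice_integrable:
  fixes f :: "complex^3 \<Rightarrow> complex"
  assumes "continuous_on UNIV f"
  shows "(\<lambda>s. f (vec3 v z s)) integrable_on cbox 0 One"
  by (rule integrable_continuous) (use continuous_on_slice[OF assms] in \<open>auto intro: continuous_on_subset\<close>)

lemma fibre_integrable:
  fixes f :: "complex^3 \<Rightarrow> complex"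
  assumes "continuous_on UNIV f"
  shows "(\<lambda>p. integral (cbox 0 One) (\<lambda>s. f (vec3 (fst p) (snd p) s))) integrable_on cbox 0 One"
  by (rule integrable_continuous)
    (use continuous_on_fibre_integral[OF assms] in \<open>auto intro: continuous_on_subset\<close>)

lemma average_add:
  assumes "continuous_on UNIV f" "continuous_on UNIV g"
  shows "average (\<lambda>x. f x + g x) = average f + average g"
  unfolding average_def
  by (simp add: integral_add slice_integrable fibre_integrable assms)

lemma average_cmult: "average (\<lambda>x. c * f x) = c * average f"
  unfolding average_def by simp

lemma average_nonzero:
  assumes f: "continuous_on UNIV f" and pos: "\<And>x. Re (f x) > 0"
  shows "average f \<noteq> 0"
proof -
  have Re: "Re (integral (cbox 0 One) h) = integral (cbox 0 One) (\<lambda>x. Re (h x))"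
    if "h integrable_on cbox 0 One" for h :: "'a::euclidean_space \<Rightarrow> complex"
    using integral_linear[OF that bounded_linear_Re] by (simp add: o_def)
  have "Re (average f) = integral (cbox 0 One) (\<lambda>p. integral (cbox 0 One) (\<lambda>s. Re (f (vec3 (fst p) (snd p) s))))"
    unfolding average_def Re[OF fibre_integrable[OF f]] Re[OF slice_integrable[OF f]] ..
  also have "\<dots> > 0"
  proof (rule integral_cube_pos)
    show "0 < integral (cbox 0 One) (\<lambda>s. Re (f (vec3 (fst p) (snd p) s)))" for p
      using pos by (intro integral_cube_pos continuous_on_Re continuous_on_slice f)
    show "continuous_on UNIV (\<lambda>p. integral (cbox 0 One) (\<lambda>s. Re (f (vec3 (fst p) (snd p) s))))"
      unfolding Re[OF slice_integrable[OF f], symmetric]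
      by (intro continuous_on_Re continuous_on_fibre_integral f)
  qed
  finally show ?thesis by auto
qed

lemma C1_D:
  assumes "Ck_on (Suc 0) UNIV f"
  shows "(f has_derivative frechet_derivative f (at x)) (at x)"
    and "continuous_on UNIV (\<lambda>x. frechet_derivative f (at x) v)" and "continuous_on UNIV f"
proof -
  show "(f has_derivative frechet_derivative f (at x)) (at x)"
    using assms by (simp add: frechet_derivative_works[symmetric])
  show "continuous_on UNIV (\<lambda>x. frechet_derivative f (at x) v)"
    using assms by simp
  show "continuous_on UNIV f"
    using Ck_on_SucD[OF assms] by simp
qed

lemma has_vector_derivative_line:
  assumes "(f has_derivative f') (at (x + t *\<^sub>R b))"
  shows "((\<lambda>s. f (x + s *\<^sub>R b)) has_vector_derivative f' b) (at t)"
proof -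
  have "((\<lambda>s. x + s *\<^sub>R b) has_derivative (\<lambda>h. h *\<^sub>R b)) (at t)"
    by (auto intro!: derivative_eq_intros)
  from has_derivative_compose[OF this assms]
  have "((\<lambda>s. f (x + s *\<^sub>R b)) has_derivative (\<lambda>h. f' (h *\<^sub>R b))) (at t)" .
  then show ?thesis
    using linear_scale[OF has_derivative_linear[OF assms]]
    by (simp add: has_vector_derivative_def)
qed

lemma vec3_arith:
  "vec3 a b c + vec3 a' b' c' = vec3 (a + a') (b + b') (c + c')"
  "r *\<^sub>R vec3 a b c = vec3 (r *\<^sub>R a) (r *\<^sub>R b) (r *\<^sub>R c)" "k *s vec3 a b c = vec3 (k * a) (k * b) (k * c)"
  by (auto intro!: vec3_eqI)

lemma scaleR_Re_Im: "Re c *\<^sub>R 1 + Im c *\<^sub>R \<i> = c"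
  by (simp add: complex_eq_iff)

text \<open>The lattice contains the pure translations of the third coordinate by 1 and \<i>, so the
  integral over each single fibre already vanishes.\<close>

lemma fibre_integral_derivative:
  assumes f: "Ck_on (Suc 0) UNIV f" "invariant f"
  shows "integral (cbox 0 One) (\<lambda>s. frechet_derivative f (at (vec3 v z s)) (vec3 0 0 c)) = 0"
proof -
  have basis: "integral (cbox 0 One) (\<lambda>s. frechet_derivative f (at (vec3 v z s)) (vec3 0 0 b)) = 0"
    if b: "b \<in> Basis" for b
  proof (rule integral_derivative_periodic[OF _ _ b])
    show "continuous_on UNIV (\<lambda>s. f (vec3 v z s))"
      by (intro continuous_on_slice C1_D[OF f(1)])
    show "continuous_on UNIV (\<lambda>s. frechet_derivative f (at (vec3 v z s)) (vec3 0 0 b))"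
      using C1_D(2)[OF f(1)] by (rule continuous_on_slice)
    have "vec3 0 0 b \<in> lat"
      using b by (auto simp: lat_iff Basis_complex_def gauss_ints_def)
    moreover have "vec3 v z (s + b) = act (vec3 0 0 b) (vec3 v z s)" for s
      by (rule vec3_eqI) (simp_all add: act_def)
    ultimately show "f (vec3 v z (s + b)) = f (vec3 v z s)" for s
      using f(2) by (simp add: invariant_def)
    show "((\<lambda>s. f (vec3 v z (x + s *\<^sub>R b))) has_vector_derivative
        frechet_derivative f (at (vec3 v z (x + t *\<^sub>R b))) (vec3 0 0 b)) (at t)" for x t
      using has_vector_derivative_line[OF C1_D(1)[OF f(1)], where x = "vec3 v z x" and t = t and b = "vec3 0 0 b"]
      by (simp add: vec3_arith)
  qed
  have "frechet_derivative f (at x) (vec3 0 0 c) =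
      Re c * frechet_derivative f (at x) (vec3 0 0 1) + Im c * frechet_derivative f (at x) (vec3 0 0 \<i>)" for x
  proof -
    have "linear (frechet_derivative f (at x))"
      using C1_D(1)[OF f(1)] by (rule has_derivative_linear)
    moreover have "vec3 0 0 c = Re c *\<^sub>R vec3 0 0 1 + Im c *\<^sub>R vec3 0 0 \<i>"
      by (simp add: vec3_arith scaleR_Re_Im)
    ultimately show ?thesis
      by (simp add: linear_add linear_scale scaleR_conv_of_real[where 'a = complex])
  qed
  then have "integral (cbox 0 One) (\<lambda>s. frechet_derivative f (at (vec3 v z s)) (vec3 0 0 c)) =
      integral (cbox 0 One) (\<lambda>s. Re c * frechet_derivative f (at (vec3 v z s)) (vec3 0 0 1)) +
      integral (cbox 0 One) (\<lambda>s. Im c * frechet_derivative f (at (vec3 v z s)) (vec3 0 0 \<i>))"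
    using slice_integrable[OF continuous_on_mult_left[OF C1_D(2)[OF f(1)]]] by (simp only: integral_add)
  then show ?thesis
    using basis[of 1] basis[of \<i>] by (simp add: Basis_complex_def)
qed

text \<open>A lattice translation of the base also moves the fibre, but by an amount
  \<open>w\<close> that is constant along it. Since the integrand is periodic on the fibre, its
  integral is unchanged by any such translation, whether or not \<open>w\<close> is a
  period.\<close>

lemma fibre_integral_periodic:
  assumes f: "continuous_on UNIV f" "invariant f" and b: "b \<in> Basis"
  shows "integral (cbox 0 One) (\<lambda>s. f (vec3 (fst (p + b)) (snd (p + b)) s)) =
    integral (cbox 0 One) (\<lambda>s. f (vec3 (fst p) (snd p) s))"
proof -
  let ?F = "\<lambda>s. f (vec3 (fst p) (snd p) s)"
  have per: "?F (s + c) = ?F s" if "c \<in> gauss_ints" for s c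
  proof -
    have "vec3 0 0 c \<in> lat"
      using that by (simp add: lat_iff gauss_ints_closed)
    moreover have "vec3 (fst p) (snd p) (s + c) = act (vec3 0 0 c) (vec3 (fst p) (snd p) s)"
      by (rule vec3_eqI) (simp_all add: act_def)
    ultimately show ?thesis
      using f(2) by (simp add: invariant_def)
  qed
  have b12: "fst b \<in> gauss_ints" "snd b \<in> gauss_ints"
    using b by (auto simp: Basis_prod_def Basis_complex_def gauss_ints_def)
  define w where "w = (cnj (fst b) + 2 * cnj (snd b)) * fst p + cnj (snd b) * snd p"
  have "f (vec3 (fst (p + b)) (snd (p + b)) s) = ?F (s + w)" for s
  proof -
    have "vec3 (fst b) (snd b) 0 \<in> lat"
      using b12 by (simp add: lat_iff gauss_ints_closed)
    moreover have "vec3 (fst (p + b)) (snd (p + b)) s = act (vec3 (fst b) (snd b) 0) (vec3 (fst p) (snd p) (s + w))"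
      by (rule vec3_eqI) (simp_all add: act_def w_def)
    ultimately show ?thesis
      using f(2) by (simp add: invariant_def)
  qed
  then have "integral (cbox 0 One) (\<lambda>s. f (vec3 (fst (p + b)) (snd (p + b)) s)) =
      integral (cbox 0 One) (\<lambda>s. ?F (s + w))"
    by simp
  also have "\<dots> = integral (cbox 0 One) (\<lambda>s. ?F ((s + Re w *\<^sub>R 1) + Im w *\<^sub>R \<i>))"
    by (intro arg_cong[of _ _ "integral _"] ext arg_cong[of _ _ f] arg_cong[of _ _ "vec3 _ _"])
      (simp add: complex_eq_iff)
  also have "\<dots> = integral (cbox 0 One) (\<lambda>s. ?F (s + Im w *\<^sub>R \<i>))"
  proof (rule integral_shift_periodic[of "\<lambda>s. ?F (s + Im w *\<^sub>R \<i>)" 1 "Re w"])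
    show "?F (s + 1 + Im w *\<^sub>R \<i>) = ?F (s + Im w *\<^sub>R \<i>)" for s
      using per[of 1 "s + Im w *\<^sub>R \<i>"] by (simp add: gauss_ints_def add.assoc add.commute[of 1])
  qed (auto simp: Basis_complex_def intro!: continuous_on_compose2[OF f(1)] continuous_intros)
  also have "\<dots> = integral (cbox 0 One) ?F"
    by (rule integral_shift_periodic[of ?F \<i> "Im w"])
      (use per[of \<i>] in \<open>auto simp: gauss_ints_def Basis_complex_def intro!: continuous_on_slice f(1)\<close>)
  finally show ?thesis .
qed

lemma average_basis_derivative:
  assumes f: "Ck_on (Suc 0) UNIV f" "invariant f" and b: "b \<in> Basis"
  shows "average (\<lambda>x. frechet_derivative f (at x) (vec3 (fst b) (snd b) 0)) = 0"
  unfolding average_def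
proof (rule integral_derivative_periodic[OF _ _ b])
  let ?D = "\<lambda>x. frechet_derivative f (at x) (vec3 (fst b) (snd b) 0)"
  show "continuous_on UNIV (\<lambda>p. integral (cbox 0 One) (\<lambda>s. f (vec3 (fst p) (snd p) s)))"
    by (intro continuous_on_fibre_integral C1_D[OF f(1)])
  show "continuous_on UNIV (\<lambda>p. integral (cbox 0 One) (\<lambda>s. ?D (vec3 (fst p) (snd p) s)))"
    by (intro continuous_on_fibre_integral C1_D[OF f(1)])
  show "integral (cbox 0 One) (\<lambda>s. f (vec3 (fst (p + b)) (snd (p + b)) s)) =
      integral (cbox 0 One) (\<lambda>s. f (vec3 (fst p) (snd p) s))" for p
    by (rule fibre_integral_periodic[OF C1_D(3)[OF f(1)] f(2) b])
  fix p and t :: real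
  have "((\<lambda>t. integral (cbox 0 One) (\<lambda>s. f (vec3 (fst (p + t *\<^sub>R b)) (snd (p + t *\<^sub>R b)) s)))
      has_vector_derivative
      integral (cbox 0 One) (\<lambda>s. ?D (vec3 (fst (p + t *\<^sub>R b)) (snd (p + t *\<^sub>R b)) s))) (at t within UNIV)"
  proof (rule leibniz_rule_vector_derivative)
    show "((\<lambda>t. f (vec3 (fst (p + t *\<^sub>R b)) (snd (p + t *\<^sub>R b)) s)) has_vector_derivative
        ?D (vec3 (fst (p + t *\<^sub>R b)) (snd (p + t *\<^sub>R b)) s)) (at t within UNIV)" for t s
      using has_vector_derivative_line[OF C1_D(1)[OF f(1)], where x = "vec3 (fst p) (snd p) s" and t = t
          and b = "vec3 (fst b) (snd b) 0"]
      by (simp add: vec3_arith)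
    show "(\<lambda>s. f (vec3 (fst (p + t *\<^sub>R b)) (snd (p + t *\<^sub>R b)) s)) integrable_on cbox 0 One" for t
      by (intro slice_integrable C1_D[OF f(1)])
    show "continuous_on (UNIV \<times> cbox 0 One) (\<lambda>(t, s). ?D (vec3 (fst (p + t *\<^sub>R b)) (snd (p + t *\<^sub>R b)) s))"
      unfolding case_prod_unfold by (intro continuous_on_compose2[OF C1_D(2)[OF f(1)]] continuous_intros) auto
  qed auto
  then show "((\<lambda>t. integral (cbox 0 One) (\<lambda>s. f (vec3 (fst (p + t *\<^sub>R b)) (snd (p + t *\<^sub>R b)) s)))
      has_vector_derivative
      integral (cbox 0 One) (\<lambda>s. ?D (vec3 (fst (p + t *\<^sub>R b)) (snd (p + t *\<^sub>R b)) s))) (at t)"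
    by simp
qed

text \<open>Continuity is included because averages may be added only for integrable
  functions.\<close>

definition null :: "(complex^3 \<Rightarrow> complex) \<Rightarrow> bool" where
  "null h \<longleftrightarrow> continuous_on UNIV h \<and> average h = 0"

lemma null_add: "null h \<Longrightarrow> null h' \<Longrightarrow> null (\<lambda>x. h x + h' x)"
  by (simp add: null_def average_add continuous_on_add)

lemma null_cmult: "null h \<Longrightarrow> null (\<lambda>x. c * h x)"
  by (simp add: null_def average_cmult continuous_on_mult_left)

lemma null_diff: "null h \<Longrightarrow> null h' \<Longrightarrow> null (\<lambda>x. h x - h' x)"
  using null_add[of h "\<lambda>x. - 1 * h' x"] null_cmult[of h' "- 1"] by simp

text \<open>Vector fields of this form preserve the volume; they include the invariant ones.\<close>

lemma null_derivative:
  assumes f: "Ck_on (Suc 0) UNIV f" "invariant f"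
    and \<kappa>: "continuous_on UNIV (\<lambda>p. \<kappa> (fst p) (snd p))"
  shows "null (\<lambda>x. frechet_derivative f (at x) (vec3 c d (\<kappa> (x$1) (x$2))))"
proof -
  let ?D = "\<lambda>v x. frechet_derivative f (at x) v"
  let ?k = "\<lambda>x. \<kappa> (x$1) (x$2)"
  have lin: "linear (frechet_derivative f (at x))" for x
    using C1_D(1)[OF f(1)] by (rule has_derivative_linear)
  have cont: "continuous_on UNIV (?D v)" for v
    by (rule C1_D(2)[OF f(1)])
  have k: "continuous_on UNIV ?k"
    using continuous_on_compose2[OF \<kappa>, of UNIV "\<lambda>x. (x$1, x$2)"] by (simp add: continuous_intros)
  have split: "?D (vec3 c d (?k x)) x =
      Re c * ?D (vec3 1 0 0) x + (Im c * ?D (vec3 \<i> 0 0) x + (Re d * ?D (vec3 0 1 0) x + (Im d * ?D (vec3 0 \<i> 0) x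
      + (Re (?k x) * ?D (vec3 0 0 1) x + Im (?k x) * ?D (vec3 0 0 \<i>) x))))" for x
  proof -
    have "vec3 c d (?k x) = Re c *\<^sub>R vec3 1 0 0 + (Im c *\<^sub>R vec3 \<i> 0 0 + (Re d *\<^sub>R vec3 0 1 0 + (Im d *\<^sub>R vec3 0 \<i> 0
      + (Re (?k x) *\<^sub>R vec3 0 0 1 + Im (?k x) *\<^sub>R vec3 0 0 \<i>))))"
      by (simp add: vec3_arith scaleR_Re_Im)
    then show ?thesis
      by (simp add: linear_add[OF lin] linear_scale[OF lin] scaleR_conv_of_real[where 'a = complex])
  qed
  have "(1, 0) \<in> (Basis :: (complex \<times> complex) set)" "(\<i>, 0) \<in> (Basis :: (complex \<times> complex) set)"
    "(0, 1) \<in> (Basis :: (complex \<times> complex) set)" "(0, \<i>) \<in> (Basis :: (complex \<times> complex) set)"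
    by (auto simp: Basis_prod_def Basis_complex_def)
  from this[THEN average_basis_derivative[OF f]]
  have base: "average (?D (vec3 1 0 0)) = 0" "average (?D (vec3 \<i> 0 0)) = 0"
    "average (?D (vec3 0 1 0)) = 0" "average (?D (vec3 0 \<i> 0)) = 0"
    by simp_all
  \<comment> \<open>The coefficient depends on the base point alone, so it leaves the fibre
    integral, which is zero.\<close>
  have fibre: "average (\<lambda>x. Re (?k x) * ?D (vec3 0 0 1) x) = 0" "average (\<lambda>x. Im (?k x) * ?D (vec3 0 0 \<i>) x) = 0"
    unfolding average_def by (simp_all add: fibre_integral_derivative[OF f])
  have "null (\<lambda>x. of_real (Re (?k x)) * ?D (vec3 0 0 1) x)" "null (\<lambda>x. of_real (Im (?k x)) * ?D (vec3 0 0 \<i>) x)"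
    using fibre cont k by (auto simp: null_def intro!: continuous_intros)
  moreover have "null (?D (vec3 1 0 0))" "null (?D (vec3 \<i> 0 0))" "null (?D (vec3 0 1 0))" "null (?D (vec3 0 \<i> 0))"
    using base cont by (simp_all add: null_def)
  ultimately show ?thesis
    unfolding split by (intro null_add null_cmult)
qed


section \<open>Lifting metrics and forms from the central fibre\<close>

lemma Phi_0 [simp]: "Phi 0 = (\<lambda>x. x)"
  by (auto simp: Phi_def)

lemma hol_act_0: "hol_act l 0 = act l"
  by (simp add: fun_eq_iff hol_act_def act_def algebra_simps)

lemma hol_act_deriv_0: "hol_act_deriv 0 = id"
  by (auto simp: fun_eq_iff hol_act_deriv_def)

lemma nil_transition_at:
  assumes c: "c \<in> nil_atlas 0" "is_sheet c proj (\<lambda>x. x) W"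
    and c': "c' \<in> nil_atlas 0" "is_sheet c' proj (\<lambda>x. x) W'"
    and w: "w \<in> W" "act l w \<in> W'" and l: "l \<in> lat"
  shows "w \<in> snd c ` (fst c \<inter> fst c')" "transition c c' w = act l w"
    "frechet_derivative (transition c c') (at w) = hol_act_deriv l"
proof -
  show w': "w \<in> snd c ` (fst c \<inter> fst c')"
    unfolding image_Int_eq_local_dom local_dom_sheet[OF c(2) c'(2)]
    using w l by (auto intro!: bexI[of _ "act l w"])
  show tr: "transition c c' w = act l w"
    unfolding transition_eq_local_map
    by (rule local_map_sheet[OF c(2) c'(2) _ w]) (use l in auto)
  obtain l' where l': "transition c c' w = hol_act l' 0 w"
    "frechet_derivative (transition c c') (at w) = hol_act_deriv l'"
    using nil_transition_deriv[OF _ c(1) c'(1) w'] by auto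
  \<comment> \<open>\<open>nil_transition_deriv\<close> yields some lattice element; the action is
    free, so it must be the given one.\<close>
  then have "act l' w = act l w"
    using tr by (simp add: hol_act_0)
  then have "l' = l"
    by (metis displacement_act)
  then show "frechet_derivative (transition c c') (at w) = hol_act_deriv l"
    using l'(2) by simp
qed

text \<open>A tensor field on the central fibre lifts to an invariant tensor field on its universal
  cover; \<open>R\<close> is the pull-back of tensors along a linear map.\<close>

lemma lift_to_cover:
  fixes h :: "(complex^3, complex^3) chart \<Rightarrow> complex^3 \<Rightarrow> 'b"
  assumes law: "\<And>c c' x. c \<in> nil_atlas 0 \<Longrightarrow> c' \<in> nil_atlas 0 \<Longrightarrow> x \<in> snd c ` (fst c \<inter> fst c') \<Longrightarrow>
      h c x = R (frechet_derivative (transition c c') (at x)) (h c' (transition c c' x))"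
    and id: "\<And>t. R id t = t"
  obtains H where "\<And>x. \<exists>c N. c \<in> nil_atlas 0 \<and> open N \<and> x \<in> N \<and> N \<subseteq> snd c ` fst c \<and> (\<forall>y\<in>N. H y = h c y)"
    "\<And>l x. l \<in> lat \<Longrightarrow> H x = R (hol_act_deriv l) (H (act l x))"
proof -
  obtain W where W: "\<And>x. open (W x)" "\<And>x. x \<in> W x" "\<And>x. inj_on proj (W x)"
    using proj_locally_injective by metis
  define c where "c x = sheet_chart proj (Phi 0) (W x)" for x
  have c: "c x \<in> nil_atlas 0" "is_sheet (c x) proj (\<lambda>x. x) (W x)" for x
    using W is_sheet_sheet_chart[OF W(3), of "Phi 0" x] by (auto simp: c_def nil_atlas_def)
  have eq: "h (c x) w = R (hol_act_deriv l) (h (c y) (act l w))"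
    if "w \<in> W x" "act l w \<in> W y" "l \<in> lat" for x y w l
    using law[OF c(1) c(1)] nil_transition_at[OF c c that] by simp
  \<comment> \<open>Every point is read in the chart chosen for it. By \<open>eq\<close> with
    lattice element 0, any other chosen sheet through the point gives the same value, so near each
    point a single chart suffices.\<close>
  show ?thesis
  proof (rule that[of "\<lambda>x. h (c x) x"])
    show "\<exists>c' N. c' \<in> nil_atlas 0 \<and> open N \<and> x \<in> N \<and> N \<subseteq> snd c' ` fst c' \<and> (\<forall>y\<in>N. h (c y) y = h c' y)" for x
    proof (intro exI[of _ "c x"] exI[of _ "W x"] conjI ballI)
      show "W x \<subseteq> snd (c x) ` fst (c x)"
        unfolding is_sheet_image[OF c(2)] by simp
      have "0 \<in> lat" by (simp add: lat_def gauss_ints_closed)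
      then show "h (c y) y = h (c x) y" if "y \<in> W x" for y
        using eq[of y y 0 x] that W by (simp add: hol_act_deriv_0 id)
    qed (use W c in auto)
    show "h (c x) x = R (hol_act_deriv l) (h (c (act l x)) (act l x))" if "l \<in> lat" for l x
      using eq[OF W(2) W(2) that] .
  qed
qed

lemma del_cong:
  assumes "open N" "x \<in> N" "\<And>y. y \<in> N \<Longrightarrow> \<omega> y = \<eta> y"
  shows "del k \<omega> x v = del k \<eta> x v"
  unfolding del_def
  by (intro sum.cong refl arg_cong2[of _ _ _ _ "(*)"] arg_cong2[of _ _ _ _ part10]
      frechet_derivative_cong_open[OF assms(1,2)]) (simp add: assms(3))

lemma delbar_cong:
  assumes "open N" "x \<in> N" "\<And>y. y \<in> N \<Longrightarrow> \<omega> y = \<eta> y"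
  shows "delbar k \<omega> x v = delbar k \<eta> x v"
  unfolding delbar_def
  by (intro sum.cong refl arg_cong2[of _ _ _ _ "(*)"] arg_cong2[of _ _ _ _ part01]
      frechet_derivative_cong_open[OF assms(1,2)]) (simp add: assms(3))

definition invariant_metric :: "(complex^3 \<Rightarrow> complex^3 \<Rightarrow> complex^3 \<Rightarrow> real) \<Rightarrow> bool" where
  "invariant_metric K \<longleftrightarrow>
     (\<forall>x. (\<forall>u. linear (K x u)) \<and> (\<forall>u w. K x u w = K x w u) \<and> (\<forall>u. u \<noteq> 0 \<longrightarrow> K x u u > 0) \<and>
        (\<forall>u w. K x (\<i> *s u) (\<i> *s w) = K x u w)) \<and>
     (\<forall>u w. Ck_on (Suc 0) UNIV (\<lambda>x. K x u w)) \<and>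
     (\<forall>l\<in>lat. \<forall>x u w. K x u w = K (act l x) (hol_act_deriv l u) (hol_act_deriv l w))"

definition invariant_form4 :: "(complex^3 \<Rightarrow> 3 covector) \<Rightarrow> bool" where
  "invariant_form4 G \<longleftrightarrow>
     (\<forall>x. alternating_covector 4 (G x)) \<and> (\<forall>v. Ck_on (Suc 0) UNIV (\<lambda>x. G x v)) \<and>
     (\<forall>l\<in>lat. \<forall>x v. G x v = G (act l x) (\<lambda>i. hol_act_deriv l (v i)))"

text \<open>Metric and four-form are lifted as one pair, so that a single chart represents both near
  a given point and equations known chart by chart carry over to the covering.\<close>

lemma metric_form_cover:
  assumes herm: "hermitian_metric (nil_atlas 0) g" and \<gamma>: "smooth_form (nil_atlas 0) 4 \<gamma>"
  obtains K G where "invariant_metric K" "invariant_form4 G"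
    "\<And>x. \<exists>c N. c \<in> nil_atlas 0 \<and> open N \<and> x \<in> N \<and> N \<subseteq> snd c ` fst c \<and>
      (\<forall>y\<in>N. pf (\<lambda>u w. of_real (K y (\<i> *s u) w)) = fundamental_power g c y \<and> G y = \<gamma> c y)"
proof -
  define R where "R D t = ((\<lambda>u w. fst t (D u) (D w)), (\<lambda>v. snd t (\<lambda>i. D (v i))))"
    for D :: "complex^3 \<Rightarrow> complex^3" and t :: "(complex^3 \<Rightarrow> complex^3 \<Rightarrow> real) \<times> 3 covector"
  obtain H where H: "\<And>x. \<exists>c N. c \<in> nil_atlas 0 \<and> open N \<and> x \<in> N \<and> N \<subseteq> snd c ` fst c \<and>
      (\<forall>y\<in>N. H y = (g c y, \<gamma> c y))"
    and inv: "\<And>l x. l \<in> lat \<Longrightarrow> H x = R (hol_act_deriv l) (H (act l x))"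
  proof (rule lift_to_cover[of "\<lambda>c x. (g c x, \<gamma> c x)" R])
    show "(g c x, \<gamma> c x) = R (frechet_derivative (transition c c') (at x)) (g c' (transition c c' x), \<gamma> c' (transition c c' x))"
      if "c \<in> nil_atlas 0" "c' \<in> nil_atlas 0" "x \<in> snd c ` (fst c \<inter> fst c')" for c c' x
    proof -
      have "g c x u w = g c' (transition c c' x) (frechet_derivative (transition c c') (at x) u)
          (frechet_derivative (transition c c') (at x) w)" for u w
        using herm[unfolded hermitian_metric_def, THEN conjunct2, rule_format, OF that] .
      moreover have "\<gamma> c x v = \<gamma> c' (transition c c' x) (\<lambda>i. frechet_derivative (transition c c') (at x) (v i))" for v
        using \<gamma>[unfolded smooth_form_def, THEN conjunct2, rule_format, OF that] .
      ultimately show ?thesis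
        unfolding R_def by (simp add: fun_eq_iff)
    qed
  qed (auto simp: R_def intro: that)
  define K where "K x = fst (H x)" for x
  define G where "G x = snd (H x)" for x
  have loc: "\<exists>c N. c \<in> nil_atlas 0 \<and> open N \<and> x \<in> N \<and> N \<subseteq> snd c ` fst c \<and>
      (\<forall>y\<in>N. K y = g c y \<and> G y = \<gamma> c y)" for x
    using H[of x] unfolding K_def G_def by (metis fst_conv snd_conv)
  show ?thesis
  proof (rule that[of K G])
    show "invariant_metric K"
      unfolding invariant_metric_def
    proof (intro conjI allI ballI impI)
      fix x u w
      obtain c where "c \<in> nil_atlas 0" "x \<in> snd c ` fst c" "K x = g c x"
        using loc[of x] by blast
      then show "linear (K x u)" "K x u w = K x w u" "u \<noteq> 0 \<Longrightarrow> K x u u > 0"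
        "K x (\<i> *s u) (\<i> *s w) = K x u w"
        using herm unfolding hermitian_metric_def by auto
    next
      fix u w
      show "Ck_on (Suc 0) UNIV (\<lambda>x. K x u w)"
      proof (rule Ck_on_local)
        fix x
        obtain c N where c: "c \<in> nil_atlas 0" "open N" "x \<in> N" "N \<subseteq> snd c ` fst c" "\<forall>y\<in>N. K y = g c y"
          using loc[of x] by blast
        then have "Ck_on (Suc 0) (snd c ` fst c) (\<lambda>x. g c x u w)"
          using herm unfolding hermitian_metric_def smooth_on_def by blast
        then have "Ck_on (Suc 0) N (\<lambda>x. g c x u w)"
          using c(4) by (rule Ck_on_subset)
        then have "Ck_on (Suc 0) N (\<lambda>x. K x u w)"
          by (rule Ck_on_cong[OF c(2), rotated]) (simp add: c(5))
        then show "\<exists>N. open N \<and> x \<in> N \<and> Ck_on (Suc 0) N (\<lambda>x. K x u w)"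
          using c by blast
      qed
    next
      fix l x u w assume "l \<in> lat"
      from inv[OF this, of x] show "K x u w = K (act l x) (hol_act_deriv l u) (hol_act_deriv l w)"
        by (simp add: K_def R_def)
    qed
    show "invariant_form4 G"
      unfolding invariant_form4_def
    proof (intro conjI allI ballI impI)
      fix x
      obtain c where "c \<in> nil_atlas 0" "x \<in> snd c ` fst c" "G x = \<gamma> c x"
        using loc[of x] by blast
      then show "alternating_covector 4 (G x)"
        using \<gamma> unfolding smooth_form_def by auto
    next
      fix v
      show "Ck_on (Suc 0) UNIV (\<lambda>x. G x v)"
      proof (rule Ck_on_local)
        fix x
        obtain c N where c: "c \<in> nil_atlas 0" "open N" "x \<in> N" "N \<subseteq> snd c ` fst c" "\<forall>y\<in>N. G y = \<gamma> c y"
          using loc[of x] by blast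
        then have "Ck_on (Suc 0) (snd c ` fst c) (\<lambda>x. \<gamma> c x v)"
          using \<gamma> unfolding smooth_form_def smooth_on_def by blast
        then have "Ck_on (Suc 0) N (\<lambda>x. \<gamma> c x v)"
          using c(4) by (rule Ck_on_subset)
        then have "Ck_on (Suc 0) N (\<lambda>x. G x v)"
          by (rule Ck_on_cong[OF c(2), rotated]) (simp add: c(5))
        then show "\<exists>N. open N \<and> x \<in> N \<and> Ck_on (Suc 0) N (\<lambda>x. G x v)"
          using c by blast
      qed
    next
      fix l x v assume "l \<in> lat"
      from inv[OF this, of x] show "G x v = G (act l x) (\<lambda>i. hol_act_deriv l (v i))"
        by (simp add: G_def R_def)
    qed
    fix x
    obtain c N where c: "c \<in> nil_atlas 0" "open N" "x \<in> N" "N \<subseteq> snd c ` fst c"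
      "\<forall>y\<in>N. K y = g c y \<and> G y = \<gamma> c y"
      using loc[of x] by blast
    have "pf (\<lambda>u w. of_real (K y (\<i> *s u) w)) = fundamental_power g c y" if "y \<in> N" for y
    proof -
      have y: "y \<in> snd c ` fst c" "K y = g c y"
        using that c(4,5) by auto
      show ?thesis
        unfolding y(2) by (rule fundamental_power_pf[symmetric]) (rule hermitian_metric_anti[OF herm c(1) y(1)])
    qed
    then show "\<exists>c N. c \<in> nil_atlas 0 \<and> open N \<and> x \<in> N \<and> N \<subseteq> snd c ` fst c \<and>
        (\<forall>y\<in>N. pf (\<lambda>u w. of_real (K y (\<i> *s u) w)) = fundamental_power g c y \<and> G y = \<gamma> c y)"
      using c by blast
  qed
qed

lemma strongly_gauduchon_cover:
  assumes "strongly_gauduchon_metric (nil_atlas 0) g"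
  obtains K G where "invariant_metric K" "invariant_form4 G"
    "\<And>x v. del 4 (\<lambda>y. pf (\<lambda>u w. of_real (K y (\<i> *s u) w))) x v = delbar 4 G x v"
proof -
  have herm: "hermitian_metric (nil_atlas 0) g"
    using assms by (simp add: strongly_gauduchon_metric_def)
  obtain \<gamma> where \<gamma>: "smooth_form (nil_atlas 0) 4 \<gamma>"
    "form_eq (nil_atlas 0) (\<lambda>c. del 4 (fundamental_power g c)) (\<lambda>c. delbar 4 (\<gamma> c))"
    using assms by (auto simp: strongly_gauduchon_metric_def delbar_exact_def)
  obtain K G where KG: "invariant_metric K" "invariant_form4 G"
    and loc: "\<And>x. \<exists>c N. c \<in> nil_atlas 0 \<and> open N \<and> x \<in> N \<and> N \<subseteq> snd c ` fst c \<and>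
      (\<forall>y\<in>N. pf (\<lambda>u w. of_real (K y (\<i> *s u) w)) = fundamental_power g c y \<and> G y = \<gamma> c y)"
    by (rule metric_form_cover[OF herm \<gamma>(1)]) (rule that)
  show ?thesis
  proof (rule that[OF KG])
    fix x v
    obtain c N where c: "c \<in> nil_atlas 0" "open N" "x \<in> N" "N \<subseteq> snd c ` fst c"
      "\<forall>y\<in>N. pf (\<lambda>u w. of_real (K y (\<i> *s u) w)) = fundamental_power g c y \<and> G y = \<gamma> c y"
      using loc[of x] by blast
    have "del 4 (\<lambda>y. pf (\<lambda>u w. of_real (K y (\<i> *s u) w))) x v = del 4 (fundamental_power g c) x v"
      by (rule del_cong[OF c(2,3)]) (simp add: c(5))
    also have "\<dots> = delbar 4 (\<gamma> c) x v"
      using \<gamma>(2) c unfolding form_eq_def by blast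
    also have "\<dots> = delbar 4 G x v"
      by (rule delbar_cong[OF c(2,3)]) (simp add: c(5))
    finally show "del 4 (\<lambda>y. pf (\<lambda>u w. of_real (K y (\<i> *s u) w))) x v = delbar 4 G x v" .
  qed
qed

lemma balanced_cover:
  assumes "balanced_metric (nil_atlas 0) g"
  obtains K where "invariant_metric K"
    "\<And>x v. del 4 (\<lambda>y. pf (\<lambda>u w. of_real (K y (\<i> *s u) w))) x v =
      - delbar 4 (\<lambda>y. pf (\<lambda>u w. of_real (K y (\<i> *s u) w))) x v"
proof -
  have herm: "hermitian_metric (nil_atlas 0) g"
    and closed: "form_eq (nil_atlas 0) (\<lambda>c. ext_d 4 (fundamental_power g c)) (\<lambda>c x v. 0)"
    using assms by (simp_all add: balanced_metric_def)
  obtain K G where K: "invariant_metric K" and "invariant_form4 G"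
    and loc: "\<And>x. \<exists>c N. c \<in> nil_atlas 0 \<and> open N \<and> x \<in> N \<and> N \<subseteq> snd c ` fst c \<and>
      (\<forall>y\<in>N. pf (\<lambda>u w. of_real (K y (\<i> *s u) w)) = fundamental_power g c y \<and> G y = (\<lambda>v. 0))"
    by (rule metric_form_cover[OF herm smooth_form_0]) (rule that)
  show ?thesis
  proof (rule that[OF K])
    fix x v
    let ?\<beta> = "\<lambda>y. pf (\<lambda>u w. of_real (K y (\<i> *s u) w))"
    obtain c N where c: "c \<in> nil_atlas 0" "open N" "x \<in> N" "N \<subseteq> snd c ` fst c"
      "\<forall>y\<in>N. ?\<beta> y = fundamental_power g c y \<and> G y = (\<lambda>v. 0)"
      using loc[of x] by blast
    have "del 4 ?\<beta> x v = del 4 (fundamental_power g c) x v"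
      by (rule del_cong[OF c(2,3)]) (simp add: c(5))
    moreover have "delbar 4 ?\<beta> x v = delbar 4 (fundamental_power g c) x v"
      by (rule delbar_cong[OF c(2,3)]) (simp add: c(5))
    moreover have "ext_d 4 (fundamental_power g c) x v = 0"
      using closed c unfolding form_eq_def by blast
    ultimately show "del 4 ?\<beta> x v = - delbar 4 ?\<beta> x v"
      by (simp add: ext_d_eq eq_neg_iff_add_eq_0)
  qed
qed


section \<open>Tensors evaluated on vectors that vary with the point\<close>

lemma linear_sum_Basis:
  fixes L :: "'v::euclidean_space \<Rightarrow> 'b::real_vector"
  assumes "linear L"
  shows "L u = (\<Sum>b\<in>Basis. (u \<bullet> b) *\<^sub>R L b)"
  by (subst euclidean_representation[of u, symmetric])
    (simp only: linear_sum[OF assms] linear_scale[OF assms])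

text \<open>Expanding the argument in a fixed basis reduces this to the product rule;
  \<open>H' u\<close> depends linearly on \<open>u\<close> because derivatives are unique.\<close>

lemma has_derivative_slot:
  fixes H :: "'a::real_normed_vector \<Rightarrow> 'v::euclidean_space \<Rightarrow> 'b::real_normed_vector"
  assumes lin: "\<And>x. linear (H x)" and H: "\<And>u. ((\<lambda>x. H x u) has_derivative H' u) (at x0)"
    and w: "(w has_derivative w') (at x0)"
  shows "((\<lambda>x. H x (w x)) has_derivative (\<lambda>h. H' (w x0) h + H x0 (w' h))) (at x0)"
proof -
  have H': "H' u = (\<lambda>h. \<Sum>b\<in>Basis. (u \<bullet> b) *\<^sub>R H' b h)" for u
  proof (rule has_derivative_unique[OF H])
    have "((\<lambda>x. \<Sum>b\<in>Basis. (u \<bullet> b) *\<^sub>R H x b) has_derivative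
        (\<lambda>h. \<Sum>b\<in>Basis. (u \<bullet> b) *\<^sub>R H' b h)) (at x0)"
      by (intro has_derivative_sum has_derivative_scaleR_right H)
    then show "((\<lambda>x. H x u) has_derivative (\<lambda>h. \<Sum>b\<in>Basis. (u \<bullet> b) *\<^sub>R H' b h)) (at x0)"
      by (simp only: linear_sum_Basis[OF lin, symmetric])
  qed
  have "((\<lambda>x. \<Sum>b\<in>Basis. (w x \<bullet> b) *\<^sub>R H x b) has_derivative
      (\<lambda>h. \<Sum>b\<in>Basis. (w x0 \<bullet> b) *\<^sub>R H' b h + (w' h \<bullet> b) *\<^sub>R H x0 b)) (at x0)"
    by (intro has_derivative_sum has_derivative_scaleR has_derivative_inner_left w H)
  then show ?thesis
    by (simp only: linear_sum_Basis[OF lin, symmetric] sum.distrib H'[of "w x0", symmetric]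
        fun_cong[OF H'[of "w x0"], symmetric])
qed

lemma Ck_on_slot:
  fixes H :: "'a::euclidean_space \<Rightarrow> 'v::euclidean_space \<Rightarrow> 'b::real_normed_vector"
  assumes "open S" and lin: "\<And>x. linear (H x)" and H: "\<And>u. Ck_on k S (\<lambda>x. H x u)"
    and w: "Ck_on k S w"
  shows "Ck_on k S (\<lambda>x. H x (w x))"
proof -
  have "Ck_on k S (\<lambda>x. \<Sum>b\<in>B. (w x \<bullet> b) *\<^sub>R H x b)" if "finite B" for B
    using that
    by (induction B)
      (simp_all add: Ck_on_const Ck_on_add[OF assms(1)] H w
        Ck_on_bounded_bilinear[OF assms(1) bounded_bilinear_scaleR]
        Ck_on_bounded_linear[OF assms(1) bounded_linear_inner_left])
  from this[OF finite_Basis] show ?thesis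
    by (simp only: linear_sum_Basis[OF lin, symmetric])
qed


section \<open>Invariant tensors of degree four\<close>

text \<open>An invariant four-form with separate arguments, so that vector fields can be inserted
  slot by slot. Linearity is demanded in the first slot and passes to the others by
  antisymmetry.\<close>

definition tensor4 :: "(complex^3 \<Rightarrow> complex^3 \<Rightarrow> complex^3 \<Rightarrow> complex^3 \<Rightarrow> complex^3 \<Rightarrow> complex) \<Rightarrow> bool" where
  "tensor4 F \<longleftrightarrow>
     (\<forall>x b c d. linear (\<lambda>a. F x a b c d)) \<and>
     (\<forall>x a b c d. F x b a c d = - F x a b c d \<and> F x a c b d = - F x a b c d \<and> F x a b d c = - F x a b c d) \<and>
     (\<forall>a b c d. Ck_on (Suc 0) UNIV (\<lambda>x. F x a b c d)) \<and>
     (\<forall>l\<in>lat. \<forall>x a b c d. F x a b c d =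
        F (act l x) (hol_act_deriv l a) (hol_act_deriv l b) (hol_act_deriv l c) (hol_act_deriv l d))"

lemma tensor4_anti:
  assumes "tensor4 F"
  shows "F x b a c d = - F x a b c d" "F x a c b d = - F x a b c d" "F x a b d c = - F x a b c d"
proof -
  have *: "F x b a c d = - F x a b c d \<and> F x a c b d = - F x a b c d \<and> F x a b d c = - F x a b c d" for a b c d
    by (rule assms[unfolded tensor4_def, THEN conjunct2, THEN conjunct1, THEN spec, THEN spec, THEN spec,
          THEN spec, THEN spec])
  show "F x b a c d = - F x a b c d" "F x a c b d = - F x a b c d" "F x a b d c = - F x a b c d"
    by (rule *[THEN conjunct1] *[THEN conjunct2, THEN conjunct1] *[THEN conjunct2, THEN conjunct2])+
qed

lemma tensor4_linear:
  assumes F: "tensor4 F"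
  shows "linear (\<lambda>a. F x a b c d)" "linear (\<lambda>a. F x b a c d)" "linear (\<lambda>a. F x b c a d)" "linear (\<lambda>a. F x b c d a)"
proof -
  show 1: "linear (\<lambda>a. F x a b c d)" for b c d
    by (rule F[unfolded tensor4_def, THEN conjunct1, THEN spec, THEN spec, THEN spec, THEN spec])
  have 2: "(\<lambda>a. F x b a c d) = (\<lambda>a. - F x a b c d)" for b c d
    by (rule ext) (rule tensor4_anti(1)[OF F])
  show L2: "linear (\<lambda>a. F x b a c d)" for b c d
    by (rule iffD2[OF arg_cong[OF 2, of linear] linear_compose_neg[OF 1]])
  have 3: "(\<lambda>a. F x b c a d) = (\<lambda>a. - F x b a c d)" for b c d
    by (rule ext) (rule tensor4_anti(2)[OF F])
  show L3: "linear (\<lambda>a. F x b c a d)" for b c d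
    by (rule iffD2[OF arg_cong[OF 3, of linear] linear_compose_neg[OF L2]])
  have 4: "(\<lambda>a. F x b c d a) = (\<lambda>a. - F x b c a d)"
    by (rule ext) (rule tensor4_anti(3)[OF F])
  show "linear (\<lambda>a. F x b c d a)"
    by (rule iffD2[OF arg_cong[OF 4, of linear] linear_compose_neg[OF L3]])
qed

lemma tensor4_C1:
  assumes "tensor4 F"
  shows "Ck_on (Suc 0) UNIV (\<lambda>x. F x a b c d)"
  by (rule assms[unfolded tensor4_def, THEN conjunct2, THEN conjunct2, THEN conjunct1,
        THEN spec, THEN spec, THEN spec, THEN spec])

lemma tensor4_derivative:
  assumes F: "tensor4 F"
    and a: "(a has_derivative a') (at x)" and b: "(b has_derivative b') (at x)"
    and c: "(c has_derivative c') (at x)" and d: "(d has_derivative d') (at x)"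
  shows "((\<lambda>y. F y (a y) (b y) (c y) (d y)) has_derivative (\<lambda>u.
    frechet_derivative (\<lambda>y. F y (a x) (b x) (c x) (d x)) (at x) u +
    F x (a' u) (b x) (c x) (d x) + F x (a x) (b' u) (c x) (d x) +
    F x (a x) (b x) (c' u) (d x) + F x (a x) (b x) (c x) (d' u))) (at x)"
proof -
  note lin = tensor4_linear[OF F]
  define D where "D a b c d = frechet_derivative (\<lambda>y. F y a b c d) (at x)" for a b c d
  have 0: "((\<lambda>y. F y a b c d) has_derivative D a b c d) (at x)" for a b c d
    unfolding D_def using tensor4_C1[OF F] by (rule C1_D)
  have 1: "((\<lambda>y. F y (a y) b c d) has_derivative (\<lambda>u. D (a x) b c d u + F x (a' u) b c d)) (at x)" for b c d
    by (rule has_derivative_slot[where H = "\<lambda>y a. F y a b c d", OF lin(1) 0 a])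
  have 2: "((\<lambda>y. F y (a y) (b y) c d) has_derivative
      (\<lambda>u. (D (a x) (b x) c d u + F x (a' u) (b x) c d) + F x (a x) (b' u) c d)) (at x)" for c d
    by (rule has_derivative_slot[where H = "\<lambda>y b. F y (a y) b c d", OF lin(2) 1 b])
  have 3: "((\<lambda>y. F y (a y) (b y) (c y) d) has_derivative
      (\<lambda>u. ((D (a x) (b x) (c x) d u + F x (a' u) (b x) (c x) d) + F x (a x) (b' u) (c x) d)
        + F x (a x) (b x) (c' u) d)) (at x)" for d
    by (rule has_derivative_slot[where H = "\<lambda>y c. F y (a y) (b y) c d", OF lin(3) 2 c])
  show ?thesis
    using has_derivative_slot[where H = "\<lambda>y d. F y (a y) (b y) (c y) d", OF lin(4) 3 d]
    by (simp only: D_def)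
qed

text \<open>Equivariant fields are those that descend to the quotient; inserted into invariant
  tensors they give invariant functions.\<close>

definition frame_field :: "(complex^3 \<Rightarrow> complex^3) \<Rightarrow> bool" where
  "frame_field a \<longleftrightarrow> Ck_on (Suc 0) UNIV a \<and> (\<forall>l\<in>lat. \<forall>x. hol_act_deriv l (a x) = a (act l x))"

lemma tensor4_frame:
  assumes F: "tensor4 F" and fr: "frame_field a" "frame_field b" "frame_field c" "frame_field d"
  shows "Ck_on (Suc 0) UNIV (\<lambda>x. F x (a x) (b x) (c x) (d x))"
    and "invariant (\<lambda>x. F x (a x) (b x) (c x) (d x))"
proof -
  note lin = tensor4_linear[OF F]
  have C: "Ck_on (Suc 0) UNIV a" "Ck_on (Suc 0) UNIV b" "Ck_on (Suc 0) UNIV c" "Ck_on (Suc 0) UNIV d"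
    using fr by (auto simp: frame_field_def)
  have 1: "Ck_on (Suc 0) UNIV (\<lambda>y. F y (a y) b c d)" for b c d
    by (rule Ck_on_slot[where H = "\<lambda>y a. F y a b c d", OF open_UNIV lin(1) tensor4_C1[OF F] C(1)])
  have 2: "Ck_on (Suc 0) UNIV (\<lambda>y. F y (a y) (b y) c d)" for c d
    by (rule Ck_on_slot[where H = "\<lambda>y b. F y (a y) b c d", OF open_UNIV lin(2) 1 C(2)])
  have 3: "Ck_on (Suc 0) UNIV (\<lambda>y. F y (a y) (b y) (c y) d)" for d
    by (rule Ck_on_slot[where H = "\<lambda>y c. F y (a y) (b y) c d", OF open_UNIV lin(3) 2 C(3)])
  show "Ck_on (Suc 0) UNIV (\<lambda>x. F x (a x) (b x) (c x) (d x))"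
    by (rule Ck_on_slot[where H = "\<lambda>y d. F y (a y) (b y) (c y) d", OF open_UNIV lin(4) 3 C(4)])
  show "invariant (\<lambda>x. F x (a x) (b x) (c x) (d x))"
    unfolding invariant_def
  proof (intro ballI allI)
    fix l x assume l: "l \<in> lat"
    have inv: "a (act l x) = hol_act_deriv l (a x)" "b (act l x) = hol_act_deriv l (b x)"
      "c (act l x) = hol_act_deriv l (c x)" "d (act l x) = hol_act_deriv l (d x)"
      using fr l by (simp_all add: frame_field_def)
    have "F x p q r s = F (act l x) (hol_act_deriv l p) (hol_act_deriv l q) (hol_act_deriv l r) (hol_act_deriv l s)"
      for p q r s
      using F[unfolded tensor4_def, THEN conjunct2, THEN conjunct2, THEN conjunct2, rule_format, OF l] .
    then show "F (act l x) (a (act l x)) (b (act l x)) (c (act l x)) (d (act l x)) = F x (a x) (b x) (c x) (d x)"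
      unfolding inv by simp
  qed
qed

text \<open>The frame dual to the invariant forms \<open>dv\<close>, \<open>dz\<close> and \<open>eps 0\<close> is \<open>fr1\<close>, \<open>fr2\<close>, \<open>E3\<close>.\<close>

definition E3 :: "complex^3" where "E3 = vec3 0 0 1"

definition IE3 :: "complex^3" where "IE3 = vec3 0 0 \<i>"

definition fr1 :: "complex^3 \<Rightarrow> complex^3" where
  "fr1 x = vec3 1 0 (- (cnj (x$1) + 2 * cnj (x$2)))"

definition fr2 :: "complex^3 \<Rightarrow> complex^3" where
  "fr2 x = vec3 0 1 (- cnj (x$2))"

abbreviation "ifr1 \<equiv> \<lambda>x. \<i> *s fr1 x"
abbreviation "ifr2 \<equiv> \<lambda>x. \<i> *s fr2 x"

definition dfr1 :: "complex^3 \<Rightarrow> complex^3" where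
  "dfr1 u = vec3 0 0 (- (cnj (u$1) + 2 * cnj (u$2)))"

definition dfr2 :: "complex^3 \<Rightarrow> complex^3" where
  "dfr2 u = vec3 0 0 (- cnj (u$2))"

lemma frame_fields:
  "frame_field fr1" "frame_field fr2" "frame_field ifr1" "frame_field ifr2"
  "frame_field (\<lambda>x. E3)" "frame_field (\<lambda>x. IE3)"
proof -
  have C: "Ck_on (Suc 0) UNIV a" if "smooth_on UNIV a" for a :: "complex^3 \<Rightarrow> complex^3"
    using that by (simp only: smooth_on_def)
  show "frame_field fr1" "frame_field fr2" "frame_field ifr1" "frame_field ifr2"
    "frame_field (\<lambda>x. E3)" "frame_field (\<lambda>x. IE3)"
    unfolding frame_field_def fr1_def fr2_def E3_def IE3_def vec3_arith
    by (intro conjI ballI allI C smooth_on_vec3 smooth_on_intros open_UNIV;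
        auto simp: hol_act_deriv_def act_def algebra_simps intro!: vec3_eqI)+
qed

lemma frame_derivatives:
  "(fr1 has_derivative dfr1) (at x)" "(fr2 has_derivative dfr2) (at x)"
  "(ifr1 has_derivative (\<lambda>u. \<i> *s dfr1 u)) (at x)" "(ifr2 has_derivative (\<lambda>u. \<i> *s dfr2 u)) (at x)"
proof -
  note [derivative_intros] = bounded_linear_imp_has_derivative[OF bounded_linear_vec_nth]
  show "(fr1 has_derivative dfr1) (at x)" "(fr2 has_derivative dfr2) (at x)"
    "(ifr1 has_derivative (\<lambda>u. \<i> *s dfr1 u)) (at x)" "(ifr2 has_derivative (\<lambda>u. \<i> *s dfr2 u)) (at x)"
    unfolding fr1_def fr2_def dfr1_def dfr2_def vec3_arith
    by (auto intro!: derivative_eq_intros simp: algebra_simps)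
qed


section \<open>Integration by parts in the invariant frame, for \<open>del\<close> and
  \<open>delbar\<close> at once\<close>

definition part_type :: "complex \<Rightarrow> (complex^'n \<Rightarrow> complex) \<Rightarrow> complex^'n \<Rightarrow> complex" where
  "part_type \<sigma> L u = (L u + \<sigma> * L (\<i> *s u)) / 2"

lemma part_type_eq: "part10 = part_type (- \<i>)" "part01 = part_type \<i>"
  by (simp_all add: fun_eq_iff part10_def part01_def part_type_def)

text \<open>The derivative with the arguments held constant, in contrast to \<open>frame_derivative\<close>, where
  they vary with the point.\<close>

definition frozen where
  "frozen F x a b c d = frechet_derivative (\<lambda>y. F y a b c d) (at x)"

text \<open>The value of \<open>\<partial>F\<close> (for \<open>\<sigma> = - \<i>\<close>) or \<open>\<partial>\<close>-bar \<open>F\<close> (for \<open>\<sigma> = \<i>\<close>) on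
  \<open>fr1, ifr1, fr2, ifr2, X\<close>. The combination of the values for \<open>X = E3\<close> and \<open>X = IE3\<close> used
  below is, up to a factor, the coefficient of the wedge product with the conjugate of
  \<open>eps 0\<close>.\<close>

definition slice where
  "slice \<sigma> F X x =
     part_type \<sigma> (frozen F x (ifr1 x) (fr2 x) (ifr2 x) X) (fr1 x)
   - part_type \<sigma> (frozen F x (fr1 x) (fr2 x) (ifr2 x) X) (ifr1 x)
   + part_type \<sigma> (frozen F x (fr1 x) (ifr1 x) (ifr2 x) X) (fr2 x)
   - part_type \<sigma> (frozen F x (fr1 x) (ifr1 x) (fr2 x) X) (ifr2 x)
   + part_type \<sigma> (frozen F x (fr1 x) (ifr1 x) (fr2 x) (ifr2 x)) X"

definition frame_derivative where
  "frame_derivative F a b c d u x = frechet_derivative (\<lambda>y. F y (a y) (b y) (c y) (d y)) (at x) (u x)"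

text \<open>This is \<open>slice\<close>, doubled to clear the denominators of
  \<open>part_type\<close>, with derivatives of the moving evaluations in place of frozen ones. The
  extra minus signs come from multiplying \<open>ifr1\<close> and \<open>ifr2\<close> by \<i>;
  \<open>u\<close> and \<open>v\<close> are meant to be \<open>X\<close> and \<i> times
  \<open>X\<close>.\<close>

definition slice_total where
  "slice_total \<sigma> F X u v x =
     (frame_derivative F ifr1 fr2 ifr2 X fr1 x + \<sigma> * frame_derivative F ifr1 fr2 ifr2 X ifr1 x)
   - (frame_derivative F fr1 fr2 ifr2 X ifr1 x - \<sigma> * frame_derivative F fr1 fr2 ifr2 X fr1 x)
   + (frame_derivative F fr1 ifr1 ifr2 X fr2 x + \<sigma> * frame_derivative F fr1 ifr1 ifr2 X ifr2 x)
   - (frame_derivative F fr1 ifr1 fr2 X ifr2 x - \<sigma> * frame_derivative F fr1 ifr1 fr2 X fr2 x)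
   + (frame_derivative F fr1 ifr1 fr2 ifr2 u x + \<sigma> * frame_derivative F fr1 ifr1 fr2 ifr2 v x)"

text \<open>These are the terms in which an argument is differentiated. The frame changes only in
  the fibre direction, hence the \<open>E3\<close> or \<open>IE3\<close> in every term, moved to the
  first slot.\<close>

definition slice_correction where
  "slice_correction \<sigma> F X x =
     - 2 * F x IE3 (fr2 x) (ifr2 x) X - 2 * \<sigma> * F x E3 (fr2 x) (ifr2 x) X
     - 2 * F x E3 (ifr1 x) (ifr2 x) X + 2 * F x IE3 (fr1 x) (ifr2 x) X - 2 * F x IE3 (fr1 x) (ifr1 x) X
     - 2 * F x IE3 (ifr1 x) (fr2 x) X - 2 * F x E3 (fr1 x) (fr2 x) X
     + \<sigma> * (2 * F x IE3 (ifr1 x) (ifr2 x) X + 2 * F x E3 (fr1 x) (ifr2 x) X - 2 * F x E3 (fr1 x) (ifr1 x) X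
       - 2 * F x E3 (ifr1 x) (fr2 x) X + 2 * F x IE3 (fr1 x) (fr2 x) X)"

lemma frame_directions:
  "dfr1 (fr1 x) = - E3" "dfr1 (ifr1 x) = IE3" "dfr1 (fr2 x) = - (2 *\<^sub>R E3)" "dfr1 (ifr2 x) = 2 *\<^sub>R IE3"
  "dfr2 (fr1 x) = 0" "dfr2 (ifr1 x) = 0" "dfr2 (fr2 x) = - E3" "dfr2 (ifr2 x) = IE3"
  "dfr1 E3 = 0" "dfr2 E3 = 0" "dfr1 IE3 = 0" "dfr2 IE3 = 0"
  by (rule vec3_eqI; simp add: dfr1_def dfr2_def fr1_def fr2_def E3_def IE3_def scaleR_conv_of_real)+

lemma i_smult:
  fixes v :: "complex^'n"
  shows "\<i> *s (\<i> *s v) = - v" "\<i> *s (- v) = - (\<i> *s v)" "\<i> *s (r *\<^sub>R v) = r *\<^sub>R (\<i> *s v)" "\<i> *s (0 :: complex^'n) = 0"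
  by (simp_all add: vec_eq_iff)

lemma i_E3: "\<i> *s E3 = IE3" "\<i> *s IE3 = - E3"
  by (rule vec3_eqI; simp add: E3_def IE3_def)+

lemma frame_derivative_eq:
  assumes F: "tensor4 F"
    and "(a has_derivative a') (at x)" "(b has_derivative b') (at x)"
      "(c has_derivative c') (at x)" "(d has_derivative d') (at x)"
  shows "frame_derivative F a b c d u x = frozen F x (a x) (b x) (c x) (d x) (u x) +
    F x (a' (u x)) (b x) (c x) (d x) + F x (a x) (b' (u x)) (c x) (d x) +
    F x (a x) (b x) (c' (u x)) (d x) + F x (a x) (b x) (c x) (d' (u x))"
  unfolding frame_derivative_def frozen_def
  using fun_cong[OF frechet_derivative_at[OF tensor4_derivative[OF assms]], of "u x"] by simp

lemma frozen_linear:
  assumes "tensor4 F"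
  shows "linear (frozen F x a b c d)"
  unfolding frozen_def
  by (rule has_derivative_linear[OF C1_D(1)[OF tensor4_C1[OF assms]]])

lemma slice_eq:
  assumes F: "tensor4 F" and X: "X = E3 \<or> X = IE3"
  shows "2 * slice \<sigma> F X x + slice_correction \<sigma> F X x = slice_total \<sigma> F (\<lambda>x. X) (\<lambda>x. X) (\<lambda>x. \<i> *s X) x"
proof -
  note lin = tensor4_linear[OF F, of x]
  note slots = lin[THEN linear_neg] lin[THEN linear_scale] lin[THEN linear_0]
  note fz = frozen_linear[OF F, THEN linear_neg]
  have swap: "F x a E b X = - F x E a b X" "F x a b E X = F x E a b X" for a b E
  proof -
    show s1: "F x a E b X = - F x E a b X" by (rule tensor4_anti(1)[OF F])
    have "F x a b E X = - F x a E b X" by (rule tensor4_anti(2)[OF F])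
    then show "F x a b E X = F x E a b X" unfolding s1 by simp
  qed
  note swaps = swap(1)[of _ E3] swap(1)[of _ IE3] swap(2)[of _ _ E3] swap(2)[of _ _ IE3]
  note fd = frame_derivatives[of x] has_derivative_const[of _ "at x"]
  have dX: "dfr1 X = 0" "dfr2 X = 0" "dfr1 (\<i> *s X) = 0" "dfr2 (\<i> *s X) = 0"
    using X by (auto simp: frame_directions i_E3 dfr1_def dfr2_def E3_def IE3_def intro!: vec3_eqI)
  have D1: "frame_derivative F ifr1 fr2 ifr2 (\<lambda>x. X) u x = frozen F x (ifr1 x) (fr2 x) (ifr2 x) X (u x) +
    F x (\<i> *s dfr1 (u x)) (fr2 x) (ifr2 x) X + F x (ifr1 x) (dfr2 (u x)) (ifr2 x) X +
    F x (ifr1 x) (fr2 x) (\<i> *s dfr2 (u x)) X" for u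
    using frame_derivative_eq[OF F fd(3,2,4,5)] by (simp add: slots)
  have D2: "frame_derivative F fr1 fr2 ifr2 (\<lambda>x. X) u x = frozen F x (fr1 x) (fr2 x) (ifr2 x) X (u x) +
    F x (dfr1 (u x)) (fr2 x) (ifr2 x) X + F x (fr1 x) (dfr2 (u x)) (ifr2 x) X +
    F x (fr1 x) (fr2 x) (\<i> *s dfr2 (u x)) X" for u
    using frame_derivative_eq[OF F fd(1,2,4,5)] by (simp add: slots)
  have D3: "frame_derivative F fr1 ifr1 ifr2 (\<lambda>x. X) u x = frozen F x (fr1 x) (ifr1 x) (ifr2 x) X (u x) +
    F x (dfr1 (u x)) (ifr1 x) (ifr2 x) X + F x (fr1 x) (\<i> *s dfr1 (u x)) (ifr2 x) X +
    F x (fr1 x) (ifr1 x) (\<i> *s dfr2 (u x)) X" for u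
    using frame_derivative_eq[OF F fd(1,3,4,5)] by (simp add: slots)
  have D4: "frame_derivative F fr1 ifr1 fr2 (\<lambda>x. X) u x = frozen F x (fr1 x) (ifr1 x) (fr2 x) X (u x) +
    F x (dfr1 (u x)) (ifr1 x) (fr2 x) X + F x (fr1 x) (\<i> *s dfr1 (u x)) (fr2 x) X +
    F x (fr1 x) (ifr1 x) (dfr2 (u x)) X" for u
    using frame_derivative_eq[OF F fd(1,3,2,5)] by (simp add: slots)
  \<comment> \<open>In the fibre directions the frame is constant, its coefficients being functions
    of the first two coordinates.\<close>
  have D5: "frame_derivative F fr1 ifr1 fr2 ifr2 u x = frozen F x (fr1 x) (ifr1 x) (fr2 x) (ifr2 x) (u x)"
    if "dfr1 (u x) = 0" "dfr2 (u x) = 0" for u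
    using frame_derivative_eq[OF F fd(1,3,2,4), of u] that by (simp add: slots i_smult)
  show ?thesis
    unfolding slice_total_def slice_def slice_correction_def part_type_def D1 D2 D3 D4
      D5[of "\<lambda>x. X", OF dX(1,2)] D5[of "\<lambda>x. \<i> *s X", OF dX(3,4)]
      frame_directions i_smult i_E3 slots fz swaps
    by (simp add: field_simps scaleR_conv_of_real)
qed

lemma null_frame_derivative:
  assumes F: "tensor4 F" and fr: "frame_field a" "frame_field b" "frame_field c" "frame_field d"
  shows "null (frame_derivative F a b c d fr1)" "null (frame_derivative F a b c d ifr1)"
    "null (frame_derivative F a b c d fr2)" "null (frame_derivative F a b c d ifr2)"
    "null (frame_derivative F a b c d (\<lambda>x. E3))" "null (frame_derivative F a b c d (\<lambda>x. IE3))"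
    "null (frame_derivative F a b c d (\<lambda>x. - E3))"
proof -
  note n = null_derivative[OF tensor4_frame[OF F fr]]
  show "null (frame_derivative F a b c d fr1)" "null (frame_derivative F a b c d ifr1)"
    "null (frame_derivative F a b c d fr2)" "null (frame_derivative F a b c d ifr2)"
    "null (frame_derivative F a b c d (\<lambda>x. E3))" "null (frame_derivative F a b c d (\<lambda>x. IE3))"
    using n[of "\<lambda>v z. - (cnj v + 2 * cnj z)" 1 0] n[of "\<lambda>v z. \<i> * (- (cnj v + 2 * cnj z))" \<i> 0]
      n[of "\<lambda>v z. - cnj z" 0 1] n[of "\<lambda>v z. \<i> * (- cnj z)" 0 \<i>] n[of "\<lambda>v z. 1" 0 0] n[of "\<lambda>v z. \<i>" 0 0]
    unfolding frame_derivative_def[abs_def] fr1_def fr2_def vec3_arith E3_def IE3_def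
    by (simp_all add: continuous_intros)
  \<comment> \<open>This direction arises as \<i> times \<open>IE3\<close>.\<close>
  have "- E3 = vec3 0 0 (- 1)"
    by (rule vec3_eqI) (simp_all add: E3_def)
  then show "null (frame_derivative F a b c d (\<lambda>x. - E3))"
    using n[of "\<lambda>v z. - 1" 0 0] unfolding frame_derivative_def[abs_def] by simp
qed

lemma null_slice_total:
  assumes F: "tensor4 F" and X: "X = E3 \<or> X = IE3"
  shows "null (slice_total \<sigma> F (\<lambda>x. X) (\<lambda>x. X) (\<lambda>x. \<i> *s X))"
proof -
  have "frame_field (\<lambda>x. X)"
    using X frame_fields by auto
  note fields = frame_fields this
  have "null (frame_derivative F fr1 ifr1 fr2 ifr2 (\<lambda>x. X))" "null (frame_derivative F fr1 ifr1 fr2 ifr2 (\<lambda>x. \<i> *s X))"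
    using X null_frame_derivative(5-7)[OF F fields(1,3,2,4)] by (auto simp: i_E3)
  then show ?thesis
    unfolding slice_total_def[abs_def]
    by (intro null_add null_diff null_cmult null_frame_derivative F fields)
qed

definition contracted where
  "contracted F x a b = F x E3 a b IE3"

text \<open>The part of the six-form that remains after the divergences of invariant vector fields are
  removed. It comes from the brackets of the frame fields and is the wedge product of \<open>F\<close> with
  the differential of the conjugate of \<open>eps 0\<close>.\<close>

definition bracket_correction where
  "bracket_correction F x =
     contracted F x (fr2 x) (ifr2 x) + contracted F x (fr1 x) (ifr1 x)
     - contracted F x (fr1 x) (ifr2 x) + contracted F x (ifr1 x) (fr2 x)
     + \<i> * (contracted F x (ifr1 x) (ifr2 x) + contracted F x (fr1 x) (fr2 x))"

text \<open>The factor \<open>1 + \<i> * \<sigma>\<close> separates the two operators: it is 2 for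
  \<open>del\<close> and 0 for \<open>delbar\<close>. The zero reflects that the conjugate of
  \<open>eps 0\<close> is \<open>delbar\<close>-closed.\<close>

lemma null_bracket:
  assumes F: "tensor4 F"
  shows "null (\<lambda>x. 2 * (slice \<sigma> F E3 x - \<i> * slice \<sigma> F IE3 x)
    + 2 * (1 + \<i> * \<sigma>) * bracket_correction F x)"
proof -
  \<comment> \<open>Repeated fibre vectors kill the terms with \<open>E3\<close> when
    \<open>X = E3\<close>, and those with \<open>IE3\<close> when \<open>X = IE3\<close>; by
    \<open>eq1\<close> all remaining terms are values of \<open>contracted\<close> up to
    sign.\<close>
  have eq0: "F x E a b E = 0" for x E a b
  proof -
    have 1: "F x E a b E = - F x a E b E" by (rule tensor4_anti(1)[OF F])
    have 2: "F x a E b E = - F x a b E E" by (rule tensor4_anti(2)[OF F])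
    have "F x a b E E = - F x a b E E" by (rule tensor4_anti(3)[OF F])
    then show ?thesis unfolding 1 2 by simp
  qed
  have eq1: "F x IE3 a b E3 = - contracted F x a b" for x a b
  proof -
    have 1: "F x IE3 a b E3 = - F x a IE3 b E3" by (rule tensor4_anti(1)[OF F])
    have 2: "F x a IE3 b E3 = - F x a b IE3 E3" by (rule tensor4_anti(2)[OF F])
    have 3: "F x a b IE3 E3 = - F x a b E3 IE3" by (rule tensor4_anti(3)[OF F])
    have 4: "F x a b E3 IE3 = - F x a E3 b IE3" by (rule tensor4_anti(2)[OF F])
    have 5: "F x a E3 b IE3 = - F x E3 a b IE3" by (rule tensor4_anti(1)[OF F])
    show ?thesis unfolding contracted_def 1 2 3 4 5 by simp
  qed
  have "2 * (slice \<sigma> F E3 x - \<i> * slice \<sigma> F IE3 x) + 2 * (1 + \<i> * \<sigma>) * bracket_correction F x =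
      slice_total \<sigma> F (\<lambda>x. E3) (\<lambda>x. E3) (\<lambda>x. \<i> *s E3) x -
      \<i> * slice_total \<sigma> F (\<lambda>x. IE3) (\<lambda>x. IE3) (\<lambda>x. \<i> *s IE3) x" for x
    unfolding slice_eq[OF F, of E3 \<sigma> x, simplified, symmetric] slice_eq[OF F, of IE3 \<sigma> x, simplified, symmetric]
      slice_correction_def eq0 eq1 contracted_def[symmetric] bracket_correction_def
    by (simp add: algebra_simps)
  then show ?thesis
    using null_diff[OF null_slice_total[OF F, of E3 \<sigma>] null_cmult[OF null_slice_total[OF F, of IE3 \<sigma>], of \<i>]]
    by simp
qed


section \<open>Four-forms as tensors, and the operators evaluated on the frame\<close>

definition tuple4 :: "'v \<Rightarrow> 'v \<Rightarrow> 'v \<Rightarrow> 'v \<Rightarrow> nat \<Rightarrow> 'v" where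
  "tuple4 a b c d = (\<lambda>i. if i = 0 then a else if i = 1 then b else if i = 2 then c else d)"

text \<open>Polarisation: the sum of the two vectors is inserted in both slots.\<close>

lemma alternating_swap:
  assumes "alternating_covector k \<alpha>" "i < k" "j < k" "i \<noteq> j"
  shows "\<alpha> (v(i := v j, j := v i)) = - \<alpha> v"
proof -
  have lin: "linear (\<lambda>u. \<alpha> (w(m := u)))" if "m < k" for w m
    using assms(1) that unfolding alternating_covector_def by blast
  have alt: "\<alpha> (v(i := u, j := u)) = 0" for u
  proof -
    have "(v(i := u, j := u)) i = (v(i := u, j := u)) j"
      using assms(4) by simp
    then show ?thesis
      using assms unfolding alternating_covector_def by blast
  qed
  define f where "f a b = \<alpha> (v(i := a, j := b))" for a b
  have f1: "f (a + a') b = f a b + f a' b" for a a' b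
    using linear_add[OF lin[OF assms(2), of "v(j := b)"]] assms(4)
    by (simp add: f_def fun_upd_twist)
  have f2: "f a (b + b') = f a b + f a b'" for a b b'
    using linear_add[OF lin[OF assms(3), of "v(i := a)"]] by (simp add: f_def)
  have f0: "f u u = 0" for u
    using alt by (simp only: f_def)
  have "f (v j) (v i) = - f (v i) (v j)"
    using f0[of "v i + v j"] unfolding f1 f2 f0[of "v i"] f0[of "v j"] by (simp add: eq_neg_iff_add_eq_0 add.commute)
  then show ?thesis
    by (simp add: f_def)
qed

lemma tensor4_form:
  assumes G: "invariant_form4 G"
  shows "tensor4 (\<lambda>x a b c d. G x (tuple4 a b c d))"
    and "G x v = G x (tuple4 (v 0) (v 1) (v 2) (v 3))"
proof -
  have alt: "alternating_covector 4 (G x)" for x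
    using G by (simp add: invariant_form4_def)
  have cong: "G x v = G x w" if "v 0 = w 0" "v 1 = w 1" "v 2 = w 2" "v 3 = w 3" for x v w
  proof -
    have "\<forall>i<4. v i = w i"
      using that by (auto simp: numeral_eq_Suc less_Suc_eq)
    then show ?thesis
      by (rule alt[of x, unfolded alternating_covector_def, THEN conjunct1, THEN spec, THEN spec, THEN mp])
  qed
  show "G x v = G x (tuple4 (v 0) (v 1) (v 2) (v 3))"
    by (rule cong) (simp_all add: tuple4_def)
  show "tensor4 (\<lambda>x a b c d. G x (tuple4 a b c d))"
    unfolding tensor4_def
  proof (intro conjI allI ballI)
    fix x a b c d
    show "linear (\<lambda>a. G x (tuple4 a b c d))"
    proof -
      have "linear (\<lambda>u. G x ((tuple4 a b c d)(0 := u)))"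
        using alt[of x, unfolded alternating_covector_def, THEN conjunct2, THEN conjunct1, rule_format, of 0]
        by simp
      moreover have "(tuple4 a b c d)(0 := u) = tuple4 u b c d" for u
        by (auto simp: tuple4_def)
      ultimately show ?thesis
        by simp
    qed
    show "G x (tuple4 b a c d) = - G x (tuple4 a b c d)"
      unfolding alternating_swap[OF alt, of 0 1, simplified, symmetric]
      by (rule cong) (simp_all add: tuple4_def)
    show "G x (tuple4 a c b d) = - G x (tuple4 a b c d)"
      unfolding alternating_swap[OF alt, of 1 2, simplified, symmetric]
      by (rule cong) (simp_all add: tuple4_def)
    show "G x (tuple4 a b d c) = - G x (tuple4 a b c d)"
      unfolding alternating_swap[OF alt, of 2 3, simplified, symmetric]
      by (rule cong) (simp_all add: tuple4_def)
  next
    fix a b c d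
    show "Ck_on (Suc 0) UNIV (\<lambda>x. G x (tuple4 a b c d))"
      using G[unfolded invariant_form4_def, THEN conjunct2, THEN conjunct1] by blast
  next
    fix l x a b c d assume "l \<in> lat"
    then have "G x (tuple4 a b c d) = G (act l x) (\<lambda>i. hol_act_deriv l (tuple4 a b c d i))"
      using G[unfolded invariant_form4_def, THEN conjunct2, THEN conjunct2] by blast
    also have "\<dots> = G (act l x) (tuple4 (hol_act_deriv l a) (hol_act_deriv l b) (hol_act_deriv l c) (hol_act_deriv l d))"
      by (rule cong) (simp_all add: tuple4_def)
    finally show "G x (tuple4 a b c d) =
      G (act l x) (tuple4 (hol_act_deriv l a) (hol_act_deriv l b) (hol_act_deriv l c) (hol_act_deriv l d))" .
  qed
qed

definition frame5 :: "complex^3 \<Rightarrow> complex^3 \<Rightarrow> nat \<Rightarrow> complex^3" where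
  "frame5 X x = (\<lambda>i. if i = 0 then fr1 x else if i = 1 then ifr1 x else if i = 2 then fr2 x
     else if i = 3 then ifr2 x else X)"

lemma slice_del:
  assumes "\<And>y v. H y v = F y (v 0) (v 1) (v 2) (v 3)"
  shows "del 4 H x (frame5 X x) = slice (- \<i>) F X x" "delbar 4 H x (frame5 X x) = slice \<i> F X x"
proof -
  have 4: "{..4::nat} = {0,1,2,3,4}" by auto
  show "del 4 H x (frame5 X x) = slice (- \<i>) F X x" "delbar 4 H x (frame5 X x) = slice \<i> F X x"
    unfolding del_def delbar_def slice_def part_type_eq[symmetric] frozen_def assms 4
    by (simp_all add: omit_def frame5_def)
qed


section \<open>Positivity\<close>

definition fund :: "(complex^3 \<Rightarrow> complex^3 \<Rightarrow> complex^3 \<Rightarrow> real) \<Rightarrow> complex^3 \<Rightarrow> complex^3 \<Rightarrow> complex^3 \<Rightarrow> complex" where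
  "fund K x u w = of_real (K x (\<i> *s u) w)"

definition fund_square where
  "fund_square K x a b c d = 2 * (fund K x a b * fund K x c d - fund K x a c * fund K x b d + fund K x a d * fund K x b c)"

lemma invariant_metric_D:
  assumes "invariant_metric K"
  shows "linear (K x u)" "K x u w = K x w u" "u \<noteq> 0 \<Longrightarrow> K x u u > 0" "K x (\<i> *s u) (\<i> *s w) = K x u w"
    "Ck_on (Suc 0) UNIV (\<lambda>x. K x u w)"
    "l \<in> lat \<Longrightarrow> K x u w = K (act l x) (hol_act_deriv l u) (hol_act_deriv l w)"
  using assms unfolding invariant_metric_def by blast+

lemma fund_anti: "invariant_metric K \<Longrightarrow> fund K x w u = - fund K x u w"
proof -
  assume K: "invariant_metric K"
  have "K x (\<i> *s w) u = K x (\<i> *s (\<i> *s w)) (\<i> *s u)"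
    by (rule invariant_metric_D(4)[OF K, symmetric])
  also have "\<dots> = K x (\<i> *s u) (- w)"
    unfolding i_smult by (rule invariant_metric_D(2)[OF K])
  also have "\<dots> = - K x (\<i> *s u) w"
    by (rule linear_neg[OF invariant_metric_D(1)[OF K]])
  finally show ?thesis
    by (simp add: fund_def)
qed

lemma tensor4_fund_square:
  assumes K: "invariant_metric K"
  shows "tensor4 (fund_square K)"
  unfolding tensor4_def
proof (intro conjI allI ballI)
  fix x a b c d
  have "K x (\<i> *s (u + v)) w = K x (\<i> *s u) w + K x (\<i> *s v) w"
    "K x (\<i> *s (r *\<^sub>R u)) w = r * K x (\<i> *s u) w" for u v w r
    using linear_add[OF invariant_metric_D(1)[OF K, of x w]] linear_scale[OF invariant_metric_D(1)[OF K, of x w]]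
    by (simp_all add: invariant_metric_D(2)[OF K, of x _ w] vector_add_ldistrib i_smult)
  then show "linear (\<lambda>a. fund_square K x a b c d)"
    by (simp add: linear_iff fund_square_def fund_def algebra_simps scaleR_conv_of_real)
  note anti = fund_anti[OF K, of x]
  show "fund_square K x b a c d = - fund_square K x a b c d"
    unfolding fund_square_def anti[of b a] by (simp add: algebra_simps)
  show "fund_square K x a c b d = - fund_square K x a b c d"
    unfolding fund_square_def anti[of c b] by (simp add: algebra_simps)
  show "fund_square K x a b d c = - fund_square K x a b c d"
    unfolding fund_square_def anti[of d c] by (simp add: algebra_simps)
next
  fix a b c d
  have "Ck_on (Suc 0) UNIV (\<lambda>x. fund K x u w)" for u w
    unfolding fund_def
    by (rule Ck_on_bounded_linear[OF open_UNIV bounded_linear_of_real invariant_metric_D(5)[OF K]])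
  then have C: "Ck_on (Suc 0) UNIV (\<lambda>x. fund K x u w * fund K x u' w')" for u w u' w'
    by (intro Ck_on_bounded_bilinear[OF open_UNIV bounded_bilinear_mult])
  have "Ck_on (Suc 0) UNIV (\<lambda>x. 2 * (fund K x a b * fund K x c d + (- 1) * (fund K x a c * fund K x b d)
      + fund K x a d * fund K x b c))"
    by (intro Ck_on_bounded_linear[OF open_UNIV bounded_linear_mult_right] Ck_on_add C open_UNIV)
  then show "Ck_on (Suc 0) UNIV (\<lambda>x. fund_square K x a b c d)"
    unfolding fund_square_def by simp
next
  fix l x a b c d assume l: "l \<in> lat"
  show "fund_square K x a b c d = fund_square K (act l x) (hol_act_deriv l a) (hol_act_deriv l b)
      (hol_act_deriv l c) (hol_act_deriv l d)"
    unfolding fund_square_def fund_def invariant_metric_D(6)[OF K l, of x] hol_act_deriv_smult ..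
qed

text \<open>This is the strict Bessel inequality for a vector outside the complex span of \<open>E\<close>.\<close>

lemma bessel_strict:
  assumes K: "invariant_metric K" and W: "\<And>r s. n *\<^sub>R W \<noteq> r *\<^sub>R E + s *\<^sub>R (\<i> *s E)"
    and n: "n = K x E E" "n > 0"
  shows "(K x E W)\<^sup>2 + (K x (\<i> *s E) W)\<^sup>2 < n * K x W W"
proof -
  define \<alpha> \<beta> where "\<alpha> = K x E W" and "\<beta> = K x (\<i> *s E) W"
  note lin = invariant_metric_D(1)[OF K, of x]
  have bil: "K x u (v + w) = K x u v + K x u w" "K x u (v - w) = K x u v - K x u w"
    "K x u (r *\<^sub>R v) = r * K x u v" for u v w r
    using linear_add[OF lin] linear_diff[OF lin] linear_scale[OF lin] by simp_all
  have bil': "K x (v + w) u = K x v u + K x w u" "K x (v - w) u = K x v u - K x w u"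
    "K x (r *\<^sub>R v) u = r * K x v u" for u v w r
    using bil[of u] invariant_metric_D(2)[OF K, of x _ u] by simp_all
  have E: "K x (\<i> *s E) (\<i> *s E) = n" "K x E (\<i> *s E) = 0" "K x (\<i> *s E) E = 0"
  proof -
    show "K x (\<i> *s E) (\<i> *s E) = n"
      using n invariant_metric_D(4)[OF K] by simp
    have "K x (\<i> *s E) E = - K x E (\<i> *s E)"
      using fund_anti[OF K, of x E E] invariant_metric_D(2)[OF K, of x "\<i> *s E" E] by (simp add: fund_def)
    then show "K x E (\<i> *s E) = 0" "K x (\<i> *s E) E = 0"
      using invariant_metric_D(2)[OF K, of x "\<i> *s E" E] by simp_all
  qed
  have sym: "K x W E = \<alpha>" "K x W (\<i> *s E) = \<beta>"
    unfolding \<alpha>_def \<beta>_def by (rule invariant_metric_D(2)[OF K])+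
  \<comment> \<open>\<open>n\<close> times the component of \<open>W\<close> orthogonal to
    \<open>E\<close> and \<open>\<i> *s E\<close>; the scaling avoids division.\<close>
  define Z where "Z = n *\<^sub>R W - (\<alpha> *\<^sub>R E + \<beta> *\<^sub>R (\<i> *s E))"
  have "Z \<noteq> 0"
    using W[of \<alpha> \<beta>] by (simp add: Z_def)
  then have "0 < K x Z Z"
    by (rule invariant_metric_D(3)[OF K])
  also have "K x Z Z = n * (n * K x W W - \<alpha>\<^sup>2 - \<beta>\<^sup>2)"
    unfolding Z_def bil bil' E sym \<alpha>_def[symmetric] \<beta>_def[symmetric] n(1)[symmetric]
    by (simp add: algebra_simps power2_eq_square)
  finally show ?thesis
    using n(2) by (simp add: zero_less_mult_iff \<alpha>_def \<beta>_def)
qed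

text \<open>Contracting the squared fundamental form with the fibre leaves a positive (1,1)-form on
  the base. Up to a factor, its product with the semi-positive form built from dv + dz is its value
  on the kernel of dv + dz. That kernel is spanned over the complex numbers by the image of
  \<open>W\<close>, and the value is a Bessel defect, positive because \<open>W\<close> is not a
  fibre vector.\<close>

lemma bracket_correction_pos:
  assumes K: "invariant_metric K"
  shows "Re (bracket_correction (fund_square K) x) > 0"
proof -
  define W where "W = fr1 x - fr2 x"
  define q where "q a b = 2 * (K x (\<i> *s E3) a * K x (\<i> *s b) IE3 - K x (\<i> *s E3) b * K x (\<i> *s a) IE3
      + K x (\<i> *s E3) IE3 * K x (\<i> *s a) b)" for a b
  have q: "contracted (fund_square K) x a b = of_real (q a b)" for a b
    by (simp add: contracted_def fund_square_def fund_def q_def)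
  note lin = invariant_metric_D(1)[OF K, of x]
  have bil: "K x u (v + w) = K x u v + K x u w" "K x u (v - w) = K x u v - K x u w" "K x u (- v) = - K x u v" for u v w
    using linear_add[OF lin] linear_diff[OF lin] linear_neg[OF lin] by simp_all
  have bil': "K x (v + w) u = K x v u + K x w u" "K x (v - w) u = K x v u - K x w u" "K x (- v) u = - K x v u" for u v w
    using bil[of u] invariant_metric_D(2)[OF K, of x _ u] by simp_all
  have J: "K x (\<i> *s u) (\<i> *s w) = K x u w" "K x IE3 (\<i> *s w) = K x E3 w" "K x (\<i> *s w) IE3 = K x w E3" for u w
    using invariant_metric_D(4)[OF K] unfolding i_E3(1)[symmetric] by simp_all
  have IE3: "K x IE3 IE3 = K x E3 E3"
    using J(1)[of E3 E3] by (simp add: i_E3)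
  have skew: "K x (\<i> *s u) w = - K x u (\<i> *s w)" for u w
    using J(1)[of u "\<i> *s w"] by (simp add: i_smult bil)
  \<comment> \<open>The values \<open>q\<close> are real, so the summands with the factor \<i> drop
    out.\<close>
  have "Re (bracket_correction (fund_square K) x) =
      q (fr2 x) (ifr2 x) + q (fr1 x) (ifr1 x) - q (fr1 x) (ifr2 x) + q (ifr1 x) (fr2 x)"
    unfolding bracket_correction_def q by simp
  also have "\<dots> = 2 * (K x E3 E3 * K x W W - (K x E3 W)\<^sup>2 - (K x IE3 W)\<^sup>2)"
    unfolding W_def q_def i_E3 IE3 bil bil' J i_smult
    using invariant_metric_D(2)[OF K, of x "fr1 x" E3] invariant_metric_D(2)[OF K, of x "fr2 x" E3]
      invariant_metric_D(2)[OF K, of x "fr1 x" IE3] invariant_metric_D(2)[OF K, of x "fr2 x" IE3]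
      invariant_metric_D(2)[OF K, of x "fr2 x" "fr1 x"]
    by (simp add: algebra_simps power2_eq_square)
  also have "\<dots> > 0"
  proof -
    have "E3 \<noteq> 0"
      by (metis E3_def vec3_nth(3) zero_index zero_neq_one)
    then have n: "K x E3 E3 > 0"
      by (rule invariant_metric_D(3)[OF K])
    have "K x E3 E3 *\<^sub>R W \<noteq> r *\<^sub>R E3 + s *\<^sub>R (\<i> *s E3)" for r s
    proof
      assume "K x E3 E3 *\<^sub>R W = r *\<^sub>R E3 + s *\<^sub>R (\<i> *s E3)"
      then have "(K x E3 E3 *\<^sub>R W) $ 1 = (r *\<^sub>R E3 + s *\<^sub>R (\<i> *s E3)) $ 1"
        by simp
      then show False
        using n by (simp add: W_def fr1_def fr2_def E3_def)
    qed
    from bessel_strict[OF K this refl n] show ?thesis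
      by (simp add: i_E3)
  qed
  finally show ?thesis .
qed

text \<open>The constant allows for both applications: \<open>c = 1\<close> with a
  \<open>delbar\<close>-primitive as \<open>F\<close>, and \<open>c = - 1\<close> with the squared
  fundamental form itself.\<close>

lemma no_invariant_solution:
  assumes K: "invariant_metric K" and F: "tensor4 F"
  shows "\<not> (\<forall>X x. slice (- \<i>) (fund_square K) X x = c * slice \<i> F X x)"
proof
  let ?K = "fund_square K"
  assume slices: "\<forall>X x. slice (- \<i>) ?K X x = c * slice \<i> F X x"
  \<comment> \<open>For \<sigma> = - \<i> the coefficient \<open>2 * (1 + \<i> * \<sigma>)\<close>
    is 4; in the next statement \<sigma> = \<i> makes it 0. Subtracting isolates the bracket
    term.\<close>
  have "null (\<lambda>x. 2 * (c * slice \<i> F E3 x - \<i> * (c * slice \<i> F IE3 x)) + 4 * bracket_correction ?K x)"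
    using null_bracket[OF tensor4_fund_square[OF K], of "- \<i>"] by (simp add: slices)
  moreover have "null (\<lambda>x. 2 * (c * slice \<i> F E3 x - \<i> * (c * slice \<i> F IE3 x)))"
    using null_cmult[OF null_bracket[OF F, of \<i>], of c] by (simp add: algebra_simps)
  ultimately have "null (\<lambda>x. 4 * bracket_correction ?K x)"
    using null_diff by fastforce
  then have "average (\<lambda>x. 4 * bracket_correction ?K x) = 0" "continuous_on UNIV (\<lambda>x. 4 * bracket_correction ?K x)"
    by (simp_all only: null_def)
  moreover have "Re (4 * bracket_correction ?K x) > 0" for x
    using bracket_correction_pos[OF K] by simp
  ultimately show False
    using average_nonzero by blast
qed

lemma slice_fund_square:
  "slice (- \<i>) (fund_square K) X x = del 4 (\<lambda>y. pf (\<lambda>u w. of_real (K y (\<i> *s u) w))) x (frame5 X x)"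
  "slice \<i> (fund_square K) X x = delbar 4 (\<lambda>y. pf (\<lambda>u w. of_real (K y (\<i> *s u) w))) x (frame5 X x)"
  by (rule slice_del[symmetric], simp add: pf_def fund_square_def fund_def)+

lemma no_strongly_gauduchon: "\<not> strongly_gauduchon_metric (nil_atlas 0) g"
proof
  assume "strongly_gauduchon_metric (nil_atlas 0) g"
  then obtain K G where K: "invariant_metric K" and G: "invariant_form4 G"
    and eq: "\<And>x v. del 4 (\<lambda>y. pf (\<lambda>u w. of_real (K y (\<i> *s u) w))) x v = delbar 4 G x v"
    by (rule strongly_gauduchon_cover) (rule that)
  have "slice (- \<i>) (fund_square K) X x = 1 * slice \<i> (\<lambda>x a b c d. G x (tuple4 a b c d)) X x" for X x
    unfolding slice_fund_square eq mult_1_left by (rule slice_del(2)) (rule tensor4_form(2)[OF G])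
  then show False
    using no_invariant_solution[OF K tensor4_form(1)[OF G], of 1] by blast
qed

lemma no_balanced: "\<not> balanced_metric (nil_atlas 0) g"
proof
  assume "balanced_metric (nil_atlas 0) g"
  then obtain K where K: "invariant_metric K"
    and eq: "\<And>x v. del 4 (\<lambda>y. pf (\<lambda>u w. of_real (K y (\<i> *s u) w))) x v =
      - delbar 4 (\<lambda>y. pf (\<lambda>u w. of_real (K y (\<i> *s u) w))) x v"
    by (rule balanced_cover) (rule that)
  have "slice (- \<i>) (fund_square K) X x = - 1 * slice \<i> (fund_square K) X x" for X x
    unfolding slice_fund_square eq by simp
  then show False
    using no_invariant_solution[OF K tensor4_fund_square[OF K], of "- 1"] by blast
qed

theorem theorem5p9:
  shows "(\<exists>(M :: (complex^3) topology) (J :: complex \<Rightarrow> (complex^3, 3) atlas).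
            holomorphic_family {a. norm a < 1} M J \<and>
            (\<forall>a\<in>{a. norm a < 1} - {0}. \<exists>g. balanced_metric (J a) g) \<and>
            \<not> (\<exists>g. strongly_gauduchon_metric (J 0) g)) \<and>
         \<not> closed_under_holomorphic_deformations
             (strongly_gauduchon_property :: (complex^3) topology \<Rightarrow> (complex^3, 3) atlas \<Rightarrow> bool) \<and>
         \<not> closed_under_holomorphic_deformations
             (balanced_property :: (complex^3) topology \<Rightarrow> (complex^3, 3) atlas \<Rightarrow> bool)"
proof (intro conjI)
  show "\<exists>(M :: (complex^3) topology) (J :: complex \<Rightarrow> (complex^3, 3) atlas).
      holomorphic_family {a. norm a < 1} M J \<and>
      (\<forall>a\<in>{a. norm a < 1} - {0}. \<exists>g. balanced_metric (J a) g) \<and>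
      \<not> (\<exists>g. strongly_gauduchon_metric (J 0) g)"
    using holomorphic_family_nil balanced_nil_metric no_strongly_gauduchon
    by (intro exI[of _ nil_top] exI[of _ nil_atlas]) blast
  have not_closed: "\<not> closed_under_holomorphic_deformations P"
    if "\<And>a. a \<in> unit_disc \<Longrightarrow> a \<noteq> 0 \<Longrightarrow> P nil_top (nil_atlas a)" "\<not> P nil_top (nil_atlas 0)"
    for P :: "(complex^3) topology \<Rightarrow> (complex^3, 3) atlas \<Rightarrow> bool"
  proof
    assume closed: "closed_under_holomorphic_deformations P"
    have ball: "ball (0::complex) 1 = unit_disc"
      by auto
    have "P nil_top (nil_atlas 0)"
      by (rule closed[unfolded closed_under_holomorphic_deformations_def, rule_format, of 1])
        (use holomorphic_family_nil that(1) in \<open>auto simp: ball\<close>)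
    with that(2) show False ..
  qed
  show "\<not> closed_under_holomorphic_deformations
      (strongly_gauduchon_property :: (complex^3) topology \<Rightarrow> (complex^3, 3) atlas \<Rightarrow> bool)"
    using strongly_gauduchon_nil_metric compact_complex_manifold_nil no_strongly_gauduchon
    by (intro not_closed) (auto simp: strongly_gauduchon_property_def)
  show "\<not> closed_under_holomorphic_deformations
      (balanced_property :: (complex^3) topology \<Rightarrow> (complex^3, 3) atlas \<Rightarrow> bool)"
    using balanced_nil_metric compact_complex_manifold_nil no_balanced
    by (intro not_closed) (auto simp: balanced_property_def)
qed

end
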